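(* Let $\tau>0$, $1\le p<\infty$, $c_p:=\big(1-\frac1{2p}\big)\big(\frac2p\big)^{\frac1{2p-1}}$, and let $\lambda,\lambda_0\in L^\infty(\mathbb{R})$. Assume that there exist a number $\alpha_0>0$ and a function $\beta_0\in L^p(\mathbb{R})$ such that $$\lambda_0(x)\ge\alpha_0-\beta_0(x)\quad\text{for a.e. }x\in\mathbb{R},\qquad\|\beta_0\|_p<\Big(\frac{\alpha_0}{c_p}\Big)^{1-\frac1{2p}}.$$ Assume that there exist a positive constant $\alpha$ and a function $\beta\in L^p(\mathbb{R})$ (same $p$) such that $$\frac{e^\tau+1}{2}|\lambda(x)|\le\alpha+\beta(x)\quad\text{for a.e. }x\in\mathbb{R}$$ with $$0\le\alpha<\alpha_0\quad\text{and}\quad\|\beta_0+\beta\|_p<\Big(\frac{\alpha_0-\alpha}{c_p}\Big)^{1-\frac1{2p}}.$$ Then the problem $$\begin{cases} u_t(x,t)+u_{xxx}(x,t)-u_{xx}(x,t)+\lambda_0(x)u(x,t)+\lambda(x)u(x,t-\tau)=0 & \text{in } \mathbb{R}\times(0,\infty),\\ u(x,s)=u_0(x,s) & \text{in } \mathbb{R}\times[-\tau,0] \end{cases}$$ is exponentially stable. In particular, for every $u_0\in C([-\tau,0];L^2(\mathbb{R}))$ the solution $u$ satisfies $$\mathcal{E}(t)\le C(u_0)e^{-\tilde\gamma t}\quad\text{for all }t\ge0,$$ where $$\tilde\gamma=\min\Big\{2\Big(\alpha_0-\alpha-\frac{2p-1}{2p}\Big(\frac2p\Big)^{\frac1{2p-1}}\|\beta+\beta_0\|_p^{\frac{2p}{2p-1}}\Big),\,1\Big\}$$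 and $$C(u_0)=\mathcal{E}(0)=\frac12\|u_0(\cdot,0)\|_2^2+\frac12\int_{-\tau}^0e^s\int_{\mathbb{R}}|\lambda(x)|u_0^2(x,s)\,dx\,ds.$$
   Context: All functions are real-valued; $\|\cdot\|_p$ is the norm of $L^p(\mathbb{R})$. For $t\ge0$, $$\mathcal{E}(t):=\frac12\int_{\mathbb{R}}u^2(x,t)\,dx+\frac12\int_{t-\tau}^t\int_{\mathbb{R}}e^{-(t-s)}|\lambda(x)|u^2(x,s)\,dx\,ds,$$ where $u=u_0$ on $[-\tau,0]$. The operator $A_{\lambda_0}u:=-u_{xxx}+u_{xx}-\lambda_0u$, $\mathcal{D}(A_{\lambda_0})=H^3(\mathbb{R})$, generates a strongly continuous semigroup $(S(t))_{t\ge0}$ in $L^2(\mathbb{R})$ (known). The solution is the unique mild solution $u\in C([-\tau,\infty);L^2(\mathbb{R}))$: $u=u_0$ on $[-\tau,0]$ and $u(t)=S(t)u_0(0)-\int_0^tS(t-s)\lambda u(s-\tau)\,ds$ for $t\ge0$. Exponentially stable means that $\mathcal{E}$ decays exponentially along all solutions: there is $\gamma>0$ such that every solution satisfies $\mathcal{E}(t)\le Ce^{-\gamma t}$ for all $t\ge0$, with $C$ depending only on the initial datum $u_0$. *)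

theory Defs
  imports "HOL-Analysis.Analysis"
begin

section \<open>The Hilbert space of square-integrable functions on the real line\<close>

definition sq_integrable :: "(real \<Rightarrow> real) \<Rightarrow> bool" where
  "sq_integrable f \<longleftrightarrow> f \<in> borel_measurable lborel \<and> integrable lborel (\<lambda>x. (f x)\<^sup>2)"

lemma sq_integrable_measurable: "sq_integrable f \<Longrightarrow> f \<in> borel_measurable lborel"
  by (simp add: sq_integrable_def)

lemma sq_integrable_0: "sq_integrable (\<lambda>x. 0)"
  by (simp add: sq_integrable_def)

lemma sq_integrable_mult:
  assumes "sq_integrable f" "sq_integrable g"
  shows "integrable lborel (\<lambda>x. f x * g x)"
proof (rule Bochner_Integration.integrable_bound)
  show "integrable lborel (\<lambda>x. (f x)\<^sup>2 + (g x)\<^sup>2)"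
    using assms by (auto simp: sq_integrable_def)
  show "(\<lambda>x. f x * g x) \<in> borel_measurable lborel"
    using assms by (auto simp: sq_integrable_def)
  have "\<bar>a * b\<bar> \<le> a\<^sup>2 + b\<^sup>2" for a b :: real
    using sum_squares_bound[of "\<bar>a\<bar>" "\<bar>b\<bar>"] abs_ge_zero[of "a * b"]
    unfolding abs_mult power2_abs by linarith
  then show "AE x in lborel. norm (f x * g x) \<le> norm ((f x)\<^sup>2 + (g x)\<^sup>2)"
    by simp
qed

lemma sq_integrable_add:
  assumes "sq_integrable f" "sq_integrable g"
  shows "sq_integrable (\<lambda>x. f x + g x)"
proof -
  have "integrable lborel (\<lambda>x. (f x)\<^sup>2 + (g x)\<^sup>2 + 2 * (f x * g x))"
    using assms sq_integrable_mult[OF assms] by (auto simp: sq_integrable_def)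
  then have "integrable lborel (\<lambda>x. (f x + g x)\<^sup>2)"
    by (simp add: power2_sum mult.assoc)
  then show ?thesis
    using assms by (auto simp: sq_integrable_def)
qed

lemma sq_integrable_cmult: "sq_integrable f \<Longrightarrow> sq_integrable (\<lambda>x. c * f x)"
  by (auto simp: sq_integrable_def power_mult_distrib)

definition sq_eq :: "(real \<Rightarrow> real) \<Rightarrow> (real \<Rightarrow> real) \<Rightarrow> bool" where
  "sq_eq f g \<longleftrightarrow> sq_integrable f \<and> sq_integrable g \<and> (AE x in lborel. f x = g x)"

quotient_type L2 = "real \<Rightarrow> real" / partial: sq_eq
proof (rule part_equivpI)
  show "\<exists>f. sq_eq f f"
    using sq_integrable_0 by (auto simp: sq_eq_def)
  show "symp sq_eq"
    by (auto simp: symp_def sq_eq_def elim: eventually_mono)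
  show "transp sq_eq"
  proof (rule transpI)
    fix f g h assume "sq_eq f g" "sq_eq g h"
    then show "sq_eq f h"
      by (auto simp: sq_eq_def elim: eventually_elim2)
  qed
qed

lemma sq_integrable_rep: "sq_integrable (rep_L2 f)"
  using Quotient3_rep_reflp[OF Quotient3_L2, of f] by (simp add: sq_eq_def)

lemma rep_abs_L2:
  assumes "sq_integrable f"
  shows "AE x in lborel. rep_L2 (abs_L2 f) x = f x"
proof -
  have "sq_eq f f" using assms by (simp add: sq_eq_def)
  then have "sq_eq (rep_L2 (abs_L2 f)) f"
    by (rule rep_abs_rsp_left[OF Quotient3_L2])
  then show ?thesis by (simp add: sq_eq_def)
qed

instantiation L2 :: real_inner
begin

lift_definition zero_L2 :: L2 is "\<lambda>x. 0"
  by (simp add: sq_eq_def sq_integrable_0)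

lift_definition plus_L2 :: "L2 \<Rightarrow> L2 \<Rightarrow> L2" is "\<lambda>f g x. f x + g x"
  by (auto simp: sq_eq_def sq_integrable_add elim: eventually_elim2)

lift_definition scaleR_L2 :: "real \<Rightarrow> L2 \<Rightarrow> L2" is "\<lambda>c f x. c * f x"
  by (auto simp: sq_eq_def sq_integrable_cmult elim: eventually_mono)

lift_definition uminus_L2 :: "L2 \<Rightarrow> L2" is "\<lambda>f x. - f x"
  using sq_integrable_cmult[of _ "-1"] by (auto simp: sq_eq_def elim: eventually_mono)

definition minus_L2 :: "L2 \<Rightarrow> L2 \<Rightarrow> L2" where
  "minus_L2 f g = f + - g"

lift_definition inner_L2 :: "L2 \<Rightarrow> L2 \<Rightarrow> real" is "\<lambda>f g. LINT x|lborel. f x * g x"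
proof -
  fix f f' g g' assume *: "sq_eq f f'" "sq_eq g g'"
  then have "AE x in lborel. f x * g x = f' x * g' x"
    by (auto simp: sq_eq_def elim: eventually_elim2)
  with * show "(LINT x|lborel. f x * g x) = (LINT x|lborel. f' x * g' x)"
    by (intro integral_cong_AE) (auto simp: sq_eq_def sq_integrable_def)
qed

definition norm_L2 :: "L2 \<Rightarrow> real" where
  "norm_L2 f = sqrt (inner f f)"

definition sgn_L2 :: "L2 \<Rightarrow> L2" where
  "sgn_L2 f = scaleR (inverse (norm f)) f"

definition dist_L2 :: "L2 \<Rightarrow> L2 \<Rightarrow> real" where
  "dist_L2 f g = norm (f - g)"

definition uniformity_L2 :: "(L2 \<times> L2) filter" where
  "uniformity_L2 = (INF e\<in>{0 <..}. principal {(f, g). dist f g < e})"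

definition open_L2 :: "L2 set \<Rightarrow> bool" where
  "open_L2 U \<longleftrightarrow> (\<forall>f\<in>U. eventually (\<lambda>(f', g). f' = f \<longrightarrow> g \<in> U) uniformity)"

instance
proof
  fix f g h :: L2 and a b :: real and U :: "L2 set"
  show "f + g + h = f + (g + h)"
    by transfer (auto simp: sq_eq_def add.assoc intro!: sq_integrable_add)
  show "f + g = g + f"
    by transfer (auto simp: sq_eq_def add.commute intro!: sq_integrable_add)
  show "0 + f = f"
    by transfer (auto simp: sq_eq_def)
  show "- f + f = 0"
    using sq_integrable_cmult[of _ "-1"]
    by transfer (auto simp: sq_eq_def sq_integrable_0)
  show "f - g = f + - g"
    by (simp add: minus_L2_def)
  show "a *\<^sub>R (f + g) = a *\<^sub>R f + a *\<^sub>R g"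
    by transfer (auto simp: sq_eq_def distrib_left intro!: sq_integrable_add sq_integrable_cmult)
  show "(a + b) *\<^sub>R f = a *\<^sub>R f + b *\<^sub>R f"
    by transfer (auto simp: sq_eq_def distrib_right intro!: sq_integrable_add sq_integrable_cmult)
  show "a *\<^sub>R b *\<^sub>R f = (a * b) *\<^sub>R f"
    by transfer (auto simp: sq_eq_def mult.assoc intro!: sq_integrable_cmult)
  show "1 *\<^sub>R f = f"
    by transfer (auto simp: sq_eq_def)
  show "inner f g = inner g f"
    by transfer (simp add: mult.commute)
  show "inner (f + g) h = inner f h + inner g h"
    by transfer (simp add: sq_eq_def distrib_right sq_integrable_mult)
  show "inner (a *\<^sub>R f) g = a * inner f g"
    by transfer (simp add: mult.assoc)
  show "0 \<le> inner f f"
    by transfer (simp add: integral_nonneg_AE)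
  show "inner f f = 0 \<longleftrightarrow> f = 0"
    by transfer (auto simp: sq_eq_def sq_integrable_0 integral_nonneg_eq_0_iff_AE sq_integrable_mult)
  show "norm f = sqrt (inner f f)"
    by (simp add: norm_L2_def)
  show "sgn f = scaleR (inverse (norm f)) f"
    by (simp add: sgn_L2_def)
  show "dist f g = norm (f - g)"
    by (simp add: dist_L2_def)
  show "(uniformity :: (L2 \<times> L2) filter) = (INF e\<in>{0 <..}. principal {(f, g). dist f g < e})"
    by (simp add: uniformity_L2_def)
  show "open U \<longleftrightarrow> (\<forall>f\<in>U. eventually (\<lambda>(f', g). f' = f \<longrightarrow> g \<in> U) uniformity)"
    by (simp add: open_L2_def)
qed

end

lemma inner_L2_eq: "inner f g = (LINT x|lborel. rep_L2 f x * rep_L2 g x)" for f g :: L2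
  by (simp add: inner_L2_def)

lemma norm_L2_sq: "(norm f)\<^sup>2 = (LINT x|lborel. (rep_L2 f x)\<^sup>2)" for f :: L2
  unfolding power2_norm_eq_inner inner_L2_eq by (simp add: power2_eq_square)

lemma rep_diff_L2:
  "AE x in lborel. rep_L2 (f - g) x = rep_L2 f x - rep_L2 g x"
proof -
  have "sq_integrable (\<lambda>x. - rep_L2 g x)"
    using sq_integrable_cmult[OF sq_integrable_rep, of "-1" g] by simp
  then have *: "AE x in lborel. rep_L2 (- g) x = - rep_L2 g x"
    unfolding uminus_L2_def by (simp add: rep_abs_L2)
  have "AE x in lborel. rep_L2 (f + - g) x = rep_L2 f x + rep_L2 (- g) x"
    unfolding plus_L2_def by (simp add: rep_abs_L2 sq_integrable_add sq_integrable_rep)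
  with * show ?thesis
    unfolding minus_L2_def by eventually_elim simp
qed

lemma norm_diff_L2_nn:
  "(\<integral>\<^sup>+x. ennreal ((rep_L2 f x - rep_L2 g x)\<^sup>2) \<partial>lborel) = ennreal ((norm (f - g))\<^sup>2)"
proof -
  have "(\<integral>\<^sup>+x. ennreal ((rep_L2 f x - rep_L2 g x)\<^sup>2) \<partial>lborel)
      = (\<integral>\<^sup>+x. ennreal ((rep_L2 (f - g) x)\<^sup>2) \<partial>lborel)"
    using rep_diff_L2[of f g] by (intro nn_integral_cong_AE) (auto elim: eventually_mono)
  also have "\<dots> = ennreal (LINT x|lborel. (rep_L2 (f - g) x)\<^sup>2)"
    using sq_integrable_rep[of "f - g"]
    by (intro nn_integral_eq_integral) (auto simp: sq_integrable_def)
  finally show ?thesis by (simp add: norm_L2_sq)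
qed

text \<open>Riesz--Fischer.\<close>

instance L2 :: banach
proof
  fix X :: "nat \<Rightarrow> L2"
  assume X: "Cauchy X"
  have "\<exists>N. \<forall>m\<ge>N. \<forall>n\<ge>N. norm (X m - X n) < (1/4) ^ k" for k
    using X by (auto simp: Cauchy_iff)
  then obtain N where N: "\<And>k m n. m \<ge> N k \<Longrightarrow> n \<ge> N k \<Longrightarrow> norm (X m - X n) < (1/4) ^ k"
    by metis
  define r where "r k = (\<Sum>i\<le>k. Suc (N i))" for k
  have rN: "N k \<le> r k" for k
    unfolding r_def using member_le_sum[of k "{..k}" "\<lambda>i. Suc (N i)"] by simp
  have r: "strict_mono r"
    by (rule strict_mono_Suc_iff[THEN iffD2]) (simp add: r_def)
  have rmono: "r k \<le> r (Suc k)" for k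
    using r by (simp add: strict_mono_less_eq)
  define F where "F k = rep_L2 (X (r k))" for k
  have Fsq: "sq_integrable (F k)" for k
    by (simp add: F_def sq_integrable_rep)
  have Fm[measurable]: "F k \<in> borel_measurable lborel" for k
    using Fsq by (rule sq_integrable_measurable)
  have Fnorm: "(\<integral>\<^sup>+x. ennreal ((F j x - F k x)\<^sup>2) \<partial>lborel) = ennreal ((norm (X (r j) - X (r k)))\<^sup>2)" for j k
    unfolding F_def by (rule norm_diff_L2_nn)
  define G where "G k x = ennreal (4 ^ k * (F (Suc k) x - F k x)\<^sup>2)" for k x
  have Gm[measurable]: "G k \<in> borel_measurable lborel" for k
    unfolding G_def by measurable
  have G: "(\<integral>\<^sup>+x. G k x \<partial>lborel) \<le> ennreal ((1/4) ^ k)" for k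
  proof -
    have "(\<integral>\<^sup>+x. G k x \<partial>lborel) = ennreal (4 ^ k) * (\<integral>\<^sup>+x. ennreal ((F (Suc k) x - F k x)\<^sup>2) \<partial>lborel)"
      unfolding G_def by (simp add: ennreal_mult nn_integral_cmult)
    also have "\<dots> = ennreal (4 ^ k * (norm (X (r (Suc k)) - X (r k)))\<^sup>2)"
      by (simp add: Fnorm ennreal_mult)
    also have "\<dots> \<le> ennreal (4 ^ k * ((1/4) ^ k)\<^sup>2)"
    proof (intro ennreal_leI mult_left_mono power_mono)
      show "norm (X (r (Suc k)) - X (r k)) \<le> (1/4) ^ k"
        using N[of k "r (Suc k)" "r k"] rN[of k] rmono[of k] by simp
    qed auto
    also have "4 ^ k * ((1/4) ^ k)\<^sup>2 = (1/4 :: real) ^ k"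
      by (simp add: power2_eq_square flip: power_mult_distrib)
    finally show ?thesis .
  qed
  have "(\<integral>\<^sup>+x. (\<Sum>k. G k x) \<partial>lborel) = (\<Sum>k. \<integral>\<^sup>+x. G k x \<partial>lborel)"
    by (rule nn_integral_suminf) measurable
  also have "\<dots> \<le> (\<Sum>k. ennreal ((1/4) ^ k))"
    by (intro suminf_le G) auto
  also have "\<dots> = ennreal (\<Sum>k. (1/4) ^ k)"
    by (intro suminf_ennreal2) (auto intro: summable_geometric)
  also have "\<dots> < \<infinity>" by simp
  finally have "(\<integral>\<^sup>+x. (\<Sum>k. G k x) \<partial>lborel) \<noteq> \<infinity>" by simp
  then have "AE x in lborel. (\<Sum>k. G k x) \<noteq> \<infinity>"
    by (intro nn_integral_PInf_AE) auto
  then have AEconv: "AE x in lborel. convergent (\<lambda>k. F k x)"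
  proof eventually_elim
    case (elim x)
    then have s: "summable (\<lambda>k. 4 ^ k * (F (Suc k) x - F k x)\<^sup>2)"
      unfolding G_def by (intro summable_suminf_not_top) auto
    have "summable (\<lambda>k. (4 ^ k * (F (Suc k) x - F k x)\<^sup>2 + (1/4) ^ k) :: real)"
      by (intro summable_add s summable_geometric) simp
    then have "summable (\<lambda>k. F (Suc k) x - F k x)"
    proof (rule summable_comparison_test'[where N = 0])
      fix k :: nat
      define d where "d = \<bar>F (Suc k) x - F k x\<bar>"
      have "2 * (2 ^ k * d) * (1/2) ^ k \<le> (2 ^ k * d)\<^sup>2 + ((1/2) ^ k)\<^sup>2"
        by (rule sum_squares_bound)
      moreover have "2 * (2 ^ k * d) * (1/2) ^ k = 2 * d"
        by (simp add: power_one_over)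
      moreover have "(2 ^ k * d)\<^sup>2 = 4 ^ k * (F (Suc k) x - F k x)\<^sup>2"
      proof -
        have "((2 :: real) ^ k)\<^sup>2 = 4 ^ k"
          by (simp add: power2_eq_square flip: power_mult_distrib)
        then show ?thesis
          by (simp only: d_def power_mult_distrib power2_abs)
      qed
      moreover have "((1/2) ^ k)\<^sup>2 = (1/4 :: real) ^ k"
        by (simp add: power2_eq_square flip: power_mult_distrib)
      moreover have "0 \<le> d" by (simp add: d_def)
      ultimately have "d \<le> 4 ^ k * (F (Suc k) x - F k x)\<^sup>2 + (1/4) ^ k"
        by linarith
      then show "norm (F (Suc k) x - F k x) \<le> 4 ^ k * (F (Suc k) x - F k x)\<^sup>2 + (1/4) ^ k"
        by (simp add: d_def)
    qed
    then have "convergent (\<lambda>n. \<Sum>k<n. F (Suc k) x - F k x)"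
      by (simp add: summable_iff_convergent)
    then have "convergent (\<lambda>n. F n x - F 0 x)"
      by (simp only: sum_lessThan_telescope[of "\<lambda>k. F k x"])
    then have "convergent (\<lambda>n. (F n x - F 0 x) + F 0 x)"
      by (rule convergent_add) (rule convergent_const)
    then show "convergent (\<lambda>k. F k x)" by simp
  qed
  define L where "L x = lim (\<lambda>k. F k x)" for x
  have Lm[measurable]: "L \<in> borel_measurable lborel"
    unfolding L_def by measurable
  have L: "AE x in lborel. (\<lambda>k. F k x) \<longlonglongrightarrow> L x"
    using AEconv by eventually_elim (simp add: L_def convergent_LIMSEQ_iff)
  have bound: "(\<integral>\<^sup>+x. ennreal ((L x - F k x)\<^sup>2) \<partial>lborel) \<le> ennreal (((1/4) ^ k)\<^sup>2)" for k
  proof -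
    have "(\<integral>\<^sup>+x. ennreal ((L x - F k x)\<^sup>2) \<partial>lborel)
        = (\<integral>\<^sup>+x. liminf (\<lambda>j. ennreal ((F j x - F k x)\<^sup>2)) \<partial>lborel)"
    proof (rule nn_integral_cong_AE, use L in eventually_elim)
      case (elim x)
      then have "(\<lambda>j. ennreal ((F j x - F k x)\<^sup>2)) \<longlonglongrightarrow> ennreal ((L x - F k x)\<^sup>2)"
        by (intro tendsto_intros)
      then show ?case
        using lim_imp_Liminf[OF trivial_limit_sequentially] by metis
    qed
    also have "\<dots> \<le> liminf (\<lambda>j. \<integral>\<^sup>+x. ennreal ((F j x - F k x)\<^sup>2) \<partial>lborel)"
      by (rule nn_integral_liminf) measurable
    also have "\<dots> \<le> liminf (\<lambda>j. ennreal (((1/4) ^ k)\<^sup>2))"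
    proof (rule Liminf_mono)
      show "\<forall>\<^sub>F j in sequentially. (\<integral>\<^sup>+x. ennreal ((F j x - F k x)\<^sup>2) \<partial>lborel) \<le> ennreal (((1/4) ^ k)\<^sup>2)"
        using eventually_ge_at_top[of k]
      proof eventually_elim
        case (elim j)
        then have "r k \<le> r j" using r by (simp add: strict_mono_less_eq)
        then have "norm (X (r j) - X (r k)) \<le> (1/4) ^ k"
          using N[of k "r j" "r k"] rN[of k] by simp
        then show ?case
          by (simp add: Fnorm power_mono ennreal_leI)
      qed
    qed
    also have "\<dots> = ennreal (((1/4) ^ k)\<^sup>2)"
      by (simp add: Liminf_const)
    finally show ?thesis .
  qed
  have dsq: "sq_integrable (\<lambda>x. L x - F k x)" for k
    unfolding sq_integrable_def
  proof
    show "integrable lborel (\<lambda>x. (L x - F k x)\<^sup>2)"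
      using bound[of k] by (intro integrableI_nonneg) (auto intro: le_less_trans)
  qed measurable
  have Lsq: "sq_integrable L"
    using sq_integrable_add[OF dsq[of 0] Fsq[of 0]] by simp
  define l where "l = abs_L2 L"
  have l: "AE x in lborel. rep_L2 l x = L x"
    unfolding l_def by (rule rep_abs_L2[OF Lsq])
  have conv: "norm (X (r k) - l) \<le> (1/4) ^ k" for k
  proof -
    have "ennreal ((norm (l - X (r k)))\<^sup>2) = (\<integral>\<^sup>+x. ennreal ((rep_L2 l x - F k x)\<^sup>2) \<partial>lborel)"
      unfolding F_def by (rule norm_diff_L2_nn[symmetric])
    also have "\<dots> = (\<integral>\<^sup>+x. ennreal ((L x - F k x)\<^sup>2) \<partial>lborel)"
      using l by (intro nn_integral_cong_AE) (auto elim: eventually_mono)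
    also have "\<dots> \<le> ennreal (((1/4) ^ k)\<^sup>2)" by (rule bound)
    finally have "(norm (l - X (r k)))\<^sup>2 \<le> ((1/4) ^ k)\<^sup>2"
      by (simp add: ennreal_le_iff)
    then have "norm (l - X (r k)) \<le> (1/4) ^ k"
      by (rule power2_le_imp_le) simp
    then show ?thesis by (simp add: norm_minus_commute)
  qed
  have "(\<lambda>k. X (r k) - l) \<longlonglongrightarrow> 0"
    by (rule Lim_null_comparison[OF always_eventually[OF allI[OF conv]]])
       (simp add: LIMSEQ_realpow_zero)
  then have "(X \<circ> r) \<longlonglongrightarrow> l"
    by (simp add: LIM_zero_iff o_def)
  then show "convergent X"
    using X r by (metis Cauchy_converges_subseq convergentI)
qed

section \<open>Lebesgue spaces of coefficients\<close>

text \<open>The coefficients are kept as functions; every hypothesis on them is insensitive to null sets.\<close>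

definition Linfty :: "(real \<Rightarrow> real) set" where
  "Linfty = {a \<in> borel_measurable lborel. \<exists>M. AE x in lborel. \<bar>a x\<bar> \<le> M}"

definition Lp :: "real \<Rightarrow> (real \<Rightarrow> real) set" where
  "Lp p = {b \<in> borel_measurable lborel. integrable lborel (\<lambda>x. \<bar>b x\<bar> powr p)}"

definition Lp_norm :: "real \<Rightarrow> (real \<Rightarrow> real) \<Rightarrow> real" where
  "Lp_norm p b = (LINT x|lborel. \<bar>b x\<bar> powr p) powr (1 / p)"

text \<open>Multiplication by a bounded function; a junk value unless \<open>a \<in> Linfty\<close>.\<close>

definition mult_L2 :: "(real \<Rightarrow> real) \<Rightarrow> L2 \<Rightarrow> L2" where
  "mult_L2 a f = abs_L2 (\<lambda>x. a x * rep_L2 f x)"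

section \<open>Weak derivatives and the generator\<close>

definition test_function :: "(real \<Rightarrow> real) \<Rightarrow> bool" where
  "test_function \<phi> \<longleftrightarrow>
     (\<forall>n x. (deriv ^^ n) \<phi> differentiable (at x)) \<and> compact (closure {x. \<phi> x \<noteq> 0})"

definition weak_deriv :: "nat \<Rightarrow> L2 \<Rightarrow> L2 \<Rightarrow> bool" where
  "weak_deriv k f g \<longleftrightarrow>
     (\<forall>\<phi>. test_function \<phi> \<longrightarrow>
        (LINT x|lborel. rep_L2 f x * (deriv ^^ k) \<phi> x)
          = (- 1) ^ k * (LINT x|lborel. rep_L2 g x * \<phi> x))"

definition sobolev_H :: "nat \<Rightarrow> L2 set" where
  "sobolev_H m = {f. \<forall>k\<le>m. \<exists>g. weak_deriv k f g}"

text \<open>Unbounded operators are represented by their graphs.\<close>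

definition A_op :: "(real \<Rightarrow> real) \<Rightarrow> (L2 \<times> L2) set" where
  "A_op lam0 = {(f, - f3 + f2 - mult_L2 lam0 f) |f f2 f3.
     f \<in> sobolev_H 3 \<and> weak_deriv 2 f f2 \<and> weak_deriv 3 f f3}"

definition C0_semigroup :: "(real \<Rightarrow> 'a \<Rightarrow>\<^sub>L 'a :: banach) \<Rightarrow> bool" where
  "C0_semigroup S \<longleftrightarrow>
     S 0 = id_blinfun \<and>
     (\<forall>s\<ge>0. \<forall>t\<ge>0. S (s + t) = S s o\<^sub>L S t) \<and>
     (\<forall>f. ((\<lambda>t. blinfun_apply (S t) f) \<longlongrightarrow> f) (at_right 0))"

definition generator :: "(real \<Rightarrow> 'a \<Rightarrow>\<^sub>L 'a :: banach) \<Rightarrow> ('a \<times> 'a) set" where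
  "generator S =
     {(f, g). ((\<lambda>h. (blinfun_apply (S h) f - f) /\<^sub>R h) \<longlongrightarrow> g) (at_right 0)}"

definition generates :: "('a \<times> 'a) set \<Rightarrow> (real \<Rightarrow> 'a \<Rightarrow>\<^sub>L 'a :: banach) \<Rightarrow> bool" where
  "generates A S \<longleftrightarrow> C0_semigroup S \<and> generator S = A"

section \<open>The delayed problem\<close>

text \<open>
  \<open>S\<close> is the semigroup generated by \<open>A_op lam0\<close>, through which \<open>lam0\<close> enters. The
  integral is the Banach-space valued gauge integral; its integrand is continuous on \<open>{0..t}\<close>.
\<close>

definition mild_solution ::
  "real \<Rightarrow> (real \<Rightarrow> L2 \<Rightarrow>\<^sub>L L2) \<Rightarrow> (real \<Rightarrow> real) \<Rightarrow> (real \<Rightarrow> L2) \<Rightarrow> (real \<Rightarrow> L2) \<Rightarrow> bool" where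
  "mild_solution \<tau> S lam u0 u \<longleftrightarrow>
     continuous_on {- \<tau>..} u \<and>
     (\<forall>s\<in>{- \<tau>..0}. u s = u0 s) \<and>
     (\<forall>t\<ge>0. u t = blinfun_apply (S t) (u0 0)
        - integral {0..t} (\<lambda>s. blinfun_apply (S (t - s)) (mult_L2 lam (u (s - \<tau>)))))"

definition energy :: "real \<Rightarrow> (real \<Rightarrow> real) \<Rightarrow> (real \<Rightarrow> L2) \<Rightarrow> real \<Rightarrow> real" where
  "energy \<tau> lam u t =
     1 / 2 * (LINT x|lborel. (rep_L2 (u t) x)\<^sup>2)
     + 1 / 2 * (LINT s:{t - \<tau>..t}|lborel.
         exp (- (t - s)) * (LINT x|lborel. \<bar>lam x\<bar> * (rep_L2 (u s) x)\<^sup>2))"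

definition exponentially_stable ::
  "real \<Rightarrow> (real \<Rightarrow> L2 \<Rightarrow>\<^sub>L L2) \<Rightarrow> (real \<Rightarrow> real) \<Rightarrow> bool" where
  "exponentially_stable \<tau> S lam \<longleftrightarrow>
     (\<exists>\<gamma>>0. \<exists>C :: (real \<Rightarrow> L2) \<Rightarrow> real. \<forall>u0 u.
        continuous_on {- \<tau>..0} u0 \<longrightarrow> mild_solution \<tau> S lam u0 u \<longrightarrow>
          (\<forall>t\<ge>0. energy \<tau> lam u t \<le> C u0 * exp (- \<gamma> * t)))"

definition c_const :: "real \<Rightarrow> real" where
  "c_const p = (1 - 1 / (2 * p)) * (2 / p) powr (1 / (2 * p - 1))"

definition gamma_rate :: "real \<Rightarrow> real \<Rightarrow> real \<Rightarrow> (real \<Rightarrow> real) \<Rightarrow> (real \<Rightarrow> real) \<Rightarrow> real" where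
  "gamma_rate p \<alpha>0 \<alpha> \<beta>0 \<beta> =
     min (2 * (\<alpha>0 - \<alpha> - (2 * p - 1) / (2 * p) * (2 / p) powr (1 / (2 * p - 1))
                 * Lp_norm p (\<lambda>x. \<beta> x + \<beta>0 x) powr (2 * p / (2 * p - 1)))) 1"

definition C_init :: "real \<Rightarrow> (real \<Rightarrow> real) \<Rightarrow> (real \<Rightarrow> L2) \<Rightarrow> real" where
  "C_init \<tau> lam u0 =
     1 / 2 * (norm (u0 0))\<^sup>2
     + 1 / 2 * (LINT s:{- \<tau>..0}|lborel.
         exp s * (LINT x|lborel. \<bar>lam x\<bar> * (rep_L2 (u0 s) x)\<^sup>2))"

end

theory Submission
  imports Defs
begin

text \<open>
The energy inequality comes from the elliptic part alone. For \<open>f\<close> in \<open>H\<^sup>3\<close> the dispersive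
term drops out, \<open>\<integral> f''' f = 0\<close>, and \<open>\<integral> f'' f = - \<integral> f'\<^sup>2\<close>, so
\<open>\<langle>A f, f\<rangle> = - \<integral> f'\<^sup>2 - \<integral> \<lambda>\<^sub>0 f\<^sup>2\<close>. The delay costs \<open>(e\<^sup>\<tau> + 1) / 2 * |\<lambda>|\<close>, and
\<open>(e\<^sup>\<tau> + 1) / 2 * |\<lambda>| - \<lambda>\<^sub>0\<close> is at most \<open>\<alpha> - \<alpha>\<^sub>0 + |\<beta> + \<beta>\<^sub>0|\<close> by hypothesis. An
\<open>L\<^sup>p\<close> potential is form-bounded with relative bound one: \<open>\<integral> |b| f\<^sup>2 \<le> \<integral> f'\<^sup>2 + K \<integral> f\<^sup>2\<close> with
\<open>K\<close> exactly the constant in the decay rate (\<open>Lp_interpolation\<close>). Hence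
\<open>\<langle>A f, f\<rangle> \<le> - Q f\<close> on the domain for the continuous quadratic form
\<open>Q f = (\<alpha>\<^sub>0 - \<alpha> - K) \<parallel>f\<parallel>\<^sup>2 + (e\<^sup>\<tau> + 1) / 2 * \<integral> |\<lambda>| f\<^sup>2\<close> (\<open>A_op_coercive\<close>).

Mild solutions are in general not differentiable, so the energy is not differentiated
along them. It is enough to bound its upper right Dini derivative, because a continuous
function whose upper right Dini derivative is nowhere positive does not increase
(\<open>dini_nonincreasing\<close>). That \<open>Q\<close> is continuous on the whole space is what carries the
differential inequality from the dense domain of the generator to every initial value
(\<open>dissipative_dini\<close>), and then to mild solutions through \<open>u(t+h) = S(h) u(t) + h F(t) + o(h)\<close>
(\<open>mild_solution_dini\<close>). The memory term of the energy has a right derivative. With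
Young's inequality \<open>|\<lambda> u v| \<le> e\<^sup>\<tau> / 2 * |\<lambda>| u\<^sup>2 + e\<^sup>-\<^sup>\<tau> / 2 * |\<lambda>| v\<^sup>2\<close> for the delayed value \<open>v\<close>
every term in \<open>|\<lambda>|\<close> cancels (\<open>energy_decay\<close>).

The calculus on the domain rests on the fact that a function with a weak derivative is
almost everywhere the indefinite Lebesgue integral of that derivative
(\<open>weakly_differentiable_imp_primitive\<close>, via the du Bois-Reymond lemma). Integration by
parts for such primitives is Fubini's theorem on a square, and boundary terms at infinity
vanish along suitable sequences.
\<close>

section \<open>Upper right Dini derivatives\<close>

text \<open>Continuous induction: for each slope \<open>\<eta> > 0\<close> the last time at which \<open>\<phi>\<close> lies below the
line of slope \<open>\<eta>\<close> through its initial value has to be \<open>b\<close>, since the hypothesis would let one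
go on a little further.\<close>

lemma dini_nonincreasing:
  fixes \<phi> :: "real \<Rightarrow> real"
  assumes cont: "continuous_on {a..b} \<phi>" and "a \<le> b"
    and dini: "\<And>t \<eta>. a \<le> t \<Longrightarrow> t < b \<Longrightarrow> 0 < \<eta> \<Longrightarrow>
      \<forall>\<^sub>F h in at_right 0. \<phi> (t + h) - \<phi> t \<le> \<eta> * h"
  shows "\<phi> b \<le> \<phi> a"
proof (rule field_le_epsilon)
  fix e :: real assume "0 < e"
  define \<eta> where "\<eta> = e / (b - a + 1)"
  have \<eta>: "0 < \<eta>" using \<open>0 < e\<close> \<open>a \<le> b\<close> by (simp add: \<eta>_def)
  define G where "G = {t \<in> {a..b}. \<phi> t - \<eta> * t \<le> \<phi> a - \<eta> * a}"
  have "closed G"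
    unfolding G_def
    by (intro continuous_on_closed_Collect_le continuous_intros cont)
  have "a \<in> G" using \<open>a \<le> b\<close> by (simp add: G_def)
  have bdd: "bdd_above G" by (rule bdd_aboveI[of _ b]) (auto simp: G_def)
  define s where "s = Sup G"
  have "s \<in> G"
    unfolding s_def using \<open>closed G\<close> \<open>a \<in> G\<close> bdd by (intro closed_contains_Sup) auto
  have "s = b"
  proof (rule ccontr)
    assume "s \<noteq> b"
    then have s: "a \<le> s" "s < b" using \<open>s \<in> G\<close> by (auto simp: G_def)
    have "\<forall>\<^sub>F h in at_right 0. h < b - s"
      using s by (intro eventually_at_right_less[THEN eventually_mono] eventually_at_rightI[of 0 "b - s"]) auto
    then have "\<forall>\<^sub>F h in at_right 0. 0 < h \<and> h < b - s \<and> \<phi> (s + h) - \<phi> s \<le> \<eta> * h"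
      using dini[OF s \<eta>] eventually_at_right_less[of "0::real"] by eventually_elim auto
    then obtain h where h: "0 < h" "h < b - s" "\<phi> (s + h) - \<phi> s \<le> \<eta> * h"
      using eventually_happens[of _ "at_right (0::real)"] trivial_limit_at_right_real by blast
    then have "s + h \<in> G" using \<open>s \<in> G\<close> by (auto simp: G_def algebra_simps)
    then have "s + h \<le> s" unfolding s_def using bdd by (rule cSup_upper)
    with \<open>0 < h\<close> show False by simp
  qed
  then have "\<phi> b \<le> \<phi> a + \<eta> * (b - a)" using \<open>s \<in> G\<close> by (simp add: G_def algebra_simps)
  also have "\<eta> * (b - a) \<le> e"
    using \<open>a \<le> b\<close> \<open>0 < e\<close> by (simp add: \<eta>_def divide_simps)
  finally show "\<phi> b \<le> \<phi> a + e" by simp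
qed

text \<open>Gronwall's lemma, reduced to \<open>dini_nonincreasing\<close> by the integrating factor
\<open>exp (\<gamma> * t)\<close>.\<close>

lemma dini_gronwall:
  fixes \<phi> c :: "real \<Rightarrow> real"
  assumes cont: "continuous_on {0..T} \<phi>" and "0 \<le> T"
    and c: "\<And>t. 0 \<le> t \<Longrightarrow> c t \<le> - \<gamma> * \<phi> t"
    and dini: "\<And>t \<eta>. 0 \<le> t \<Longrightarrow> 0 < \<eta> \<Longrightarrow>
      \<forall>\<^sub>F h in at_right 0. \<phi> (t + h) - \<phi> t \<le> h * (c t + \<eta>)"
  shows "\<phi> T \<le> \<phi> 0 * exp (- \<gamma> * T)"
proof -
  define \<psi> where "\<psi> t = exp (\<gamma> * t) * \<phi> t" for t
  have "\<psi> T \<le> \<psi> 0"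
  proof (rule dini_nonincreasing[of 0 T \<psi>])
    show "continuous_on {0..T} \<psi>"
      unfolding \<psi>_def by (intro continuous_intros cont)
    fix t \<eta> :: real assume t: "0 \<le> t" "t < T" and \<eta>: "0 < \<eta>"
    define \<eta>' where "\<eta>' = \<eta> / 2 / exp (\<gamma> * t)"
    have \<eta>': "0 < \<eta>'" using \<eta> by (simp add: \<eta>'_def)
    have expq: "((\<lambda>h. (exp (\<gamma> * h) - 1) / h) \<longlongrightarrow> \<gamma>) (at_right 0)"
    proof -
      have "((\<lambda>h. exp (\<gamma> * h)) has_field_derivative \<gamma>) (at 0)"
        by (auto intro!: derivative_eq_intros)
      then have "((\<lambda>h. (exp (\<gamma> * h) - 1) / h) \<longlongrightarrow> \<gamma>) (at 0)"
        by (simp add: DERIV_def)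
      then show ?thesis by (rule Lim_at_imp_Lim_at_within)
    qed
    have exp0: "((\<lambda>h. exp (\<gamma> * (t + h))) \<longlongrightarrow> exp (\<gamma> * (t + 0))) (at_right 0)"
      by (intro tendsto_intros)
    have "((\<lambda>h. exp (\<gamma> * (t + h)) * (c t + \<eta>') + \<phi> t * exp (\<gamma> * t) * ((exp (\<gamma> * h) - 1) / h))
        \<longlongrightarrow> exp (\<gamma> * (t + 0)) * (c t + \<eta>') + \<phi> t * exp (\<gamma> * t) * \<gamma>) (at_right 0)"
      by (intro tendsto_intros exp0 expq)
    moreover have "exp (\<gamma> * (t + 0)) * (c t + \<eta>') + \<phi> t * exp (\<gamma> * t) * \<gamma> < \<eta>"
    proof -
      have "exp (\<gamma> * t) * (c t + \<gamma> * \<phi> t) \<le> 0"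
        using c[OF t(1)] by (intro mult_nonneg_nonpos) auto
      moreover have "exp (\<gamma> * t) * \<eta>' = \<eta> / 2" by (simp add: \<eta>'_def)
      ultimately show ?thesis using \<eta> by (simp add: algebra_simps)
    qed
    ultimately have "\<forall>\<^sub>F h in at_right 0. exp (\<gamma> * (t + h)) * (c t + \<eta>')
        + \<phi> t * exp (\<gamma> * t) * ((exp (\<gamma> * h) - 1) / h) < \<eta>"
      by (rule order_tendstoD)
    then show "\<forall>\<^sub>F h in at_right 0. \<psi> (t + h) - \<psi> t \<le> \<eta> * h"
      using dini[OF t(1) \<eta>'] eventually_at_right_less[of "0::real"]
    proof eventually_elim
      case (elim h)
      have "\<psi> (t + h) - \<psi> t
          = exp (\<gamma> * (t + h)) * (\<phi> (t + h) - \<phi> t) + \<phi> t * exp (\<gamma> * t) * (exp (\<gamma> * h) - 1)"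
        by (simp add: \<psi>_def algebra_simps exp_add)
      also have "\<dots> \<le> exp (\<gamma> * (t + h)) * (h * (c t + \<eta>')) + \<phi> t * exp (\<gamma> * t) * (exp (\<gamma> * h) - 1)"
        using elim by simp
      also have "\<dots> = h * (exp (\<gamma> * (t + h)) * (c t + \<eta>')
        + \<phi> t * exp (\<gamma> * t) * ((exp (\<gamma> * h) - 1) / h))"
        using elim(3) by (simp add: field_simps)
      also have "\<dots> \<le> h * \<eta>" using elim by (intro mult_left_mono) auto
      finally show ?case by (simp add: mult.commute)
    qed
  qed fact
  then have "exp (- \<gamma> * T) * (exp (\<gamma> * T) * \<phi> T) \<le> exp (- \<gamma> * T) * \<phi> 0"
    by (intro mult_left_mono) (auto simp: \<psi>_def)
  moreover have "exp (- \<gamma> * T) * (exp (\<gamma> * T) * \<phi> T) = \<phi> T"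
    by (simp add: exp_minus)
  ultimately show ?thesis by (simp only: mult.commute[of "\<phi> 0"])
qed

section \<open>Uniform boundedness and strongly continuous semigroups\<close>

text \<open>If \<open>w\<close> nearly attains the norm of \<open>T\<close> on the ball of radius \<open>r\<close> around the origin, then one
of \<open>x + w\<close>, \<open>x - w\<close> does as well as \<open>w\<close>, because \<open>T (x + w) - T (x - w) = 2 T w\<close>.\<close>

lemma norm_blinfun_attained_in_ball:
  fixes T :: "'a::real_normed_vector \<Rightarrow>\<^sub>L 'b::real_normed_vector"
  assumes "0 < r" "0 \<le> c" "c < norm T"
  obtains y where "norm (y - x) \<le> r" "r * c \<le> norm (blinfun_apply T y)"
proof -
  obtain z where z: "c * norm z < norm (blinfun_apply T z)"
    using assms(2,3) norm_blinfun_bound[of c T] by (meson not_le)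
  then have "z \<noteq> 0" by auto
  define w where "w = (r / norm z) *\<^sub>R z"
  have w: "norm w = r" using \<open>z \<noteq> 0\<close> \<open>0 < r\<close> by (simp add: w_def)
  have "r * c \<le> norm (blinfun_apply T w)"
    using z \<open>z \<noteq> 0\<close> \<open>0 < r\<close> by (simp add: w_def blinfun.scaleR_right field_simps)
  moreover have "blinfun_apply T (x + w) - blinfun_apply T (x - w) = 2 *\<^sub>R blinfun_apply T w"
    by (simp add: blinfun.add_right blinfun.diff_right scaleR_2)
  then have "2 * norm (blinfun_apply T w)
      \<le> norm (blinfun_apply T (x + w)) + norm (blinfun_apply T (x - w))"
    by (metis norm_triangle_ineq4 norm_scaleR abs_numeral)
  ultimately have "r * c \<le> norm (blinfun_apply T (x + w)) \<or> r * c \<le> norm (blinfun_apply T (x - w))"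
    by linarith
  then show ?thesis using that[of "x + w"] that[of "x - w"] w by auto
qed

text \<open>The gliding-hump proof of the Banach--Steinhaus theorem. Points \<open>X n\<close> move by at most
\<open>(1/3)\<^sup>n\<close> while \<open>T n\<close> is made at least \<open>(2/3) * (1/3)\<^sup>n * \<parallel>T n\<parallel>\<close> at the new
point; all later steps together have length at most \<open>(1/2) * (1/3)\<^sup>n\<close> and so cannot undo this, and \<open>4\<^sup>n\<close> beats \<open>3\<^sup>n\<close>.\<close>

lemma exists_unbounded_orbit:
  fixes T :: "nat \<Rightarrow> 'a::banach \<Rightarrow>\<^sub>L 'b::real_normed_vector"
  assumes large: "\<And>n. 4 ^ n < norm (T n)"
  obtains x where "\<not> Bseq (\<lambda>n. blinfun_apply (T n) x)"
proof -
  have step: "\<exists>y. norm (y - x) \<le> (1/3) ^ n \<and> 2/3 * (1/3) ^ n * norm (T n) \<le> norm (blinfun_apply (T n) y)"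
    for n x
  proof -
    have pos: "0 < norm (T n)" using large[of n] by (smt (verit) zero_less_power)
    obtain y where "norm (y - x) \<le> (1/3) ^ n"
        "(1/3) ^ n * (2/3 * norm (T n)) \<le> norm (blinfun_apply (T n) y)"
      by (rule norm_blinfun_attained_in_ball[of "(1/3) ^ n" "2/3 * norm (T n)" "T n" x]) (use pos in auto)
    then show ?thesis by (auto simp: mult_ac)
  qed
  define nxt where "nxt n x = (SOME y. norm (y - x) \<le> (1/3) ^ n
    \<and> 2/3 * (1/3) ^ n * norm (T n) \<le> norm (blinfun_apply (T n) y))" for n x
  have nxt: "norm (nxt n x - x) \<le> (1/3) ^ n"
    "2/3 * (1/3) ^ n * norm (T n) \<le> norm (blinfun_apply (T n) (nxt n x))" for n x
    using someI_ex[OF step, of x n] unfolding nxt_def by auto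
  define X where "X = rec_nat 0 nxt"
  have X: "X (Suc n) = nxt n (X n)" for n by (simp add: X_def)
  define d where "d n = X (Suc n) - X n" for n
  have d: "norm (d n) \<le> (1/3) ^ n" for n by (simp add: d_def X nxt)
  have sd: "summable d"
    by (rule summable_comparison_test'[of "\<lambda>n. (1/3) ^ n" 0]) (use d in \<open>auto intro: summable_geometric\<close>)
  define x where "x = (\<Sum>n. d n)"
  have Xsum: "X n = (\<Sum>i<n. d i)" for n
    by (induction n) (simp_all add: d_def, simp add: X_def)
  have tail: "norm (x - X (Suc n)) \<le> 1/2 * (1/3) ^ n" for n
  proof -
    have "x - X (Suc n) = (\<Sum>i. d (i + Suc n))"
      unfolding x_def Xsum using suminf_minus_initial_segment[OF sd, of "Suc n"] by simp
    also have "norm \<dots> \<le> (\<Sum>i. (1/3) ^ Suc n * (1/3) ^ i)"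
    proof (rule norm_suminf_le)
      show "norm (d (i + Suc n)) \<le> (1/3) ^ Suc n * (1/3) ^ i" for i
        using d[of "i + Suc n"] by (simp add: power_add mult_ac)
      show "summable (\<lambda>i. (1/3) ^ Suc n * (1/3) ^ i :: real)"
        by (intro summable_mult summable_geometric) simp
    qed
    also have "\<dots> = (1/3) ^ Suc n * (3/2)"
      by (subst suminf_mult) (auto intro: summable_geometric simp: suminf_geometric)
    finally show ?thesis by simp
  qed
  have lower: "1/6 * (4/3) ^ n \<le> norm (blinfun_apply (T n) x)" for n
  proof -
    have "norm (blinfun_apply (T n) (X (Suc n))) \<le>
        norm (blinfun_apply (T n) x) + norm (blinfun_apply (T n) (x - X (Suc n)))"
      by (metis blinfun.diff_right norm_triangle_sub norm_minus_commute)
    moreover have "norm (blinfun_apply (T n) (x - X (Suc n))) \<le> norm (T n) * (1/2 * (1/3) ^ n)"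
      by (rule order_trans[OF norm_blinfun]) (intro mult_left_mono tail norm_ge_zero)
    moreover have "2/3 * (1/3) ^ n * norm (T n) \<le> norm (blinfun_apply (T n) (X (Suc n)))"
      using nxt(2)[of n "X n"] by (simp only: X)
    ultimately have "1/6 * (1/3) ^ n * norm (T n) \<le> norm (blinfun_apply (T n) x)"
      by (simp add: algebra_simps)
    moreover have "1/6 * (1/3) ^ n * 4 ^ n \<le> 1/6 * (1/3) ^ n * norm (T n)"
      using large[of n] by (intro mult_left_mono) auto
    moreover have "(1/3) ^ n * 4 ^ n = (4/3 :: real) ^ n" by (simp flip: power_mult_distrib)
    ultimately show ?thesis by simp
  qed
  have "\<not> Bseq (\<lambda>n. blinfun_apply (T n) x)"
  proof
    assume "Bseq (\<lambda>n. blinfun_apply (T n) x)"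
    then obtain K where K: "\<And>n. norm (blinfun_apply (T n) x) \<le> K" by (auto simp: Bseq_def)
    obtain n where "6 * K < (4/3) ^ n" using real_arch_pow[of "4/3" "6 * K"] by auto
    with lower[of n] K[of n] show False by simp
  qed
  then show ?thesis by (rule that)
qed

text \<open>Otherwise the operators at some times tending to \<open>0\<close> would have an unbounded orbit, but
the orbits converge there.\<close>

lemma C0_semigroup_bounded_near_0:
  fixes S :: "real \<Rightarrow> 'a::banach \<Rightarrow>\<^sub>L 'a"
  assumes "C0_semigroup S"
  obtains \<delta> M where "0 < \<delta>" "\<And>t. 0 \<le> t \<Longrightarrow> t \<le> \<delta> \<Longrightarrow> norm (S t) \<le> M"
proof -
  have "\<exists>\<delta>>0. \<exists>M. \<forall>t. 0 \<le> t \<longrightarrow> t \<le> \<delta> \<longrightarrow> norm (S t) \<le> M"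
  proof (rule ccontr)
    assume neg: "\<not> ?thesis"
    have "\<exists>t. 0 \<le> t \<and> t \<le> 1 / real (Suc n) \<and> 4 ^ n + norm (S 0) < norm (S t)" for n
    proof -
      have "0 < 1 / real (Suc n)" by simp
      with neg show ?thesis by (meson not_le)
    qed
    then obtain t where t: "\<And>n. 0 \<le> t n" "\<And>n. t n \<le> 1 / real (Suc n)"
      "\<And>n. 4 ^ n + norm (S 0) < norm (S (t n))" by metis
    have pos: "0 < t n" for n
      using t(1)[of n] t(3)[of n] zero_le_power[of "4::real" n] by (cases "t n = 0") auto
    have "t \<longlonglongrightarrow> 0"
      by (rule tendsto_sandwich[OF _ _ tendsto_const LIMSEQ_inverse_real_of_nat])
        (use t in \<open>auto simp: inverse_eq_divide\<close>)
    then have lim: "filterlim t (at_right 0) sequentially"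
      using tendsto_imp_filterlim_at_right[of t 0 sequentially] pos by simp
    obtain x where x: "\<not> Bseq (\<lambda>n. blinfun_apply (S (t n)) x)"
      by (rule exists_unbounded_orbit[of "\<lambda>n. S (t n)"]) (use t(3) norm_ge_zero[of "S 0"] in \<open>smt (verit)\<close>)
    have "((\<lambda>t. blinfun_apply (S t) x) \<longlongrightarrow> x) (at_right 0)"
      using assms by (simp add: C0_semigroup_def)
    from filterlim_compose[OF this lim] have "convergent (\<lambda>n. blinfun_apply (S (t n)) x)"
      by (auto simp: convergent_def)
    with x show False by (metis convergent_imp_Bseq)
  qed
  then show ?thesis using that by blast
qed

lemma C0_semigroup_locally_bounded:
  fixes S :: "real \<Rightarrow> 'a::banach \<Rightarrow>\<^sub>L 'a"
  assumes S: "C0_semigroup S"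
  obtains M where "0 < M" "\<And>t. 0 \<le> t \<Longrightarrow> t \<le> T \<Longrightarrow> norm (S t) \<le> M"
proof -
  obtain \<delta> M where \<delta>: "0 < \<delta>" and M: "\<And>t. 0 \<le> t \<Longrightarrow> t \<le> \<delta> \<Longrightarrow> norm (S t) \<le> M"
    using C0_semigroup_bounded_near_0[OF S] by blast
  have "0 \<le> M" using M[of 0] \<delta> norm_ge_zero[of "S 0"] by linarith
  have ext: "\<forall>t. 0 \<le> t \<longrightarrow> t \<le> real n * \<delta> \<longrightarrow> norm (S t) \<le> max 1 M ^ Suc n" for n
  proof (induction n)
    case 0
    then show ?case using M[of 0] \<delta> by auto
  next
    case (Suc n)
    show ?case
    proof (intro allI impI)
      fix t assume t: "0 \<le> t" "t \<le> real (Suc n) * \<delta>"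
      show "norm (S t) \<le> max 1 M ^ Suc (Suc n)"
      proof (cases "t \<le> \<delta>")
        case True
        have "max 1 M \<le> max 1 M ^ Suc (Suc n)" by (rule self_le_power) auto
        then show ?thesis using M[OF t(1) True] by linarith
      next
        case False
        have "norm (S t) = norm (S \<delta> o\<^sub>L S (t - \<delta>))"
          using S[unfolded C0_semigroup_def, THEN conjunct2, THEN conjunct1, rule_format, of \<delta> "t - \<delta>"]
            False \<delta> by simp
        also have "\<dots> \<le> norm (S \<delta>) * norm (S (t - \<delta>))" by (rule norm_blinfun_compose)
        also have "\<dots> \<le> max 1 M * max 1 M ^ Suc n"
          using M[of \<delta>] \<delta> Suc False t by (intro mult_mono) (auto simp: algebra_simps le_max_iff_disj)
        finally show ?thesis by simp
      qed
    qed
  qed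
  obtain n where "T \<le> real n * \<delta>"
    using reals_Archimedean3[OF \<delta>] by (meson less_imp_le)
  show ?thesis
    by (rule that[of "max 1 M ^ Suc n"]) (use ext[of n] \<open>T \<le> _\<close> in auto)
qed

lemma C0_semigroup_add:
  assumes "C0_semigroup S" "0 \<le> s" "0 \<le> t"
  shows "blinfun_apply (S (s + t)) f = blinfun_apply (S s) (blinfun_apply (S t) f)"
  using assms by (simp add: C0_semigroup_def)

lemma C0_semigroup_zero: "C0_semigroup S \<Longrightarrow> blinfun_apply (S 0) f = f"
  by (simp add: C0_semigroup_def)

lemma C0_semigroup_close:
  fixes S :: "real \<Rightarrow> 'a::banach \<Rightarrow>\<^sub>L 'a"
  assumes S: "C0_semigroup S" and "0 < e"
  obtains d where "0 < d" "\<And>h. 0 \<le> h \<Longrightarrow> h \<le> d \<Longrightarrow> norm (blinfun_apply (S h) f - f) < e"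
proof -
  have "((\<lambda>t. blinfun_apply (S t) f) \<longlongrightarrow> f) (at_right 0)"
    using S by (simp add: C0_semigroup_def)
  from tendstoD[OF this \<open>0 < e\<close>] obtain b where b: "0 < b"
    "\<And>h. 0 < h \<Longrightarrow> h < b \<Longrightarrow> norm (blinfun_apply (S h) f - f) < e"
    by (auto simp: eventually_at_right_field dist_norm)
  show ?thesis
  proof (rule that[of "b / 2"])
    fix h assume "0 \<le> h" "h \<le> b / 2"
    then show "norm (blinfun_apply (S h) f - f) < e"
      using b S \<open>0 < e\<close> by (cases "h = 0") (auto simp: C0_semigroup_zero)
  qed (use b in auto)
qed

text \<open>The two times are ordered and the smaller one is factored out; local boundedness makes the
estimate uniform in it, which gives continuity from the left as well.\<close>

lemma C0_semigroup_orbit_continuous: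
  fixes S :: "real \<Rightarrow> 'a::banach \<Rightarrow>\<^sub>L 'a"
  assumes S: "C0_semigroup S"
  shows "continuous_on {0..} (\<lambda>t. blinfun_apply (S t) f)"
  unfolding continuous_on_iff dist_norm
proof (intro ballI allI impI)
  fix t e :: real assume t: "t \<in> {0..}" and "0 < e"
  obtain M where M: "0 < M" "\<And>r. 0 \<le> r \<Longrightarrow> r \<le> t + 1 \<Longrightarrow> norm (S r) \<le> M"
    using C0_semigroup_locally_bounded[OF S] by blast
  obtain d where d: "0 < d" "\<And>h. 0 \<le> h \<Longrightarrow> h \<le> d \<Longrightarrow> norm (blinfun_apply (S h) f - f) < e / M"
    using C0_semigroup_close[OF S, of "e / M" f] \<open>0 < e\<close> M(1) by auto
  have main: "norm (blinfun_apply (S (r + h)) f - blinfun_apply (S r) f) < e"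
    if "0 \<le> r" "r \<le> t + 1" "0 \<le> h" "h \<le> d" for r h
  proof -
    have "blinfun_apply (S (r + h)) f - blinfun_apply (S r) f = blinfun_apply (S r) (blinfun_apply (S h) f - f)"
      using that S by (simp add: C0_semigroup_add blinfun.diff_right)
    then have "norm (blinfun_apply (S (r + h)) f - blinfun_apply (S r) f)
        \<le> norm (S r) * norm (blinfun_apply (S h) f - f)"
      by (simp add: norm_blinfun)
    also have "\<dots> \<le> M * norm (blinfun_apply (S h) f - f)"
      using M that by (intro mult_right_mono) auto
    also have "\<dots> < e" using d(2)[OF that(3,4)] M(1) by (simp add: field_simps)
    finally show ?thesis .
  qed
  show "\<exists>d>0. \<forall>x'\<in>{0..}. norm (x' - t) < d \<longrightarrow> norm (blinfun_apply (S x') f - blinfun_apply (S t) f) < e"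
  proof (intro exI[of _ "min d 1"] conjI ballI impI)
    fix r assume r: "r \<in> {0::real..}" "norm (r - t) < min d 1"
    show "norm (blinfun_apply (S r) f - blinfun_apply (S t) f) < e"
    proof (cases "r \<le> t")
      case True
      then show ?thesis using main[of r "t - r"] r t by (auto simp: norm_minus_commute)
    next
      case False
      then show ?thesis using main[of t "r - t"] r t by auto
    qed
  qed (use d in auto)
qed

lemma C0_semigroup_convolution_continuous:
  fixes S :: "real \<Rightarrow> 'a::banach \<Rightarrow>\<^sub>L 'a"
  assumes S: "C0_semigroup S" and F: "continuous_on {a..b} F"
  shows "continuous_on {a..b} (\<lambda>s. blinfun_apply (S (b - s)) (F s))"
  unfolding continuous_on_def
proof
  fix s assume s: "s \<in> {a..b}"
  obtain M where M: "0 < M" "\<And>r. 0 \<le> r \<Longrightarrow> r \<le> b - a \<Longrightarrow> norm (S r) \<le> M"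
    using C0_semigroup_locally_bounded[OF S] by blast
  have Fs: "(F \<longlongrightarrow> F s) (at s within {a..b})" using F s by (simp add: continuous_on_def)
  have "continuous_on {a..b} (\<lambda>r. blinfun_apply (S (b - r)) (F s))"
    by (rule continuous_on_compose2[OF C0_semigroup_orbit_continuous[OF S, of "F s"]])
      (auto intro!: continuous_intros)
  then have 1: "((\<lambda>r. blinfun_apply (S (b - r)) (F s)) \<longlongrightarrow> blinfun_apply (S (b - s)) (F s)) (at s within {a..b})"
    using s by (simp add: continuous_on_def)
  have 2: "((\<lambda>r. blinfun_apply (S (b - r)) (F r - F s)) \<longlongrightarrow> 0) (at s within {a..b})"
  proof (rule Lim_null_comparison)
    show "\<forall>\<^sub>F r in at s within {a..b}. norm (blinfun_apply (S (b - r)) (F r - F s)) \<le> M * norm (F r - F s)"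
      unfolding eventually_at_filter
    proof (intro always_eventually allI impI)
      fix r assume "r \<in> {a..b}"
      then show "norm (blinfun_apply (S (b - r)) (F r - F s)) \<le> M * norm (F r - F s)"
        by (intro order_trans[OF norm_blinfun] mult_right_mono M) auto
    qed
    have "((\<lambda>r. M * norm (F r - F s)) \<longlongrightarrow> M * norm (F s - F s)) (at s within {a..b})"
      by (intro tendsto_intros Fs)
    then show "((\<lambda>r. M * norm (F r - F s)) \<longlongrightarrow> 0) (at s within {a..b})" by simp
  qed
  show "((\<lambda>s. blinfun_apply (S (b - s)) (F s)) \<longlongrightarrow> blinfun_apply (S (b - s)) (F s)) (at s within {a..b})"
    using tendsto_add[OF 1 2] by (simp add: blinfun.diff_right)
qed

lemma integral_close_to_constant:
  fixes G :: "real \<Rightarrow> 'a::banach"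
  assumes "a \<le> b" "continuous_on {a..b} G" "\<And>s. a \<le> s \<Longrightarrow> s \<le> b \<Longrightarrow> norm (G s - v) \<le> e"
  shows "norm (integral {a..b} G - (b - a) *\<^sub>R v) \<le> e * (b - a)"
proof -
  have "integral {a..b} G - (b - a) *\<^sub>R v = integral {a..b} (\<lambda>s. G s - v)"
    using assms(1,2) by (subst integral_diff) (auto intro: integrable_continuous_interval)
  also have "norm \<dots> \<le> e * (b - a)"
    using assms by (intro integral_bound) (auto intro!: continuous_intros)
  finally show ?thesis .
qed

text \<open>The integrand may depend on the length \<open>h\<close> of the interval, as it does in Duhamel's formula
over \<open>{t..t + h}\<close>.\<close>

lemma right_average_tendsto:
  fixes G :: "real \<Rightarrow> real \<Rightarrow> 'a::banach"
  assumes "\<And>e. 0 < e \<Longrightarrow> \<forall>\<^sub>F h in at_right 0. continuous_on {t..t + h} (G h) \<and>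
     (\<forall>s. t \<le> s \<longrightarrow> s \<le> t + h \<longrightarrow> norm (G h s - v) \<le> e)"
  shows "((\<lambda>h. integral {t..t + h} (G h) /\<^sub>R h) \<longlongrightarrow> v) (at_right 0)"
proof (rule tendstoI)
  fix e :: real assume "0 < e"
  then have "0 < e / 2" by simp
  from assms[OF this] eventually_at_right_less[of "0::real"]
  show "\<forall>\<^sub>F h in at_right 0. dist (integral {t..t + h} (G h) /\<^sub>R h) v < e"
  proof eventually_elim
    case (elim h)
    have "integral {t..t + h} (G h) /\<^sub>R h - v = (integral {t..t + h} (G h) - (t + h - t) *\<^sub>R v) /\<^sub>R h"
      using elim(2) by (simp add: scaleR_right_diff_distrib)
    then have "norm (integral {t..t + h} (G h) /\<^sub>R h - v)
        = norm (integral {t..t + h} (G h) - (t + h - t) *\<^sub>R v) / h"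
      using elim(2) by (simp add: divide_inverse mult.commute)
    also have "\<dots> \<le> (e / 2 * (t + h - t)) / h"
      using elim by (intro divide_right_mono integral_close_to_constant) auto
    also have "\<dots> < e" using elim(2) \<open>0 < e\<close> by simp
    finally show ?case by (simp add: dist_norm)
  qed
qed

lemma right_average_continuous:
  fixes G :: "real \<Rightarrow> 'a::banach"
  assumes G: "continuous_on {t..} G"
  shows "((\<lambda>h. integral {t..t + h} G /\<^sub>R h) \<longlongrightarrow> G t) (at_right 0)"
proof (rule right_average_tendsto)
  fix e :: real assume "0 < e"
  then obtain d where "0 < d" and d: "\<And>s. t \<le> s \<Longrightarrow> s - t < d \<Longrightarrow> norm (G s - G t) < e"
  proof -
    have "\<exists>d>0. \<forall>s\<in>{t..}. dist s t < d \<longrightarrow> dist (G s) (G t) < e"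
      using G \<open>0 < e\<close> unfolding continuous_on_iff by auto
    then show ?thesis using that by (auto simp: dist_norm)
  qed
  have "\<forall>\<^sub>F h in at_right 0. h < d"
    using \<open>0 < d\<close> by (intro eventually_at_rightI[of 0 d]) auto
  then show "\<forall>\<^sub>F h in at_right 0. continuous_on {t..t + h} G \<and>
      (\<forall>s. t \<le> s \<longrightarrow> s \<le> t + h \<longrightarrow> norm (G s - G t) \<le> e)"
    by eventually_elim (auto intro!: continuous_on_subset[OF G] less_imp_le[OF d])
qed

text \<open>The averages of an orbit over \<open>{0..d}\<close> lie in the domain, with image \<open>(S d f - f) / d\<close>, and
tend to \<open>f\<close> as \<open>d\<close> tends to \<open>0\<close>.\<close>

lemma generator_domain_dense:
  fixes S :: "real \<Rightarrow> 'a::banach \<Rightarrow>\<^sub>L 'a"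
  assumes S: "C0_semigroup S" and "0 < e"
  obtains g k where "(g, k) \<in> generator S" "norm (g - f) < e"
proof -
  obtain d where d: "0 < d" "\<And>h. 0 \<le> h \<Longrightarrow> h \<le> d \<Longrightarrow> norm (blinfun_apply (S h) f - f) < e / 2"
    using C0_semigroup_close[OF S, of "e / 2" f] \<open>0 < e\<close> by auto
  define G where "G r = blinfun_apply (S r) f" for r
  have G: "continuous_on {0..} G"
    unfolding G_def by (rule C0_semigroup_orbit_continuous[OF S])
  have Gint: "G integrable_on {a..b}" if "0 \<le> a" for a b
    using that by (intro integrable_continuous_interval continuous_on_subset[OF G]) auto
  define g where "g = integral {0..d} G /\<^sub>R d"
  have close: "norm (g - f) < e"
  proof -
    have "norm (integral {0..d} G - (d - 0) *\<^sub>R f) \<le> e / 2 * (d - 0)"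
      using d by (intro integral_close_to_constant continuous_on_subset[OF G])
        (auto simp: G_def intro: less_imp_le)
    moreover have "g - f = (integral {0..d} G - (d - 0) *\<^sub>R f) /\<^sub>R d"
      using d(1) by (simp add: g_def scaleR_right_diff_distrib)
    then have "norm (g - f) = norm (integral {0..d} G - (d - 0) *\<^sub>R f) / d"
      using d(1) by (simp only: norm_scaleR divide_inverse mult.commute[of "inverse d"]
          abs_of_pos[of "inverse d"] positive_imp_inverse_positive)
    ultimately have "norm (g - f) \<le> e / 2"
      using d(1) by (simp add: pos_divide_le_eq)
    then show ?thesis using \<open>0 < e\<close> by simp
  qed
  have shift: "blinfun_apply (S h) (integral {0..d} G) - integral {0..d} G
      = integral {d..d + h} G - integral {0..0 + h} G" if "0 < h" for h
  proof -
    have "blinfun_apply (S h) (integral {0..d} G) = integral {0..d} (\<lambda>r. blinfun_apply (S h) (G r))"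
      using integral_linear[OF Gint[of 0 d] blinfun.bounded_linear_right[of "S h"]] by (simp add: o_def)
    also have "\<dots> = integral {0..d} (\<lambda>r. G (r + h))"
      using S that by (intro integral_cong) (auto simp: G_def add.commute[of _ h] C0_semigroup_add)
    also have "\<dots> = integral {h..d + h} G"
      using integral_shift_Icc_real[of 0 d G h] by (simp add: add.commute o_def)
    finally have "blinfun_apply (S h) (integral {0..d} G) = integral {h..d + h} G" .
    moreover have "integral {0..h} G + integral {h..d + h} G = integral {0..d + h} G"
      using that d by (intro Henstock_Kurzweil_Integration.integral_combine Gint) auto
    moreover have "integral {0..d} G + integral {d..d + h} G = integral {0..d + h} G"
      using that d by (intro Henstock_Kurzweil_Integration.integral_combine Gint) auto
    ultimately show ?thesis by (simp add: algebra_simps)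
  qed
  have "((\<lambda>h. (integral {d..d + h} G /\<^sub>R h - integral {0..0 + h} G /\<^sub>R h) /\<^sub>R d)
      \<longlongrightarrow> (G d - G 0) /\<^sub>R d) (at_right 0)"
    using d by (intro tendsto_intros right_average_continuous continuous_on_subset[OF G]) auto
  moreover have "\<forall>\<^sub>F h in at_right 0. (integral {d..d + h} G /\<^sub>R h - integral {0..0 + h} G /\<^sub>R h) /\<^sub>R d
      = (blinfun_apply (S h) g - g) /\<^sub>R h"
    using eventually_at_right_less[of "0::real"]
  proof eventually_elim
    case (elim h)
    have "(blinfun_apply (S h) g - g) /\<^sub>R h
      = ((blinfun_apply (S h) (integral {0..d} G) - integral {0..d} G) /\<^sub>R h) /\<^sub>R d"
      unfolding g_def by (simp add: blinfun.scaleR_right scaleR_right_diff_distrib mult.commute)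
    then show ?case unfolding shift[OF elim] by (simp add: scaleR_right_diff_distrib)
  qed
  ultimately have "((\<lambda>h. (blinfun_apply (S h) g - g) /\<^sub>R h) \<longlongrightarrow> (G d - G 0) /\<^sub>R d) (at_right 0)"
    by (rule Lim_transform_eventually)
  then show ?thesis using close that by (simp add: generator_def)
qed

lemma generator_invariant:
  assumes S: "C0_semigroup S" and "(f, g) \<in> generator S" "0 \<le> t"
  shows "(blinfun_apply (S t) f, blinfun_apply (S t) g) \<in> generator S"
proof -
  have "((\<lambda>h. (blinfun_apply (S h) f - f) /\<^sub>R h) \<longlongrightarrow> g) (at_right 0)"
    using assms(2) by (simp add: generator_def)
  then have "((\<lambda>h. blinfun_apply (S t) ((blinfun_apply (S h) f - f) /\<^sub>R h)) \<longlongrightarrow> blinfun_apply (S t) g) (at_right 0)"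
    by (intro tendsto_intros)
  moreover have "\<forall>\<^sub>F h in at_right 0. blinfun_apply (S t) ((blinfun_apply (S h) f - f) /\<^sub>R h)
      = (blinfun_apply (S h) (blinfun_apply (S t) f) - blinfun_apply (S t) f) /\<^sub>R h"
    using eventually_at_right_less[of "0::real"]
    by eventually_elim (use S \<open>0 \<le> t\<close> in
      \<open>simp add: blinfun.scaleR_right blinfun.diff_right flip: C0_semigroup_add; simp add: add.commute\<close>)
  ultimately show ?thesis
    unfolding generator_def by (auto intro: Lim_transform_eventually)
qed

section \<open>Dissipativity along mild solutions\<close>

lemma half_square_norm_diff:
  fixes a b :: "'a::real_inner"
  shows "(norm b)\<^sup>2 / 2 - (norm a)\<^sup>2 / 2 = inner (b - a) ((a + b) /\<^sub>R 2)"
  by (simp add: power2_norm_eq_inner inner_diff_left inner_diff_right inner_add_right inner_commute[of b a] field_simps)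

lemma dissipative_dini_domain:
  fixes S :: "real \<Rightarrow> 'a::{real_inner,banach} \<Rightarrow>\<^sub>L 'a"
  assumes S: "C0_semigroup S" and fg: "(f, g) \<in> generator S" and "inner g f < c"
  shows "\<forall>\<^sub>F h in at_right 0. (norm (blinfun_apply (S h) f))\<^sup>2 / 2 - (norm f)\<^sup>2 / 2 \<le> h * c"
proof -
  have "((\<lambda>t. blinfun_apply (S t) f) \<longlongrightarrow> f) (at_right 0)"
    using S by (simp add: C0_semigroup_def)
  moreover have "((\<lambda>h. (blinfun_apply (S h) f - f) /\<^sub>R h) \<longlongrightarrow> g) (at_right 0)"
    using fg by (simp add: generator_def)
  ultimately have "((\<lambda>h. inner ((blinfun_apply (S h) f - f) /\<^sub>R h) ((f + blinfun_apply (S h) f) /\<^sub>R 2))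
      \<longlongrightarrow> inner g ((f + f) /\<^sub>R 2)) (at_right 0)"
    by (intro tendsto_intros)
  moreover have "inner g ((f + f) /\<^sub>R 2) = inner g f" by (simp flip: scaleR_2)
  ultimately have "\<forall>\<^sub>F h in at_right 0.
      inner ((blinfun_apply (S h) f - f) /\<^sub>R h) ((f + blinfun_apply (S h) f) /\<^sub>R 2) < c"
    using \<open>inner g f < c\<close> by (intro order_tendstoD) auto
  then show ?thesis
    using eventually_at_right_less[of "0::real"]
  proof eventually_elim
    case (elim h)
    have "(norm (blinfun_apply (S h) f))\<^sup>2 / 2 - (norm f)\<^sup>2 / 2
        = h * inner ((blinfun_apply (S h) f - f) /\<^sub>R h) ((f + blinfun_apply (S h) f) /\<^sub>R 2)"
      unfolding half_square_norm_diff inner_scaleR_left using elim(2) by simp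
    also have "\<dots> \<le> h * c" using elim by (intro mult_left_mono) auto
    finally show ?case .
  qed
qed

text \<open>Orbits that start in the domain close to \<open>f\<close> stay, on a short interval, where \<open>Q\<close> exceeds
\<open>Q f - \<eta>\<close>, so along them half the squared norm grows at a rate below \<open>- Q f + \<eta>\<close>. The interval does
not depend on the starting point, which may therefore tend to \<open>f\<close>.\<close>

lemma dissipative_dini:
  fixes S :: "real \<Rightarrow> 'a::{real_inner,banach} \<Rightarrow>\<^sub>L 'a"
  assumes S: "C0_semigroup S"
    and diss: "\<And>f g. (f, g) \<in> generator S \<Longrightarrow> inner g f \<le> - Q f"
    and Q: "continuous_on UNIV Q" and "0 < \<eta>"
  shows "\<forall>\<^sub>F h in at_right 0.
    (norm (blinfun_apply (S h) f))\<^sup>2 / 2 - (norm f)\<^sup>2 / 2 \<le> h * (- Q f + \<eta>)"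
proof -
  obtain e where "0 < e" and e: "\<And>x. norm (x - f) < e \<Longrightarrow> Q f - \<eta> < Q x"
  proof -
    from Q \<open>0 < \<eta>\<close> obtain e where "0 < e" "\<And>x. norm (x - f) < e \<Longrightarrow> \<bar>Q x - Q f\<bar> < \<eta>"
      unfolding continuous_on_iff dist_norm by (metis UNIV_I real_norm_def)
    then show thesis using that[of e] by force
  qed
  obtain d where d: "0 < d" "\<And>h. 0 \<le> h \<Longrightarrow> h \<le> d \<Longrightarrow> norm (blinfun_apply (S h) f - f) < e / 2"
    using C0_semigroup_close[OF S, of "e / 2" f] \<open>0 < e\<close> by auto
  obtain M where M: "0 < M" "\<And>t. 0 \<le> t \<Longrightarrow> t \<le> d \<Longrightarrow> norm (S t) \<le> M"
    using C0_semigroup_locally_bounded[OF S] by blast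
  have dom: "(norm (blinfun_apply (S h) g))\<^sup>2 / 2 - (norm g)\<^sup>2 / 2 \<le> h * (- Q f + \<eta>)"
    if g: "(g, k) \<in> generator S" "norm (g - f) < e / 2 / M" and h: "0 \<le> h" "h \<le> d" for g k h
  proof -
    \<comment> \<open>It suffices that \<open>\<phi>\<close> does not increase: its slope at \<open>r\<close> is at most \<open>Q f - \<eta> - Q (S r g)\<close>.\<close>
    define \<phi> where "\<phi> r = (norm (blinfun_apply (S r) g))\<^sup>2 / 2 - r * (- Q f + \<eta>)" for r
    have "\<phi> h \<le> \<phi> 0"
    proof (rule dini_nonincreasing[of 0 h \<phi>])
      show "continuous_on {0..h} \<phi>" unfolding \<phi>_def
        by (intro continuous_intros continuous_on_subset[OF C0_semigroup_orbit_continuous[OF S]]) auto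
      fix r \<eta>' :: real assume r: "0 \<le> r" "r < h" and "0 < \<eta>'"
      have "blinfun_apply (S r) g - f = blinfun_apply (S r) (g - f) + (blinfun_apply (S r) f - f)"
        by (simp add: blinfun.diff_right)
      then have "norm (blinfun_apply (S r) g - f)
          \<le> norm (blinfun_apply (S r) (g - f)) + norm (blinfun_apply (S r) f - f)"
        by (metis norm_triangle_ineq)
      moreover have "norm (blinfun_apply (S r) (g - f)) \<le> M * norm (g - f)"
        using r h by (intro order_trans[OF norm_blinfun] mult_right_mono M) auto
      moreover have "M * norm (g - f) < e / 2"
        using g(2) M(1) by (simp add: field_simps)
      moreover have "norm (blinfun_apply (S r) f - f) < e / 2"
        using r h by (intro d) auto
      ultimately have "norm (blinfun_apply (S r) g - f) < e" by linarith
      then have "Q f - \<eta> < Q (blinfun_apply (S r) g)" by (rule e)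
      then have "inner (blinfun_apply (S r) k) (blinfun_apply (S r) g) < - Q f + \<eta>"
        using diss[OF generator_invariant[OF S g(1) r(1)]] by linarith
      from dissipative_dini_domain[OF S generator_invariant[OF S g(1) r(1)] this]
      show "\<forall>\<^sub>F h in at_right 0. \<phi> (r + h) - \<phi> r \<le> \<eta>' * h"
        using eventually_at_right_less[of "0::real"]
      proof eventually_elim
        case (elim h)
        have "\<phi> (r + h) - \<phi> r \<le> 0"
          using elim C0_semigroup_add[OF S, of h r g] r by (simp add: \<phi>_def add.commute algebra_simps)
        also have "0 \<le> \<eta>' * h" using elim \<open>0 < \<eta>'\<close> by simp
        finally show ?case .
      qed
    qed (use h in auto)
    then show ?thesis using S by (simp add: \<phi>_def C0_semigroup_zero)
  qed
  have "(norm (blinfun_apply (S h) f))\<^sup>2 / 2 - (norm f)\<^sup>2 / 2 \<le> h * (- Q f + \<eta>)"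
    if h: "0 \<le> h" "h \<le> d" for h
  proof -
    have "\<exists>g k. (g, k) \<in> generator S \<and> norm (g - f) < min (e / 2 / M) (1 / real (Suc n))" for n
      using generator_domain_dense[OF S, of "min (e / 2 / M) (1 / real (Suc n))" f] \<open>0 < e\<close> M(1)
      by (metis divide_pos_pos half_gt_zero min_less_iff_conj of_nat_0_less_iff zero_less_Suc zero_less_one)
    then obtain g k where gk: "\<And>n. (g n, k n) \<in> generator S"
      "\<And>n. norm (g n - f) < min (e / 2 / M) (1 / real (Suc n))" by metis
    have "(\<lambda>n. g n - f) \<longlonglongrightarrow> 0"
    proof (rule Lim_null_comparison)
      show "\<forall>\<^sub>F n in sequentially. norm (g n - f) \<le> 1 / real (Suc n)"
        using gk(2) by (intro always_eventually) (auto intro: less_imp_le)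
      show "(\<lambda>n. 1 / real (Suc n)) \<longlonglongrightarrow> 0"
        using LIMSEQ_inverse_real_of_nat by (simp add: inverse_eq_divide)
    qed
    then have "g \<longlonglongrightarrow> f" by (simp add: LIM_zero_iff)
    then have "(\<lambda>n. (norm (blinfun_apply (S h) (g n)))\<^sup>2 / 2 - (norm (g n))\<^sup>2 / 2)
        \<longlonglongrightarrow> (norm (blinfun_apply (S h) f))\<^sup>2 / 2 - (norm f)\<^sup>2 / 2"
      by (intro tendsto_intros) auto
    then show ?thesis
      by (rule LIMSEQ_le_const2) (use dom[OF gk(1) _ h] gk(2) in auto)
  qed
  moreover have "\<forall>\<^sub>F h in at_right 0. 0 < h \<and> h < d"
    using d(1) by (intro eventually_at_rightI[of 0 d]) auto
  ultimately show ?thesis by (auto elim!: eventually_mono)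
qed

text \<open>The semigroup law lets \<open>S h\<close> be pulled out of the part of the integral over \<open>{0..t}\<close>.\<close>

lemma mild_solution_step:
  fixes S :: "real \<Rightarrow> 'a::banach \<Rightarrow>\<^sub>L 'a"
  assumes S: "C0_semigroup S" and F: "continuous_on {0..} F"
    and u: "\<And>t. 0 \<le> t \<Longrightarrow>
      u t = blinfun_apply (S t) x + integral {0..t} (\<lambda>s. blinfun_apply (S (t - s)) (F s))"
    and "0 \<le> t" "0 \<le> h"
  shows "u (t + h) = blinfun_apply (S h) (u t)
    + integral {t..t + h} (\<lambda>s. blinfun_apply (S (t + h - s)) (F s))"
proof -
  have int: "(\<lambda>s. blinfun_apply (S (b - s)) (F s)) integrable_on {0..b}" for b
    by (intro integrable_continuous_interval C0_semigroup_convolution_continuous[OF S]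
        continuous_on_subset[OF F]) auto
  have "integral {0..t + h} (\<lambda>s. blinfun_apply (S (t + h - s)) (F s))
      = integral {0..t} (\<lambda>s. blinfun_apply (S (t + h - s)) (F s))
        + integral {t..t + h} (\<lambda>s. blinfun_apply (S (t + h - s)) (F s))"
    using assms(4,5) by (intro Henstock_Kurzweil_Integration.integral_combine[symmetric] int) auto
  also have "integral {0..t} (\<lambda>s. blinfun_apply (S (t + h - s)) (F s))
      = integral {0..t} (\<lambda>s. blinfun_apply (S h) (blinfun_apply (S (t - s)) (F s)))"
    using C0_semigroup_add[OF S, of h] assms(4,5) by (intro integral_cong) (simp add: add_diff_eq add.commute flip: C0_semigroup_add[OF S])
  also have "\<dots> = blinfun_apply (S h) (integral {0..t} (\<lambda>s. blinfun_apply (S (t - s)) (F s)))"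
    using integral_linear[OF int[of t] blinfun.bounded_linear_right[of "S h"]] by (simp add: o_def)
  finally have "integral {0..t + h} (\<lambda>s. blinfun_apply (S (t + h - s)) (F s)) = \<dots>
    + integral {t..t + h} (\<lambda>s. blinfun_apply (S (t + h - s)) (F s))" .
  then show ?thesis
    using u[of t] u[of "t + h"] assms(4,5) C0_semigroup_add[OF S, of h t x]
    by (simp add: blinfun.add_right add.commute)
qed

text \<open>Over a short time the forcing contributes \<open>h F(t) + o(h)\<close>, and the rest is the semigroup
applied to \<open>u t\<close>; expanding the square gives the cross term \<open>\<langle>F(t), u(t)\<rangle>\<close>.\<close>

lemma mild_solution_dini:
  fixes S :: "real \<Rightarrow> 'a::{real_inner,banach} \<Rightarrow>\<^sub>L 'a"
  assumes S: "C0_semigroup S"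
    and diss: "\<And>f g. (f, g) \<in> generator S \<Longrightarrow> inner g f \<le> - Q f"
    and Q: "continuous_on UNIV Q"
    and F: "continuous_on {0..} F"
    and u: "\<And>t. 0 \<le> t \<Longrightarrow>
      u t = blinfun_apply (S t) x + integral {0..t} (\<lambda>s. blinfun_apply (S (t - s)) (F s))"
    and "0 \<le> t" "0 < \<eta>"
  shows "\<forall>\<^sub>F h in at_right 0. (norm (u (t + h)))\<^sup>2 / 2 - (norm (u t))\<^sup>2 / 2
    \<le> h * (- Q (u t) + inner (F t) (u t) + \<eta>)"
proof -
  define R where "R h = integral {t..t + h} (\<lambda>s. blinfun_apply (S (t + h - s)) (F s))" for h
  have R: "((\<lambda>h. R h /\<^sub>R h) \<longlongrightarrow> F t) (at_right 0)"
    unfolding R_def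
  proof (rule right_average_tendsto)
    fix e :: real assume "0 < e"
    obtain M where M: "0 < M" "\<And>r. 0 \<le> r \<Longrightarrow> r \<le> 1 \<Longrightarrow> norm (S r) \<le> M"
      using C0_semigroup_locally_bounded[OF S] by blast
    obtain d1 where d1: "0 < d1" "\<And>h. 0 \<le> h \<Longrightarrow> h \<le> d1 \<Longrightarrow> norm (blinfun_apply (S h) (F t) - F t) < e / 2"
      using C0_semigroup_close[OF S, of "e / 2" "F t"] \<open>0 < e\<close> by auto
    have "0 < e / 2 / M" using \<open>0 < e\<close> M by simp
    then obtain d2 where d2: "0 < d2" "\<And>s. t \<le> s \<Longrightarrow> \<bar>s - t\<bar> < d2 \<Longrightarrow> norm (F s - F t) < e / 2 / M"
      using F \<open>0 \<le> t\<close> unfolding continuous_on_iff dist_norm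
      by (metis atLeast_iff order_trans real_norm_def)
    have "\<forall>\<^sub>F h in at_right 0. 0 < h \<and> h < min 1 (min d1 d2)"
      using d1(1) d2(1) by (intro eventually_at_rightI[of 0 "min 1 (min d1 d2)"]) auto
    then show "\<forall>\<^sub>F h in at_right 0.
        continuous_on {t..t + h} (\<lambda>s. blinfun_apply (S (t + h - s)) (F s)) \<and>
        (\<forall>s. t \<le> s \<longrightarrow> s \<le> t + h \<longrightarrow> norm (blinfun_apply (S (t + h - s)) (F s) - F t) \<le> e)"
    proof eventually_elim
      case (elim h)
      show ?case
      proof (intro conjI allI impI)
        show "continuous_on {t..t + h} (\<lambda>s. blinfun_apply (S (t + h - s)) (F s))"
          using \<open>0 \<le> t\<close> by (intro C0_semigroup_convolution_continuous[OF S] continuous_on_subset[OF F]) auto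
        fix s assume s: "t \<le> s" "s \<le> t + h"
        define r where "r = t + h - s"
        have r: "0 \<le> r" "r \<le> 1" "r \<le> d1" using s elim by (auto simp: r_def)
        have "blinfun_apply (S r) (F s) - F t
            = blinfun_apply (S r) (F s - F t) + (blinfun_apply (S r) (F t) - F t)"
          by (simp add: blinfun.diff_right)
        then have "norm (blinfun_apply (S r) (F s) - F t)
            \<le> norm (blinfun_apply (S r) (F s - F t)) + norm (blinfun_apply (S r) (F t) - F t)"
          by (metis norm_triangle_ineq)
        moreover have "norm (blinfun_apply (S r) (F s - F t)) \<le> M * norm (F s - F t)"
          using r by (intro order_trans[OF norm_blinfun] mult_right_mono M) auto
        moreover have "M * norm (F s - F t) < e / 2"
          using d2(2)[of s] s elim M(1) by (simp add: field_simps)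
        moreover have "norm (blinfun_apply (S r) (F t) - F t) < e / 2"
          using r by (intro d1) auto
        ultimately show "norm (blinfun_apply (S (t + h - s)) (F s) - F t) \<le> e"
          by (simp add: r_def)
      qed
    qed
  qed
  have Su: "((\<lambda>h. blinfun_apply (S h) (u t)) \<longlongrightarrow> u t) (at_right 0)"
    using S by (simp add: C0_semigroup_def)
  have id0: "((\<lambda>h. h) \<longlongrightarrow> 0) (at_right (0::real))" by (rule tendsto_ident_at)
  have "((\<lambda>h. inner (R h /\<^sub>R h) (blinfun_apply (S h) (u t)) + h * ((norm (R h /\<^sub>R h))\<^sup>2 / 2))
      \<longlongrightarrow> inner (F t) (u t) + 0 * ((norm (F t))\<^sup>2 / 2)) (at_right 0)"
    by (intro tendsto_intros R Su id0) auto
  then have "\<forall>\<^sub>F h in at_right 0.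
      inner (R h /\<^sub>R h) (blinfun_apply (S h) (u t)) + h * ((norm (R h /\<^sub>R h))\<^sup>2 / 2)
        < inner (F t) (u t) + \<eta> / 2"
    using \<open>0 < \<eta>\<close> by (intro order_tendstoD) auto
  moreover have "\<forall>\<^sub>F h in at_right 0.
      (norm (blinfun_apply (S h) (u t)))\<^sup>2 / 2 - (norm (u t))\<^sup>2 / 2 \<le> h * (- Q (u t) + \<eta> / 2)"
    by (rule dissipative_dini[OF S diss Q]) (use \<open>0 < \<eta>\<close> in auto)
  ultimately show ?thesis
    using eventually_at_right_less[of "0::real"]
  proof eventually_elim
    case (elim h)
    let ?w = "blinfun_apply (S h) (u t)" and ?\<rho> = "R h /\<^sub>R h"
    have "u (t + h) = ?w + h *\<^sub>R ?\<rho>"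
      using mild_solution_step[OF S F u \<open>0 \<le> t\<close>, of h] elim(3) by (simp add: R_def)
    then have "(norm (u (t + h)))\<^sup>2 / 2
        = (norm ?w)\<^sup>2 / 2 + h * (inner ?\<rho> ?w + h * ((norm ?\<rho>)\<^sup>2 / 2))"
      unfolding power2_norm_eq_inner
      by (simp add: inner_add_left inner_add_right inner_commute power2_eq_square algebra_simps)
    also have "\<dots> \<le> (norm ?w)\<^sup>2 / 2 + h * (inner (F t) (u t) + \<eta> / 2)"
      using elim by simp
    finally show ?case using elim(2) by (simp add: algebra_simps)
  qed
qed

section \<open>Smooth test functions\<close>

text \<open>The family is closed under differentiation up to linear combinations, which avoids
polynomials in \<open>1 / y\<close>; \<open>flat 0\<close> is the standard smooth function that vanishes on the
negative half-line.\<close>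

definition flat :: "nat \<Rightarrow> real \<Rightarrow> real" where
  "flat n y = (if 0 < y then (1 / y) ^ n * exp (- (1 / y)) else 0)"

lemma flat_tendsto_0: "(flat n \<longlongrightarrow> 0) (at 0)"
proof (rule filterlim_split_at)
  show "(flat n \<longlongrightarrow> 0) (at_left 0)"
    by (rule tendsto_eventually) (auto simp: flat_def eventually_at_filter)
  have "((\<lambda>z::real. z ^ n / exp z) \<longlongrightarrow> 0) at_top" by (rule tendsto_power_div_exp_0)
  then have "((\<lambda>y. inverse y ^ n / exp (inverse y)) \<longlongrightarrow> (0::real)) (at_right 0)"
    by (rule filterlim_compose) (rule filterlim_inverse_at_top_right)
  moreover have "\<forall>\<^sub>F y in at_right 0. inverse y ^ n / exp (inverse y) = flat n y"
    using eventually_at_right_less[of "0::real"]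
    by eventually_elim (simp add: flat_def exp_minus divide_inverse)
  ultimately show "(flat n \<longlongrightarrow> 0) (at_right 0)" by (rule Lim_transform_eventually)
qed

lemma flat_has_derivative:
  "(flat n has_real_derivative flat (n + 2) y - real n * flat (n + 1) y) (at y)"
proof -
  consider "0 < y" | "y < 0" | "y = 0" by linarith
  then show ?thesis
  proof cases
    case 1
    define z where "z = 1 / y"
    have z: "((\<lambda>y. 1 / y) has_real_derivative - z\<^sup>2) (at y)"
      using 1 by (auto intro!: derivative_eq_intros simp: z_def power2_eq_square)
    have "((\<lambda>y. (1 / y) ^ n * exp (- (1 / y))) has_real_derivative
        real n * (- z\<^sup>2 * z ^ (n - Suc 0)) * exp (- z) + exp (- z) * (- (- z\<^sup>2)) * z ^ n) (at y)"
      using DERIV_mult[OF DERIV_power[OF z, of n] DERIV_fun_exp[OF DERIV_minus[OF z]]]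
      by (simp only: z_def)
    also have "real n * (- z\<^sup>2 * z ^ (n - Suc 0)) * exp (- z) + exp (- z) * (- (- z\<^sup>2)) * z ^ n
        = flat (n + 2) y - real n * flat (n + 1) y"
      using 1 unfolding flat_def z_def[symmetric]
      by (cases n) (simp_all add: power2_eq_square algebra_simps)
    finally have "((\<lambda>y. (1 / y) ^ n * exp (- (1 / y))) has_real_derivative
        flat (n + 2) y - real n * flat (n + 1) y) (at y)" .
    then show ?thesis
    proof (rule has_field_derivative_transform_within_open)
      show "open {0::real<..}" by simp
    qed (use 1 in \<open>auto simp: flat_def\<close>)
  next
    case 2
    have "((\<lambda>y. 0) has_real_derivative 0) (at y)" by simp
    then have "(flat n has_real_derivative 0) (at y)"
    proof (rule has_field_derivative_transform_within_open)
      show "open {..<0::real}" by simp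
    qed (use 2 in \<open>auto simp: flat_def\<close>)
    then show ?thesis using 2 by (simp add: flat_def)
  next
    case 3
    have "(flat n has_real_derivative 0) (at 0)"
      unfolding DERIV_def
    proof (rule Lim_transform_eventually[OF flat_tendsto_0[of "Suc n"]])
      show "\<forall>\<^sub>F h in at 0. flat (Suc n) h = (flat n (0 + h) - flat n 0) / h"
        by (auto simp: flat_def eventually_at_filter)
    qed
    then show ?thesis using 3 by (simp add: flat_def)
  qed
qed

text \<open>All functions obtained from \<open>flat\<close> by the operations needed here. The class is closed under
differentiation, so every member is smooth. The last rule makes antiderivatives of members
smooth without any computation.\<close>

inductive smooth_generated :: "(real \<Rightarrow> real) \<Rightarrow> bool" where
  flat: "smooth_generated (\<lambda>x. flat n (m * x + c))"
| const: "smooth_generated (\<lambda>x. c)"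
| add: "smooth_generated f \<Longrightarrow> smooth_generated g \<Longrightarrow> smooth_generated (\<lambda>x. f x + g x)"
| mult: "smooth_generated f \<Longrightarrow> smooth_generated g \<Longrightarrow> smooth_generated (\<lambda>x. f x * g x)"
| primitive: "smooth_generated f \<Longrightarrow> (\<And>x. (F has_real_derivative f x) (at x)) \<Longrightarrow> smooth_generated F"

lemma smooth_generated_deriv:
  assumes "smooth_generated f"
  shows "\<exists>f'. smooth_generated f' \<and> (\<forall>x. (f has_real_derivative f' x) (at x))"
  using assms
proof induction
  case (flat n m c)
  have "smooth_generated (\<lambda>x. m * (flat (n + 2) (m * x + c) + (- real n) * flat (n + 1) (m * x + c)))"
    by (intro smooth_generated.intros)
  moreover have "((\<lambda>x. flat n (m * x + c)) has_real_derivative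
      m * (flat (n + 2) (m * x + c) + (- real n) * flat (n + 1) (m * x + c))) (at x)" for x
    by (rule DERIV_chain'[OF _ flat_has_derivative, THEN DERIV_cong])
      (auto intro!: derivative_eq_intros simp: algebra_simps)
  ultimately show ?case by blast
next
  case (const c)
  then show ?case by (intro exI[of _ "\<lambda>x. 0"]) (auto intro: smooth_generated.const)
next
  case (add f g)
  then obtain f' g' where "smooth_generated f'" "smooth_generated g'"
    "\<And>x. (f has_real_derivative f' x) (at x)" "\<And>x. (g has_real_derivative g' x) (at x)" by blast
  then show ?case
    by (intro exI[of _ "\<lambda>x. f' x + g' x"]) (auto intro: smooth_generated.add DERIV_add)
next
  case (mult f g)
  then obtain f' g' where *: "smooth_generated f'" "smooth_generated g'"
    "\<And>x. (f has_real_derivative f' x) (at x)" "\<And>x. (g has_real_derivative g' x) (at x)" by blast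
  then show ?case
    using mult.hyps by (intro exI[of _ "\<lambda>x. f' x * g x + g' x * f x"])
      (auto intro: smooth_generated.add smooth_generated.mult DERIV_mult)
next
  case (primitive f F)
  then show ?case by blast
qed

lemma smooth_generated_iterated_deriv:
  assumes "smooth_generated f"
  shows "smooth_generated ((deriv ^^ n) f)"
proof (induction n)
  case (Suc n)
  obtain f' where f': "smooth_generated f'" "\<And>x. ((deriv ^^ n) f has_real_derivative f' x) (at x)"
    using smooth_generated_deriv[OF Suc] by blast
  then have "(deriv ^^ Suc n) f = f'" by (auto intro!: ext DERIV_imp_deriv)
  with f' show ?case by simp
qed (use assms in simp)

lemma test_functionI:
  assumes "smooth_generated \<phi>" and supp: "\<And>x. x \<notin> {a..b} \<Longrightarrow> \<phi> x = 0"
  shows "test_function \<phi>"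
  unfolding test_function_def
proof (intro conjI allI)
  fix n x
  show "(deriv ^^ n) \<phi> differentiable at x"
    using smooth_generated_deriv[OF smooth_generated_iterated_deriv[OF assms(1), of n]]
    by (auto simp: real_differentiable_def)
  have "{x. \<phi> x \<noteq> 0} \<subseteq> {a..b}" using supp by blast
  then have "bounded {x. \<phi> x \<noteq> 0}" by (rule bounded_subset[rotated]) simp
  then show "compact (closure {x. \<phi> x \<noteq> 0})" by simp
qed

lemma test_function_deriv:
  assumes "test_function \<phi>"
  shows "test_function (deriv \<phi>)"
  unfolding test_function_def
proof (intro conjI allI)
  fix n x
  have "(deriv ^^ n) (deriv \<phi>) = (deriv ^^ Suc n) \<phi>" by (simp only: funpow_Suc_right o_apply)
  then show "(deriv ^^ n) (deriv \<phi>) differentiable at x"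
    using assms unfolding test_function_def by metis
  have "{x. deriv \<phi> x \<noteq> 0} \<subseteq> closure {x. \<phi> x \<noteq> 0}"
  proof
    fix x assume "x \<in> {x. deriv \<phi> x \<noteq> 0}"
    show "x \<in> closure {x. \<phi> x \<noteq> 0}"
    proof (rule ccontr)
      assume x: "x \<notin> closure {x. \<phi> x \<noteq> 0}"
      have "((\<lambda>x. 0) has_real_derivative 0) (at x)" by simp
      then have "(\<phi> has_real_derivative 0) (at x)"
      proof (rule has_field_derivative_transform_within_open)
        show "open (- closure {x. \<phi> x \<noteq> 0})" by (simp add: open_Compl)
        show "0 = \<phi> y" if "y \<in> - closure {x. \<phi> x \<noteq> 0}" for y
          using that closure_subset[of "{x. \<phi> x \<noteq> 0}"] by auto
      qed (use x in simp)
      then show False using \<open>x \<in> {x. deriv \<phi> x \<noteq> 0}\<close> by (auto dest: DERIV_imp_deriv)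
    qed
  qed
  then have "closure {x. deriv \<phi> x \<noteq> 0} \<subseteq> closure {x. \<phi> x \<noteq> 0}"
    by (simp add: closure_minimal)
  then show "compact (closure {x. deriv \<phi> x \<noteq> 0})"
    using assms unfolding test_function_def by (metis bounded_subset compact_eq_bounded_closed closed_closure)
qed

lemma test_function_has_derivative:
  assumes "test_function \<phi>"
  shows "(\<phi> has_real_derivative deriv \<phi> x) (at x)"
proof -
  have "(deriv ^^ 0) \<phi> differentiable at x" using assms unfolding test_function_def by blast
  then show ?thesis by (simp add: DERIV_deriv_iff_real_differentiable)
qed

lemma test_function_continuous:
  assumes "test_function \<phi>"
  shows "continuous_on A \<phi>"
  using test_function_has_derivative[OF assms]
  by (auto intro!: continuous_at_imp_continuous_on DERIV_isCont)

lemma test_function_support: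
  assumes "test_function \<phi>"
  obtains a b :: real where "a < b" "\<And>x. x \<notin> {a<..<b} \<Longrightarrow> \<phi> x = 0"
proof -
  have "bounded (closure {x. \<phi> x \<noteq> 0})"
    using assms by (auto simp: test_function_def compact_imp_bounded)
  then obtain r where r: "\<And>x. x \<in> closure {x. \<phi> x \<noteq> 0} \<Longrightarrow> \<bar>x\<bar> \<le> r" "0 < r"
    by (auto simp: bounded_pos)
  show ?thesis
  proof (rule that[of "- (r + 1)" "r + 1"])
    fix x assume "x \<notin> {- (r + 1)<..<r + 1}"
    then show "\<phi> x = 0" using r(1)[of x] closure_subset[of "{x. \<phi> x \<noteq> 0}"] by fastforce
  qed (use r in auto)
qed

text \<open>As \<open>n\<close> grows, \<open>flat 0 (n * y)\<close> tends to \<open>1\<close> for each \<open>y > 0\<close>, so these products tend to the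
indicator of the open interval while staying between \<open>0\<close> and \<open>1\<close>; no plateau is needed.\<close>

definition smooth_indicator :: "real \<Rightarrow> real \<Rightarrow> nat \<Rightarrow> real \<Rightarrow> real" where
  "smooth_indicator a b n x = flat 0 (real n * (x - a)) * flat 0 (real n * (b - x))"

lemma smooth_indicator_smooth: "smooth_generated (smooth_indicator a b n)"
proof -
  have "smooth_generated (\<lambda>x. flat 0 (real n * x + (- real n * a)) * flat 0 ((- real n) * x + real n * b))"
    by (intro smooth_generated.intros)
  moreover have "(\<lambda>x. flat 0 (real n * x + (- real n * a)) * flat 0 ((- real n) * x + real n * b))
      = smooth_indicator a b n"
    by (rule ext) (simp add: smooth_indicator_def algebra_simps)
  ultimately show ?thesis by simp
qed

lemma flat_0_bounds: "0 \<le> flat 0 y" "flat 0 y \<le> 1"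
  by (auto simp: flat_def)

lemma smooth_indicator_le: "\<bar>smooth_indicator a b n x\<bar> \<le> indicator {a<..<b} x"
proof (cases "x \<in> {a<..<b}")
  case True
  then show ?thesis
    using flat_0_bounds by (simp add: smooth_indicator_def abs_mult mult_le_one)
next
  case False
  then have "x - a \<le> 0 \<or> b - x \<le> 0" by auto
  then have "real n * (x - a) \<le> 0 \<or> real n * (b - x) \<le> 0"
    by (auto simp: mult_le_0_iff)
  then show ?thesis by (auto simp: smooth_indicator_def flat_def)
qed

lemma smooth_indicator_tendsto:
  "(\<lambda>n. smooth_indicator a b n x) \<longlonglongrightarrow> indicator {a<..<b} x"
proof (cases "x \<in> {a<..<b}")
  case True
  have one: "(\<lambda>n. flat 0 (real n * y)) \<longlonglongrightarrow> 1" if "0 < y" for y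
  proof (rule Lim_transform_eventually)
    have "(\<lambda>n. exp (- (1 / y * inverse (real n)))) \<longlonglongrightarrow> exp (- (1 / y * 0))"
      by (intro tendsto_intros lim_inverse_n)
    then show "(\<lambda>n. exp (- (1 / y * inverse (real n)))) \<longlonglongrightarrow> 1" by simp
    show "\<forall>\<^sub>F n in sequentially. exp (- (1 / y * inverse (real n))) = flat 0 (real n * y)"
      using eventually_gt_at_top[of 0]
      by eventually_elim (use that in \<open>simp add: flat_def field_simps\<close>)
  qed
  have "(\<lambda>n. smooth_indicator a b n x) \<longlonglongrightarrow> 1 * 1"
    unfolding smooth_indicator_def using True by (intro tendsto_intros one) auto
  then show ?thesis using True by simp
next
  case False
  then have "x - a \<le> 0 \<or> b - x \<le> 0" by auto
  then have "smooth_indicator a b n x = 0" for n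
    by (auto simp: smooth_indicator_def flat_def zero_less_mult_iff)
  then show ?thesis using False by simp
qed

lemma smooth_indicator_continuous: "continuous_on A (smooth_indicator a b n)"
proof -
  obtain f' where "\<And>x. (smooth_indicator a b n has_real_derivative f' x) (at x)"
    using smooth_generated_deriv[OF smooth_indicator_smooth] by blast
  then show ?thesis by (auto intro!: continuous_at_imp_continuous_on DERIV_isCont)
qed

lemma smooth_indicator_measurable[measurable]: "smooth_indicator a b n \<in> borel_measurable borel"
  by (rule borel_measurable_continuous_onI) (rule smooth_indicator_continuous)

section \<open>Primitives of locally integrable functions\<close>

definition loc_integrable :: "(real \<Rightarrow> real) \<Rightarrow> bool" where
  "loc_integrable f \<longleftrightarrow> f \<in> borel_measurable borel \<and> (\<forall>a b. set_integrable lborel {a..b} f)"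

text \<open>Equivalently, \<open>F\<close> is locally absolutely continuous with derivative \<open>f\<close> almost everywhere.\<close>

definition is_primitive :: "(real \<Rightarrow> real) \<Rightarrow> (real \<Rightarrow> real) \<Rightarrow> bool" where
  "is_primitive F f \<longleftrightarrow> loc_integrable f \<and> (\<forall>a b. a \<le> b \<longrightarrow> F b - F a = (LINT x:{a..b}|lborel. f x))"

lemma loc_integrable_measurable: "loc_integrable f \<Longrightarrow> f \<in> borel_measurable borel"
  by (simp add: loc_integrable_def)

lemma loc_integrable_continuous:
  assumes "continuous_on UNIV f"
  shows "loc_integrable f"
  unfolding loc_integrable_def
  using assms by (auto intro!: borel_measurable_continuous_onI borel_integrable_atLeastAtMost'
      intro: continuous_on_subset)

lemma loc_integrable_sq_integrable:
  assumes "sq_integrable f"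
  shows "loc_integrable f"
  unfolding loc_integrable_def
proof (intro conjI allI)
  show m[measurable]: "f \<in> borel_measurable borel" using assms by (simp add: sq_integrable_def)
  fix a b :: real
  have "sq_integrable (indicator {a..b} :: real \<Rightarrow> real)"
  proof -
    have "(\<lambda>x. (indicator {a..b} x :: real)\<^sup>2) = indicator {a..b}"
      by (auto split: split_indicator)
    then show ?thesis by (auto simp: sq_integrable_def emeasure_lborel_Icc_eq intro!: integrable_real_indicator)
  qed
  from sq_integrable_mult[OF this assms] show "set_integrable lborel {a..b} f"
    by (simp add: set_integrable_def)
qed

lemma loc_integrable_diff:
  "loc_integrable f \<Longrightarrow> loc_integrable g \<Longrightarrow> loc_integrable (\<lambda>x. f x - g x)"
  unfolding loc_integrable_def by auto

lemma set_integral_combine: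
  assumes "loc_integrable f" "a \<le> b" "b \<le> c"
  shows "(LINT x:{a..b}|lborel. f x) + (LINT x:{b..c}|lborel. f x) = (LINT x:{a..c}|lborel. f x)"
proof -
  have "(LINT x:{a..b} \<union> {b..c}|lborel. f x) = (LINT x:{a..b}|lborel. f x) + (LINT x:{b..c}|lborel. f x)"
  proof (rule set_integral_Un_AE)
    show "AE x in lborel. \<not> (x \<in> {a..b} \<and> x \<in> {b..c})"
      using AE_lborel_singleton[of b] by eventually_elim auto
  qed (use assms in \<open>auto simp: loc_integrable_def\<close>)
  moreover have "{a..b} \<union> {b..c} = {a..c}" using assms by auto
  ultimately show ?thesis by simp
qed

lemma is_primitive_exists:
  assumes "loc_integrable f"
  obtains F where "is_primitive F f"
proof -
  define F where "F x = (if 0 \<le> x then LINT y:{0..x}|lborel. f y else - (LINT y:{x..0}|lborel. f y))" for x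
  have "F b - F a = (LINT x:{a..b}|lborel. f x)" if "a \<le> b" for a b
    using set_integral_combine[OF assms, of a 0 b] set_integral_combine[OF assms, of 0 a b]
      set_integral_combine[OF assms, of a b 0] that by (auto simp: F_def)
  then show ?thesis using assms that[of F] by (auto simp: is_primitive_def)
qed

lemma is_primitive_deriv:
  assumes "\<And>x. (F has_real_derivative f x) (at x)" "continuous_on UNIV f"
  shows "is_primitive F f"
  unfolding is_primitive_def
proof (intro conjI allI impI)
  show "loc_integrable f" by (rule loc_integrable_continuous) fact
  fix a b :: real assume "a \<le> b"
  then have "(LINT x|lborel. indicator {a..b} x *\<^sub>R f x) = F b - F a"
    using assms by (intro integral_FTC_atLeastAtMost)
      (auto intro: continuous_on_subset has_field_derivative_at_within
        simp flip: has_real_derivative_iff_has_vector_derivative)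
  then show "F b - F a = (LINT x:{a..b}|lborel. f x)" by (simp add: set_lebesgue_integral_def)
qed

lemma is_primitive_continuous:
  assumes "is_primitive F f"
  shows "continuous_on UNIV F"
proof -
  have "isCont F x" for x
  proof -
    have int: "set_integrable lborel {x - 1..x + 1} f"
      using assms by (auto simp: is_primitive_def loc_integrable_def)
    have "continuous_on {x - 1..x + 1} (\<lambda>y. F (x - 1) + integral {x - 1..y} f)"
      by (intro continuous_intros indefinite_integral_continuous_1 set_borel_integral_eq_integral(1)[OF int])
    also have "?this \<longleftrightarrow> continuous_on {x - 1..x + 1} F"
    proof (rule continuous_on_cong[OF refl])
      fix y assume "y \<in> {x - 1..x + 1}"
      then have "F y - F (x - 1) = (LINT x:{x - 1..y}|lborel. f x)"
        using assms by (auto simp: is_primitive_def)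
      also have "\<dots> = integral {x - 1..y} f"
        using assms by (intro set_borel_integral_eq_integral) (auto simp: is_primitive_def loc_integrable_def)
      finally show "F (x - 1) + integral {x - 1..y} f = F y" by simp
    qed
    finally have "continuous_on {x - 1<..<x + 1} F" by (rule continuous_on_subset) auto
    then show ?thesis by (simp add: continuous_on_eq_continuous_at)
  qed
  then show ?thesis by (simp add: continuous_on_eq_continuous_at)
qed

lemma loc_integrable_mult_continuous:
  assumes "loc_integrable f" "continuous_on UNIV G"
  shows "loc_integrable (\<lambda>x. f x * G x)"
  unfolding loc_integrable_def
proof (intro conjI allI)
  have [measurable]: "f \<in> borel_measurable borel" "G \<in> borel_measurable borel"
    using assms by (auto simp: loc_integrable_def intro: borel_measurable_continuous_onI)
  show "(\<lambda>x. f x * G x) \<in> borel_measurable borel" by measurable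
  fix a b :: real
  have "bounded (G ` {a..b})"
    by (intro compact_imp_bounded compact_continuous_image continuous_on_subset[OF assms(2)]) auto
  then obtain K where "\<forall>x\<in>{a..b}. \<bar>G x\<bar> \<le> K" by (auto simp: bounded_iff)
  then have K: "\<bar>G x\<bar> \<le> K" if "x \<in> {a..b}" for x using that by blast
  have "set_integrable lborel {a..b} (\<lambda>x. K * f x)"
    using assms(1) by (auto simp: loc_integrable_def)
  then show "set_integrable lborel {a..b} (\<lambda>x. f x * G x)"
  proof (rule set_integrable_bound)
    show "AE x in lborel. x \<in> {a..b} \<longrightarrow> norm (f x * G x) \<le> norm (K * f x)"
    proof (intro AE_I2 impI)
      fix x assume "x \<in> {a..b}"
      then have "\<bar>G x\<bar> \<le> \<bar>K\<bar>" using K[of x] by linarith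
      then show "norm (f x * G x) \<le> norm (K * f x)"
        by (simp add: abs_mult mult.commute mult_right_mono)
    qed
  qed (simp add: set_borel_measurable_def)
qed

text \<open>Integration by parts: the product \<open>f x * g y\<close> over the square \<open>{a..b} \<times> {a..b}\<close> is integrated
over the two triangles below and above the diagonal, in each case first along the direction
in which the inner integral is an increment of \<open>G\<close> or of \<open>F\<close>.\<close>

lemma is_primitive_parts:
  assumes F: "is_primitive F f" and G: "is_primitive G g"
  shows "is_primitive (\<lambda>x. F x * G x) (\<lambda>x. f x * G x + g x * F x)"
  unfolding is_primitive_def
proof (intro conjI allI impI)
  note contF = is_primitive_continuous[OF F] and contG = is_primitive_continuous[OF G]
  have lf: "loc_integrable f" and lg: "loc_integrable g"
    using F G by (auto simp: is_primitive_def)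
  have lfG: "loc_integrable (\<lambda>x. f x * G x)" and lgF: "loc_integrable (\<lambda>x. g x * F x)"
    by (intro loc_integrable_mult_continuous lf lg contF contG)+
  show "loc_integrable (\<lambda>x. f x * G x + g x * F x)"
    using lfG lgF unfolding loc_integrable_def by auto
  fix a b :: real assume ab: "a \<le> b"
  define f' where "f' x = indicator {a..b} x * f x" for x
  define g' where "g' x = indicator {a..b} x * g x" for x
  have f'[measurable]: "integrable lborel f'" and g'[measurable]: "integrable lborel g'"
    using lf lg unfolding f'_def g'_def by (auto simp: loc_integrable_def set_integrable_def)
  have [measurable]: "f' \<in> borel_measurable borel" "g' \<in> borel_measurable borel"
    using f' g' by (auto dest: borel_measurable_integrable)
  have prod: "integrable (lborel \<Otimes>\<^sub>M lborel) (\<lambda>(x, y). f' x * g' y)"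
  proof (rule lborel_pair.Fubini_integrable)
    show "integrable lborel (\<lambda>x. LINT y|lborel. norm (case (x, y) of (x, y) \<Rightarrow> f' x * g' y))"
      using f' g' by (simp add: abs_mult)
    show "AE x in lborel. integrable lborel (\<lambda>y. case (x, y) of (x, y) \<Rightarrow> f' x * g' y)"
      using g' by simp
  qed simp
  have low: "integrable (lborel \<Otimes>\<^sub>M lborel) (\<lambda>(x, y). if y \<le> x then f' x * g' y else 0)"
    by (rule Bochner_Integration.integrable_bound[OF prod]) auto
  have up: "integrable (lborel \<Otimes>\<^sub>M lborel) (\<lambda>(x, y). if x < y then f' x * g' y else 0)"
    by (rule Bochner_Integration.integrable_bound[OF prod]) auto
  have inner_low: "(LINT y|lborel. (if y \<le> x then f' x * g' y else 0)) = indicator {a..b} x * (f x * (G x - G a))" for x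
  proof (cases "x \<in> {a..b}")
    case True
    have "(LINT y|lborel. (if y \<le> x then f' x * g' y else 0)) = f x * (LINT y:{a..x}|lborel. g y)"
      using True unfolding set_lebesgue_integral_def f'_def g'_def
      by (subst Bochner_Integration.integral_mult_right_zero[symmetric], intro Bochner_Integration.integral_cong) (auto split: split_indicator)
    then show ?thesis using True G by (auto simp: is_primitive_def)
  next
    case False
    then have "f' x = 0" by (auto simp: f'_def)
    then show ?thesis using False by (simp cong: if_cong)
  qed
  have inner_up: "(LINT x|lborel. (if x < y then f' x * g' y else 0)) = indicator {a..b} y * (g y * (F y - F a))" for y
  proof (cases "y \<in> {a..b}")
    case True
    have "(LINT x|lborel. (if x < y then f' x * g' y else 0)) = (LINT x|lborel. g y * (indicator {a..y} x *\<^sub>R f x))"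
    proof (rule integral_cong_AE)
      show "AE x in lborel. (if x < y then f' x * g' y else 0) = g y * (indicator {a..y} x *\<^sub>R f x)"
        using AE_lborel_singleton[of y]
        by eventually_elim (use True in \<open>auto simp: f'_def g'_def split: split_indicator\<close>)
    qed (use lf in \<open>auto simp: loc_integrable_def intro!: borel_measurable_times\<close>)
    also have "\<dots> = g y * (LINT x:{a..y}|lborel. f x)"
      by (simp add: set_lebesgue_integral_def)
    finally show ?thesis using True F by (auto simp: is_primitive_def)
  next
    case False
    then have "g' y = 0" by (auto simp: g'_def)
    then show ?thesis using False by (simp cong: if_cong)
  qed
  have "(F b - F a) * (G b - G a) = (LINT x|lborel. f' x) * (LINT y|lborel. g' y)"
    using F G ab by (simp add: is_primitive_def set_lebesgue_integral_def f'_def g'_def)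
  also have "\<dots> = (LINT x|lborel. (LINT y|lborel. f' x * g' y))" by simp
  also have "\<dots> = integral\<^sup>L (lborel \<Otimes>\<^sub>M lborel) (\<lambda>(x, y). f' x * g' y)"
    by (rule lborel_pair.integral_fst[OF prod])
  also have "\<dots> = integral\<^sup>L (lborel \<Otimes>\<^sub>M lborel)
      (\<lambda>z. (case z of (x, y) \<Rightarrow> (if y \<le> x then f' x * g' y else 0)) + (case z of (x, y) \<Rightarrow> (if x < y then f' x * g' y else 0)))"
    by (intro Bochner_Integration.integral_cong) (auto split: split_indicator)
  also have "\<dots> = integral\<^sup>L (lborel \<Otimes>\<^sub>M lborel) (\<lambda>(x, y). if y \<le> x then f' x * g' y else 0)
      + integral\<^sup>L (lborel \<Otimes>\<^sub>M lborel) (\<lambda>(x, y). if x < y then f' x * g' y else 0)"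
    by (rule Bochner_Integration.integral_add[OF low up])
  also have "integral\<^sup>L (lborel \<Otimes>\<^sub>M lborel) (\<lambda>(x, y). if y \<le> x then f' x * g' y else 0)
      = (LINT x:{a..b}|lborel. f x * (G x - G a))"
    unfolding lborel_pair.integral_fst[OF low, symmetric] inner_low by (simp add: set_lebesgue_integral_def)
  also have "integral\<^sup>L (lborel \<Otimes>\<^sub>M lborel) (\<lambda>(x, y). if x < y then f' x * g' y else 0)
      = (LINT y:{a..b}|lborel. g y * (F y - F a))"
    unfolding lborel_pair.integral_snd[OF up, symmetric] inner_up by (simp add: set_lebesgue_integral_def)
  also have "(LINT x:{a..b}|lborel. f x * (G x - G a))
      = (LINT x:{a..b}|lborel. f x * G x) - G a * (F b - F a)"
    using lf lfG F ab by (simp add: right_diff_distrib set_integral_diff loc_integrable_def is_primitive_def mult.commute)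
  also have "(LINT y:{a..b}|lborel. g y * (F y - F a))
      = (LINT x:{a..b}|lborel. g x * F x) - F a * (G b - G a)"
    using lg lgF G ab by (simp add: right_diff_distrib set_integral_diff loc_integrable_def is_primitive_def mult.commute)
  finally have "F b * G b - F a * G a = (LINT x:{a..b}|lborel. f x * G x) + (LINT x:{a..b}|lborel. g x * F x)"
    by (simp add: algebra_simps)
  also have "\<dots> = (LINT x:{a..b}|lborel. f x * G x + g x * F x)"
    using lfG lgF by (intro set_integral_add(2)[symmetric]) (auto simp: loc_integrable_def)
  finally show "F b * G b - F a * G a = (LINT x:{a..b}|lborel. f x * G x + g x * F x)" .
qed


section \<open>Weak derivatives are derivatives of primitives\<close>

lemma integrable_compact_support:
  assumes "loc_integrable g" "\<And>x. x \<notin> {A..B} \<Longrightarrow> g x = 0"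
  shows "integrable lborel g" "integral\<^sup>L lborel g = (LINT x:{A..B}|lborel. g x)"
proof -
  have eq: "(\<lambda>x. indicator {A..B} x *\<^sub>R g x) = g"
    using assms(2) by (auto simp: fun_eq_iff split: split_indicator)
  have "set_integrable lborel {A..B} g" using assms(1) by (simp add: loc_integrable_def)
  then show "integrable lborel g" unfolding set_integrable_def eq .
  show "integral\<^sup>L lborel g = (LINT x:{A..B}|lborel. g x)"
    unfolding set_lebesgue_integral_def eq ..
qed

text \<open>On a bounded interval the positive and the negative part of \<open>w\<close> are densities of two finite
measures that agree on half-lines.\<close>

lemma AE_zero_if_interval_integrals_zero:
  assumes w: "loc_integrable w" and zero: "\<And>a b. a < b \<Longrightarrow> (LINT x:{a..b}|lborel. w x) = 0"
  shows "AE x in lborel. w x = 0"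
proof -
  have [measurable]: "w \<in> borel_measurable borel" using w by (rule loc_integrable_measurable)
  have "AE x in lborel. indicator {- real N..real N} x * w x = 0" for N
  proof -
    define v where "v x = indicator {- real N..real N} x * w x" for x
    have [measurable]: "v \<in> borel_measurable borel" unfolding v_def by measurable
    have tail: "(\<integral>\<^sup>+y. ennreal (indicator {x<..} y * v y) \<partial>lborel) < \<infinity>
      \<and> (\<integral>\<^sup>+y. ennreal (indicator {x<..} y * v y) \<partial>lborel) = (\<integral>\<^sup>+y. ennreal (- (indicator {x<..} y * v y)) \<partial>lborel)"
      for x
    proof -
      define h where "h y = indicator {x<..} y * v y" for y
      have AEh: "AE y in lborel. indicator {max x (- real N)..real N} y * w y = h y"
        using AE_lborel_singleton[of x]
        by eventually_elim (auto simp: h_def v_def split: split_indicator)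
      have hm[measurable]: "h \<in> borel_measurable borel" unfolding h_def by measurable
      have wi: "integrable lborel (\<lambda>y. indicator {max x (- real N)..real N} y * w y)"
        using w by (simp add: loc_integrable_def set_integrable_def)
      have int: "integrable lborel h"
        by (rule Bochner_Integration.integrable_cong_AE_imp[OF wi]) (use AEh in \<open>auto elim: eventually_mono\<close>)
      have "integral\<^sup>L lborel h = (LINT y:{max x (- real N)..real N}|lborel. w y)"
        unfolding set_lebesgue_integral_def
        by (rule integral_cong_AE) (use AEh in \<open>auto elim: eventually_mono\<close>)
      also have "\<dots> = 0"
      proof (cases "max x (- real N) < real N")
        case False
        then have "{max x (- real N)..real N} \<subseteq> {real N}" by auto
        then have "AE y in lborel. indicator {max x (- real N)..real N} y *\<^sub>R w y = 0"
          using AE_lborel_singleton[of "real N"] by (auto elim!: eventually_mono split: split_indicator)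
        then show ?thesis
          unfolding set_lebesgue_integral_def by (rule integral_eq_zero_AE)
      qed (rule zero)
      finally have "enn2real (\<integral>\<^sup>+y. ennreal (h y) \<partial>lborel) = enn2real (\<integral>\<^sup>+y. ennreal (- h y) \<partial>lborel)"
        using real_lebesgue_integral_def[OF int] by simp
      moreover have "(\<integral>\<^sup>+y. ennreal (h y) \<partial>lborel) \<noteq> \<infinity>" "(\<integral>\<^sup>+y. ennreal (- h y) \<partial>lborel) \<noteq> \<infinity>"
        using int by (auto simp: real_integrable_def)
      ultimately show ?thesis
        unfolding h_def[symmetric]
        by (metis ennreal_enn2real infinity_ennreal_def top.not_eq_extremum)
    qed
    have dens: "emeasure (density lborel (\<lambda>y. ennreal (v y))) {x<..}
        = (\<integral>\<^sup>+y. ennreal (indicator {x<..} y * v y) \<partial>lborel)"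
      "emeasure (density lborel (\<lambda>y. ennreal (- v y))) {x<..}
        = (\<integral>\<^sup>+y. ennreal (- (indicator {x<..} y * v y)) \<partial>lborel)" for x
      by (subst emeasure_density; auto intro!: nn_integral_cong split: split_indicator)+
    have "density lborel (\<lambda>y. ennreal (v y)) = density lborel (\<lambda>y. ennreal (- v y))"
      by (rule measure_eqI_lessThan) (use tail[THEN conjunct1] in
          \<open>simp_all add: dens tail[THEN conjunct2, symmetric]\<close>)
    then have "AE x in lborel. ennreal (v x) = ennreal (- v x)"
      by (intro sigma_finite_measure.density_unique[OF sigma_finite_lborel]) auto
    then show ?thesis
    proof eventually_elim
      case (elim x)
      then have "v x = 0"
        by (cases "0 \<le> v x") (auto simp: ennreal_eq_0_iff ennreal_neg)
      then show ?case by (simp add: v_def)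
    qed
  qed
  then have "AE x in lborel. \<forall>N. indicator {- real N..real N} x * w x = 0"
    unfolding AE_all_countable by blast
  then show ?thesis
  proof eventually_elim
    case (elim x)
    obtain N where "\<bar>x\<bar> \<le> real N" using real_arch_simple by blast
    then show ?case using elim[rule_format, of N] by (auto split: split_indicator_asm)
  qed
qed

lemma integral_smooth_indicator_tendsto:
  assumes w: "loc_integrable w"
  shows "(\<lambda>n. LINT x|lborel. w x * smooth_indicator a b n x) \<longlonglongrightarrow> (LINT x:{a..b}|lborel. w x)"
  unfolding set_lebesgue_integral_def
proof (rule integral_dominated_convergence)
  have [measurable]: "w \<in> borel_measurable borel" using w by (rule loc_integrable_measurable)
  show "(\<lambda>x. indicator {a..b} x *\<^sub>R w x) \<in> borel_measurable lborel"
    "(\<lambda>x. w x * smooth_indicator a b n x) \<in> borel_measurable lborel" for n by measurable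
  show "integrable lborel (\<lambda>x. \<bar>indicator {a..b} x *\<^sub>R w x\<bar>)"
    using w by (intro integrable_abs) (simp add: loc_integrable_def set_integrable_def)
  show "AE x in lborel. (\<lambda>n. w x * smooth_indicator a b n x) \<longlonglongrightarrow> indicator {a..b} x *\<^sub>R w x"
    using AE_lborel_singleton[of a] AE_lborel_singleton[of b]
  proof eventually_elim
    case (elim x)
    have "(\<lambda>n. w x * smooth_indicator a b n x) \<longlonglongrightarrow> w x * indicator {a<..<b} x"
      by (intro tendsto_intros smooth_indicator_tendsto)
    also have "w x * indicator {a<..<b} x = indicator {a..b} x *\<^sub>R w x"
      using elim by (auto split: split_indicator)
    finally show ?case .
  qed
  show "AE x in lborel. norm (w x * smooth_indicator a b n x) \<le> \<bar>indicator {a..b} x *\<^sub>R w x\<bar>" for n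
  proof (rule AE_I2)
    fix x
    have "\<bar>smooth_indicator a b n x\<bar> \<le> indicator {a..b} x"
      by (rule order_trans[OF smooth_indicator_le]) (auto split: split_indicator)
    from mult_left_mono[OF this, of "\<bar>w x\<bar>"]
    show "norm (w x * smooth_indicator a b n x) \<le> \<bar>indicator {a..b} x *\<^sub>R w x\<bar>"
      by (simp add: abs_mult mult.commute)
  qed
qed

text \<open>A test function with derivative \<open>J * \<chi>\<^sub>1 - I * \<chi>\<^sub>2\<close> exists whenever \<open>\<chi>\<^sub>1\<close> and \<open>\<chi>\<^sub>2\<close> are smooth
with compact support and integrals \<open>I\<close> and \<open>J\<close>. Letting these tend to the indicators of \<open>{a..b}\<close>
and \<open>{0..1}\<close> shows that the mean of \<open>w\<close> over \<open>{a..b}\<close> is its mean over the unit interval.\<close>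

lemma du_bois_reymond:
  assumes w: "loc_integrable w"
    and orth: "\<And>\<phi>. test_function \<phi> \<Longrightarrow> (LINT x|lborel. w x * deriv \<phi> x) = 0"
  obtains c where "AE x in lborel. w x = c"
proof -
  define c where "c = (LINT x:{0..1}|lborel. w x)"
  have wlin: "(LINT x:{a..b}|lborel. w x) = (b - a) * c" if ab: "a < b" for a b
  proof -
    define m where "m = min a 0"
    define M where "M = max b 1"
    have m: "m \<le> a" "m \<le> 0" "b \<le> M" "1 \<le> M" "m \<le> M"
      using ab by (auto simp: m_def M_def)
    define I where "I n = (LINT x|lborel. smooth_indicator a b n x)" for n
    define J where "J n = (LINT x|lborel. smooth_indicator 0 1 n x)" for n
    have li: "loc_integrable (smooth_indicator a b n)" for a b n
      by (intro loc_integrable_continuous smooth_indicator_continuous)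
    have out: "smooth_indicator a b n x = 0" if "x \<notin> {a<..<b}" for a b n x
      using smooth_indicator_le[of a b n x] that by simp
    have int: "integrable lborel (smooth_indicator a b n)" for a b n
      by (rule integrable_compact_support[OF li, of a b]) (auto intro: out)
    have wint: "integrable lborel (\<lambda>x. w x * smooth_indicator a b n x)" for a b n
      by (rule integrable_compact_support[OF loc_integrable_mult_continuous[OF w smooth_indicator_continuous], of a b])
        (auto intro: out)
    have eq: "J n * (LINT x|lborel. w x * smooth_indicator a b n x)
        - I n * (LINT x|lborel. w x * smooth_indicator 0 1 n x) = 0" for n
    proof -
      \<comment> \<open>Weighted by each other's integrals, the two bumps have total integral zero, so the antiderivative \<open>\<phi>\<close> of \<open>\<psi>\<close> has compact support.\<close>
      define \<psi> where "\<psi> x = J n * smooth_indicator a b n x + (- I n) * smooth_indicator 0 1 n x" for x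
      have \<psi>s: "smooth_generated \<psi>"
        unfolding \<psi>_def by (intro smooth_generated.add smooth_generated.mult smooth_generated.const smooth_indicator_smooth)
      have \<psi>c: "continuous_on UNIV \<psi>"
        unfolding \<psi>_def by (intro continuous_intros smooth_indicator_continuous)
      have \<psi>0: "\<psi> x = 0" if "x \<notin> {m<..<M}" for x
      proof -
        have "x \<notin> {a<..<b}" "x \<notin> {0<..<1}" using that m by auto
        then show ?thesis by (simp add: \<psi>_def out)
      qed
      have \<psi>int: "integral\<^sup>L lborel \<psi> = 0"
        unfolding \<psi>_def using int by (simp add: I_def J_def)
      obtain F where F: "\<And>x. (F has_real_derivative \<psi> x) (at x)"
        using einterval_antiderivative[of "- \<infinity>" \<infinity> \<psi>] \<psi>c
        by (auto simp: continuous_on_eq_continuous_at has_real_derivative_iff_has_vector_derivative)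
      define \<phi> where "\<phi> x = F x - F m" for x
      have \<phi>d: "(\<phi> has_real_derivative \<psi> x) (at x)" for x
        unfolding \<phi>_def using F[of x] by (auto intro!: derivative_eq_intros)
      note prim = is_primitive_deriv[OF \<phi>d \<psi>c]
      have "test_function \<phi>"
      proof (rule test_functionI)
        show "smooth_generated \<phi>" by (rule smooth_generated.primitive[OF \<psi>s \<phi>d])
        fix x assume "x \<notin> {m..M}"
        then consider "x < m" | "M < x" by force
        then show "\<phi> x = 0"
        proof cases
          case 1
          have "\<phi> m - \<phi> x = (LINT y:{x..m}|lborel. \<psi> y)"
            using prim 1 by (simp add: is_primitive_def)
          also have "(\<lambda>y. indicator {x..m} y *\<^sub>R \<psi> y) = (\<lambda>y. 0)"
            by (auto simp: fun_eq_iff split: split_indicator intro!: \<psi>0)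
          then have "(LINT y:{x..m}|lborel. \<psi> y) = 0" by (simp add: set_lebesgue_integral_def)
          finally show ?thesis by (simp add: \<phi>_def)
        next
          case 2
          then have "\<phi> x - \<phi> m = (LINT y:{m..x}|lborel. \<psi> y)"
            using prim m by (simp add: is_primitive_def)
          also have "(\<lambda>y. indicator {m..x} y *\<^sub>R \<psi> y) = \<psi>"
          proof
            fix y
            show "indicator {m..x} y *\<^sub>R \<psi> y = \<psi> y"
              using 2 \<psi>0[of y] by (cases "y \<in> {m<..<M}") auto
          qed
          then have "(LINT y:{m..x}|lborel. \<psi> y) = 0" using \<psi>int by (simp add: set_lebesgue_integral_def)
          finally show ?thesis by (simp add: \<phi>_def)
        qed
      qed
      from orth[OF this] have "(LINT x|lborel. w x * \<psi> x) = 0"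
        by (simp add: DERIV_imp_deriv[OF \<phi>d])
      also have "(LINT x|lborel. w x * \<psi> x) = (LINT x|lborel.
          J n * (w x * smooth_indicator a b n x) - I n * (w x * smooth_indicator 0 1 n x))"
        by (intro Bochner_Integration.integral_cong) (auto simp: \<psi>_def algebra_simps)
      finally show ?thesis using wint by simp
    qed
    have lim1: "(\<lambda>n. LINT x|lborel. smooth_indicator a b n x) \<longlonglongrightarrow> b - a" if "a < b" for a b
    proof -
      have "loc_integrable (\<lambda>x. 1)" by (rule loc_integrable_continuous) simp
      from integral_smooth_indicator_tendsto[OF this, of a b]
      show ?thesis using that by (simp add: set_lebesgue_integral_def)
    qed
    have "(\<lambda>n. J n * (LINT x|lborel. w x * smooth_indicator a b n x)
        - I n * (LINT x|lborel. w x * smooth_indicator 0 1 n x))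
        \<longlonglongrightarrow> (1 - 0) * (LINT x:{a..b}|lborel. w x) - (b - a) * c"
      unfolding I_def J_def c_def
      by (intro tendsto_intros lim1 integral_smooth_indicator_tendsto w ab) simp
    then show ?thesis unfolding eq by (simp add: LIMSEQ_const_iff)
  qed
  have lc: "loc_integrable (\<lambda>x. c)" by (rule loc_integrable_continuous) simp
  have "AE x in lborel. w x - c = 0"
  proof (rule AE_zero_if_interval_integrals_zero)
    show "loc_integrable (\<lambda>x. w x - c)" by (rule loc_integrable_diff[OF w lc])
    fix a b :: real assume "a < b"
    have "(LINT x:{a..b}|lborel. w x - c) = (LINT x:{a..b}|lborel. w x) - (LINT x:{a..b}|lborel. c)"
      using w lc by (intro set_integral_diff) (auto simp: loc_integrable_def)
    also have "(LINT x:{a..b}|lborel. c) = (b - a) * c"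
      using \<open>a < b\<close> by (simp add: set_lebesgue_integral_def)
    finally show "(LINT x:{a..b}|lborel. w x - c) = 0" using wlin[OF \<open>a < b\<close>] by simp
  qed
  then show ?thesis by (intro that[of c]) (auto elim: eventually_mono)
qed

lemma is_primitive_integral_test_function:
  assumes F: "is_primitive F f" and \<phi>: "test_function \<phi>"
  shows "integrable lborel (\<lambda>x. F x * deriv \<phi> x)"
    and "(LINT x|lborel. F x * deriv \<phi> x) = - (LINT x|lborel. f x * \<phi> x)"
proof -
  note \<phi>' = test_function_deriv[OF \<phi>]
  obtain a1 b1 where 1: "a1 < b1" "\<And>x. x \<notin> {a1<..<b1} \<Longrightarrow> \<phi> x = 0"
    using test_function_support[OF \<phi>] by blast
  obtain a2 b2 where 2: "a2 < b2" "\<And>x. x \<notin> {a2<..<b2} \<Longrightarrow> deriv \<phi> x = 0"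
    using test_function_support[OF \<phi>'] by blast
  define A where "A = min a1 a2"
  define B where "B = max b1 b2"
  have AB: "A \<le> B" using 1(1) by (simp add: A_def B_def)
  have z: "\<phi> x = 0" "deriv \<phi> x = 0" if "x \<notin> {A<..<B}" for x
  proof -
    have "x \<notin> {a1<..<b1}" "x \<notin> {a2<..<b2}" using that by (auto simp: A_def B_def)
    then show "\<phi> x = 0" "deriv \<phi> x = 0" using 1(2) 2(2) by blast+
  qed
  have Fc: "loc_integrable F" by (rule loc_integrable_continuous[OF is_primitive_continuous[OF F]])
  have l1: "loc_integrable (\<lambda>x. F x * deriv \<phi> x)"
    by (intro loc_integrable_mult_continuous Fc test_function_continuous[OF \<phi>'])
  have l2: "loc_integrable (\<lambda>x. f x * \<phi> x)"
    using F by (intro loc_integrable_mult_continuous test_function_continuous[OF \<phi>]) (simp add: is_primitive_def)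
  have "is_primitive \<phi> (deriv \<phi>)"
    by (intro is_primitive_deriv test_function_has_derivative[OF \<phi>] test_function_continuous[OF \<phi>'])
  from is_primitive_parts[OF F this]
  have "F B * \<phi> B - F A * \<phi> A = (LINT x:{A..B}|lborel. f x * \<phi> x + deriv \<phi> x * F x)"
    using AB by (simp add: is_primitive_def)
  also have "\<dots> = (LINT x:{A..B}|lborel. f x * \<phi> x + F x * deriv \<phi> x)"
    by (simp add: mult.commute)
  also have "\<dots> = (LINT x:{A..B}|lborel. f x * \<phi> x) + (LINT x:{A..B}|lborel. F x * deriv \<phi> x)"
    using l1 l2 by (intro set_integral_add(2)) (auto simp: loc_integrable_def)
  also have "(LINT x:{A..B}|lborel. f x * \<phi> x) = (LINT x|lborel. f x * \<phi> x)"
    by (rule integrable_compact_support(2)[OF l2, symmetric]) (auto intro!: z)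
  also have "(LINT x:{A..B}|lborel. F x * deriv \<phi> x) = (LINT x|lborel. F x * deriv \<phi> x)"
    by (rule integrable_compact_support(2)[OF l1, symmetric]) (auto intro!: z)
  finally show "(LINT x|lborel. F x * deriv \<phi> x) = - (LINT x|lborel. f x * \<phi> x)"
    using z(1)[of A] z(1)[of B] by simp
  show "integrable lborel (\<lambda>x. F x * deriv \<phi> x)"
    by (rule integrable_compact_support(1)[OF l1, of A B]) (auto intro!: z)
qed

text \<open>The difference of \<open>f\<close> and any primitive of its weak derivative has weak derivative zero.\<close>

lemma weakly_differentiable_imp_primitive:
  assumes f: "loc_integrable f" and f1: "loc_integrable f1"
    and weak: "\<And>\<phi>. test_function \<phi> \<Longrightarrow>
      (LINT x|lborel. f x * deriv \<phi> x) = - (LINT x|lborel. f1 x * \<phi> x)"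
  obtains F where "is_primitive F f1" "AE x in lborel. f x = F x"
proof -
  obtain F0 where F0: "is_primitive F0 f1" using is_primitive_exists[OF f1] .
  have l0: "loc_integrable F0" by (rule loc_integrable_continuous[OF is_primitive_continuous[OF F0]])
  have "\<exists>c. AE x in lborel. f x - F0 x = c"
  proof (rule du_bois_reymond)
    show "loc_integrable (\<lambda>x. f x - F0 x)" by (rule loc_integrable_diff[OF f l0])
    fix \<phi> assume \<phi>: "test_function \<phi>"
    obtain a b where z: "\<And>x. x \<notin> {a<..<b} \<Longrightarrow> deriv \<phi> x = 0"
      using test_function_support[OF test_function_deriv[OF \<phi>]] by blast
    have "integrable lborel (\<lambda>x. f x * deriv \<phi> x)"
      by (rule integrable_compact_support(1)[OF loc_integrable_mult_continuous[OF f
            test_function_continuous[OF test_function_deriv[OF \<phi>]]], of a b]) (auto intro!: z)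
    then show "(LINT x|lborel. (f x - F0 x) * deriv \<phi> x) = 0"
      using is_primitive_integral_test_function[OF F0 \<phi>] weak[OF \<phi>]
      by (simp add: left_diff_distrib)
  qed blast
  then obtain c where c: "AE x in lborel. f x - F0 x = c" by blast
  show ?thesis
  proof (rule that[of "\<lambda>x. F0 x + c"])
    show "is_primitive (\<lambda>x. F0 x + c) f1" using F0 by (simp add: is_primitive_def)
    show "AE x in lborel. f x = F0 x + c" using c by eventually_elim simp
  qed
qed

section \<open>Integration by parts and interpolation on the line\<close>

lemma integrable_small_beyond:
  fixes P :: "real \<Rightarrow> real"
  assumes P: "integrable lborel P" and "0 < e"
  obtains x where "X \<le> x" "\<bar>P x\<bar> < e"
proof -
  have "\<exists>x\<ge>X. \<bar>P x\<bar> < e"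
  proof (rule ccontr)
    assume neg: "\<not> ?thesis"
    define K where "K = (LINT x|lborel. \<bar>P x\<bar>)"
    have K: "e * real n \<le> K" for n
    proof -
      have "e * real n = (LINT x|lborel. e * indicator {X..X + real n} x)" by simp
      also have "\<dots> \<le> K"
        unfolding K_def
      proof (rule integral_mono)
        show "integrable lborel (\<lambda>x. e * indicator {X..X + real n} x)"
          by (intro integrable_mult_right integrable_real_indicator) (auto simp: emeasure_lborel_Icc_eq)
        show "e * indicator {X..X + real n} x \<le> \<bar>P x\<bar>" for x
          using neg by (auto simp: not_less split: split_indicator)
      qed (use P in auto)
      finally show ?thesis .
    qed
    obtain n where "K / e < real n" using reals_Archimedean2 by blast
    then show False using K[of n] \<open>0 < e\<close> by (simp add: field_simps)
  qed
  then show ?thesis using that by blast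
qed

text \<open>If both \<open>P\<close> and its derivative \<open>q\<close> are integrable, then \<open>P\<close> is small at some points beyond any
bound on either side. The increments of \<open>P\<close> between such points give both claims.\<close>

lemma integrable_primitive_vanishes:
  assumes P: "is_primitive P q" and iP: "integrable lborel P" and iq: "integrable lborel q"
  shows "integral\<^sup>L lborel q = 0" and "\<bar>P x\<bar> \<le> (LINT y|lborel. \<bar>q y\<bar>)"
proof -
  have "\<exists>b\<ge>real n. \<bar>P b\<bar> < 1 / real (Suc n)" for n
    using integrable_small_beyond[OF iP, of "1 / real (Suc n)" "real n"] by auto
  then obtain b where b: "\<And>n. real n \<le> b n" "\<And>n. \<bar>P (b n)\<bar> < 1 / real (Suc n)" by metis
  have iP': "integrable lborel (\<lambda>x. P (- x))"
    using lborel_integrable_real_affine[OF iP, of "-1" 0] by simp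
  have "\<exists>a\<ge>real n. \<bar>P (- a)\<bar> < 1 / real (Suc n)" for n
    using integrable_small_beyond[OF iP', of "1 / real (Suc n)" "real n"] by auto
  then obtain a where a: "\<And>n. real n \<le> a n" "\<And>n. \<bar>P (- a n)\<bar> < 1 / real (Suc n)" by metis
  have inv: "(\<lambda>n. 1 / real (Suc n)) \<longlonglongrightarrow> 0"
    using LIMSEQ_inverse_real_of_nat by (simp add: inverse_eq_divide)
  have Pb: "(\<lambda>n. P (b n)) \<longlonglongrightarrow> 0" and Pa: "(\<lambda>n. P (- a n)) \<longlonglongrightarrow> 0"
    by (rule Lim_null_comparison[OF _ inv], use a(2) b(2) in \<open>auto intro!: always_eventually intro: less_imp_le\<close>)+
  have "(\<lambda>n. LINT x|lborel. indicator {- a n..b n} x * q x) \<longlonglongrightarrow> integral\<^sup>L lborel q"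
  proof (rule integral_dominated_convergence[where w = "\<lambda>x. \<bar>q x\<bar>"])
    show "AE x in lborel. (\<lambda>n. indicator {- a n..b n} x * q x) \<longlonglongrightarrow> q x"
    proof (rule AE_I2, rule tendsto_eventually)
      fix x :: real
      obtain N where N: "\<bar>x\<bar> \<le> real N" using real_arch_simple by blast
      show "\<forall>\<^sub>F n in sequentially. indicator {- a n..b n} x * q x = q x"
        using eventually_ge_at_top[of N]
      proof eventually_elim
        case (elim n)
        then have "\<bar>x\<bar> \<le> real n" using N by linarith
        then have "x \<in> {- a n..b n}" using a(1)[of n] b(1)[of n] by (simp add: abs_le_iff)
        then show ?case by simp
      qed
    qed
  qed (use iq in \<open>auto split: split_indicator\<close>)
  moreover have "(LINT x|lborel. indicator {- a n..b n} x * q x) = P (b n) - P (- a n)" for n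
  proof -
    have "- a n \<le> b n" using a(1)[of n] b(1)[of n] by linarith
    then show ?thesis using P by (simp add: is_primitive_def set_lebesgue_integral_def)
  qed
  ultimately have "(\<lambda>n. P (b n) - P (- a n)) \<longlonglongrightarrow> integral\<^sup>L lborel q" by simp
  moreover have "(\<lambda>n. P (b n) - P (- a n)) \<longlonglongrightarrow> 0 - 0" by (intro tendsto_intros Pa Pb)
  ultimately show "integral\<^sup>L lborel q = 0" using LIMSEQ_unique by fastforce
  have "(\<lambda>n. \<bar>P x - P (- a n)\<bar>) \<longlonglongrightarrow> \<bar>P x - 0\<bar>" by (intro tendsto_intros Pa)
  then have "(\<lambda>n. \<bar>P x - P (- a n)\<bar>) \<longlonglongrightarrow> \<bar>P x\<bar>" by simp
  then show "\<bar>P x\<bar> \<le> (LINT y|lborel. \<bar>q y\<bar>)"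
  proof (rule LIMSEQ_le_const2)
    obtain N where N: "\<bar>x\<bar> \<le> real N" using real_arch_simple by blast
    have "\<bar>P x - P (- a n)\<bar> \<le> (LINT y|lborel. \<bar>q y\<bar>)" if "N \<le> n" for n
    proof -
      have "real N \<le> real n" using that by simp
      then have "- a n \<le> x" using a(1)[of n] N by linarith
      then have "\<bar>P x - P (- a n)\<bar> = \<bar>LINT y|lborel. indicator {- a n..x} y * q y\<bar>"
        using P by (simp add: is_primitive_def set_lebesgue_integral_def)
      also have "\<dots> \<le> (LINT y|lborel. \<bar>indicator {- a n..x} y * q y\<bar>)" by (rule integral_abs_bound)
      also have "\<dots> \<le> (LINT y|lborel. \<bar>q y\<bar>)"
      proof (rule integral_mono)
        have "set_integrable lborel {- a n..x} q"
          using P by (simp add: is_primitive_def loc_integrable_def)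
        then show "integrable lborel (\<lambda>y. \<bar>indicator {- a n..x} y * q y\<bar>)"
          by (simp add: set_integrable_def)
      qed (use iq in \<open>auto split: split_indicator\<close>)
      finally show ?thesis .
    qed
    then show "\<exists>N. \<forall>n\<ge>N. \<bar>P x - P (- a n)\<bar> \<le> (LINT y|lborel. \<bar>q y\<bar>)" by blast
  qed
qed

lemma integral_parts_line:
  assumes "is_primitive f f1" "is_primitive g g1"
    and sq: "sq_integrable f" "sq_integrable f1" "sq_integrable g" "sq_integrable g1"
  shows "(LINT x|lborel. f1 x * g x) = - (LINT x|lborel. g1 x * f x)"
proof -
  have "(LINT x|lborel. f1 x * g x + g1 x * f x) = 0"
    by (rule integrable_primitive_vanishes(1)[OF is_primitive_parts[OF assms(1,2)]])
      (auto intro!: sq_integrable_mult sq Bochner_Integration.integrable_add)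
  then show ?thesis by (simp add: sq_integrable_mult sq)
qed

text \<open>The elementary inequality \<open>f\<^sup>2 \<le> \<integral> 2 |f f'|\<close>, with the product split by a weight \<open>s\<close> that is
left free for the optimisation in \<open>Lp_potential_bound\<close>.\<close>

lemma square_sup_bound:
  assumes f: "is_primitive f f1" and sq: "sq_integrable f" "sq_integrable f1" and "0 < s"
  shows "(f x)\<^sup>2 \<le> s * (LINT x|lborel. (f x)\<^sup>2) + (LINT x|lborel. (f1 x)\<^sup>2) / s"
proof -
  have int: "integrable lborel (\<lambda>x. f1 x * f x + f1 x * f x)"
    by (intro Bochner_Integration.integrable_add sq_integrable_mult sq)
  have "\<bar>f x * f x\<bar> \<le> (LINT x|lborel. \<bar>f1 x * f x + f1 x * f x\<bar>)"
    by (rule integrable_primitive_vanishes(2)[OF is_primitive_parts[OF f f] sq_integrable_mult[OF sq(1,1)] int])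
  also have "\<dots> \<le> (LINT x|lborel. s * (f x)\<^sup>2 + (f1 x)\<^sup>2 / s)"
  proof (rule integral_mono)
    show "integrable lborel (\<lambda>x. s * (f x)\<^sup>2 + (f1 x)\<^sup>2 / s)"
      using sq by (auto simp: sq_integrable_def)
    fix x
    have "0 \<le> (\<bar>s * f x\<bar> - \<bar>f1 x\<bar>)\<^sup>2" by simp
    then have "2 * (s * (\<bar>f1 x\<bar> * \<bar>f x\<bar>)) \<le> s\<^sup>2 * (f x)\<^sup>2 + (f1 x)\<^sup>2"
      using \<open>0 < s\<close> by (simp add: power2_diff power_mult_distrib abs_mult mult_ac)
    then have "2 * (s * (\<bar>f1 x\<bar> * \<bar>f x\<bar>)) / s \<le> (s\<^sup>2 * (f x)\<^sup>2 + (f1 x)\<^sup>2) / s"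
      using \<open>0 < s\<close> by (intro divide_right_mono) auto
    moreover have "\<bar>f1 x * f x + f1 x * f x\<bar> = 2 * (s * (\<bar>f1 x\<bar> * \<bar>f x\<bar>)) / s"
      using \<open>0 < s\<close> by (simp add: abs_mult flip: mult_2)
    moreover have "(s\<^sup>2 * (f x)\<^sup>2 + (f1 x)\<^sup>2) / s = s * (f x)\<^sup>2 + (f1 x)\<^sup>2 / s"
      using \<open>0 < s\<close> by (simp add: add_divide_distrib power2_eq_square)
    ultimately show "\<bar>f1 x * f x + f1 x * f x\<bar> \<le> s * (f x)\<^sup>2 + (f1 x)\<^sup>2 / s" by simp
  qed (use int in simp)
  also have "\<dots> = s * (LINT x|lborel. (f x)\<^sup>2) + (LINT x|lborel. (f1 x)\<^sup>2) / s"
    using sq by (simp add: sq_integrable_def)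
  finally show ?thesis by (simp add: power2_eq_square)
qed

text \<open>The tangent to the convex function \<open>b \<mapsto> b\<^sup>p\<close> at \<open>y\<close>, solved for \<open>b\<close>; it replaces Hoelder's
inequality.\<close>

lemma le_powr_tangent:
  fixes b p y :: real
  assumes "1 \<le> p" "0 < y" "0 \<le> b"
  shows "b \<le> b powr p / (p * y powr (p - 1)) + (1 - 1 / p) * y"
proof (cases "p = 1")
  case True
  then show ?thesis using assms by simp
next
  case False
  then have p: "1 < p" using assms by simp
  define q where "q = p / (p - 1)"
  have q: "1 < q" "1 / p + 1 / q = 1" "1 / q = 1 - 1 / p" "(p - 1) * q = p"
    using p by (auto simp: q_def field_simps)
  have "b * y powr (p - 1) \<le> b powr p / p + (y powr (p - 1)) powr q / q"
    by (rule Youngs_inequality) (use p q assms in auto)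
  also have "(y powr (p - 1)) powr q / q = (1 - 1 / p) * (y * y powr (p - 1))"
  proof -
    have "(y powr (p - 1)) powr q = y powr p" using q by (simp add: powr_powr)
    also have "\<dots> = y * y powr (p - 1)" using assms by (simp add: powr_diff)
    finally show ?thesis using q(3) by (simp add: divide_inverse mult.commute)
  qed
  finally have "(b * y powr (p - 1)) / y powr (p - 1)
      \<le> (b powr p / p + (1 - 1 / p) * (y * y powr (p - 1))) / y powr (p - 1)"
    by (intro divide_right_mono) auto
  also have "\<dots> = b powr p / (p * y powr (p - 1)) + (1 - 1 / p) * y"
    using assms by (simp add: add_divide_distrib)
  finally show ?thesis using assms by simp
qed

text \<open>The constant that is subtracted from \<open>\<alpha>\<^sub>0 - \<alpha>\<close> in the decay rate.\<close>

definition interpolation_const :: "real \<Rightarrow> real \<Rightarrow> real" where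
  "interpolation_const p B = (2 * p - 1) / (2 * p) * (2 / p) powr (1 / (2 * p - 1)) * B powr (2 * p / (2 * p - 1))"

text \<open>The tangent inequality bounds \<open>|b| f\<^sup>2\<close> by \<open>|b|\<^sup>p f\<^sup>2 / (p y\<^bsup>p-1\<^esup>) + (1 - 1 / p) y f\<^sup>2\<close>, and in the first
term \<open>f\<^sup>2\<close> is replaced by its supremum. The weight in \<open>square_sup_bound\<close> is chosen as \<open>Y\<close> itself, so
that \<open>\<integral> f'\<^sup>2\<close> gets the factor one.\<close>

lemma Lp_potential_bound:
  fixes p y :: real
  assumes "1 \<le> p" "0 < y" and b: "b \<in> Lp p"
    and f: "is_primitive f f1" and sq: "sq_integrable f" "sq_integrable f1"
    and "0 < (LINT x|lborel. \<bar>b x\<bar> powr p)"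
  defines "Y \<equiv> (LINT x|lborel. \<bar>b x\<bar> powr p) / (p * y powr (p - 1))"
  shows "integrable lborel (\<lambda>x. \<bar>b x\<bar> * (f x)\<^sup>2)"
    and "(LINT x|lborel. \<bar>b x\<bar> * (f x)\<^sup>2)
      \<le> (LINT x|lborel. (f1 x)\<^sup>2) + (Y\<^sup>2 + (1 - 1 / p) * y) * (LINT x|lborel. (f x)\<^sup>2)"
proof -
  define N where "N = (LINT x|lborel. (f x)\<^sup>2)"
  define D where "D = (LINT x|lborel. (f1 x)\<^sup>2)"
  have bm[measurable]: "b \<in> borel_measurable borel" and bi: "integrable lborel (\<lambda>x. \<bar>b x\<bar> powr p)"
    using b by (auto simp: Lp_def)
  have [measurable]: "f \<in> borel_measurable borel" using sq by (simp add: sq_integrable_def)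
  have Y: "0 < Y" unfolding Y_def using assms by simp
  define c where "c = p * y powr (p - 1)"
  have c: "0 < c" using assms by (simp add: c_def)
  define M where "M = Y * N + D / Y"
  have M: "(f x)\<^sup>2 \<le> M" for x
    unfolding M_def N_def D_def by (rule square_sup_bound[OF f sq Y])
  define G where "G x = M / c * (\<bar>b x\<bar> powr p) + (1 - 1 / p) * y * (f x)\<^sup>2" for x
  have Gi: "integrable lborel G"
    unfolding G_def using bi sq by (auto simp: sq_integrable_def)
  have le: "\<bar>b x\<bar> * (f x)\<^sup>2 \<le> G x" for x
  proof -
    have "\<bar>b x\<bar> * (f x)\<^sup>2 \<le> (\<bar>b x\<bar> powr p / c + (1 - 1 / p) * y) * (f x)\<^sup>2"
      unfolding c_def by (intro mult_right_mono le_powr_tangent assms) auto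
    also have "\<dots> = \<bar>b x\<bar> powr p / c * (f x)\<^sup>2 + (1 - 1 / p) * y * (f x)\<^sup>2"
      by (simp add: algebra_simps)
    also have "\<dots> \<le> \<bar>b x\<bar> powr p / c * M + (1 - 1 / p) * y * (f x)\<^sup>2"
      using c by (intro add_right_mono mult_left_mono M) auto
    finally show ?thesis by (simp add: G_def mult.commute[of M])
  qed
  show int: "integrable lborel (\<lambda>x. \<bar>b x\<bar> * (f x)\<^sup>2)"
    by (rule Bochner_Integration.integrable_bound[OF Gi]) (auto intro!: AE_I2 order_trans[OF le abs_ge_self] simp: abs_mult)
  have "(LINT x|lborel. \<bar>b x\<bar> * (f x)\<^sup>2) \<le> integral\<^sup>L lborel G"
    by (intro integral_mono int Gi le)
  also have "\<dots> = M * ((LINT x|lborel. \<bar>b x\<bar> powr p) / c) + (1 - 1 / p) * y * N"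
    unfolding G_def N_def using bi sq by (simp add: sq_integrable_def)
  also have "(LINT x|lborel. \<bar>b x\<bar> powr p) / c = Y" by (simp add: Y_def c_def)
  also have "M * Y = Y\<^sup>2 * N + D" using Y by (simp add: M_def power2_eq_square field_simps)
  finally show "(LINT x|lborel. \<bar>b x\<bar> * (f x)\<^sup>2) \<le> D + (Y\<^sup>2 + (1 - 1 / p) * y) * N"
    by (simp add: algebra_simps)
qed

text \<open>The best \<open>y\<close> in \<open>Lp_potential_bound\<close> solves \<open>y\<^bsup>2p-1\<^esup> = (2 / p) * \<parallel>b\<parallel>\<^bsup>2p\<^esup>\<close>, for which
\<open>Y\<^sup>2 = y / (2 * p)\<close>. It has to be positive, so the case \<open>b = 0\<close> is separate.\<close>

lemma Lp_interpolation:
  fixes p :: real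
  assumes p: "1 \<le> p" and b: "b \<in> Lp p"
    and f: "is_primitive f f1" and sq: "sq_integrable f" "sq_integrable f1"
  shows "integrable lborel (\<lambda>x. \<bar>b x\<bar> * (f x)\<^sup>2)"
    and "(LINT x|lborel. \<bar>b x\<bar> * (f x)\<^sup>2)
      \<le> (LINT x|lborel. (f1 x)\<^sup>2) + interpolation_const p (Lp_norm p b) * (LINT x|lborel. (f x)\<^sup>2)"
proof -
  define I where "I = (LINT x|lborel. \<bar>b x\<bar> powr p)"
  have bm[measurable]: "b \<in> borel_measurable borel" and bi: "integrable lborel (\<lambda>x. \<bar>b x\<bar> powr p)"
    using b by (auto simp: Lp_def)
  have fm[measurable]: "f \<in> borel_measurable borel" using sq by (simp add: sq_integrable_def)
  have "0 \<le> I" by (simp add: I_def)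
  have "integrable lborel (\<lambda>x. \<bar>b x\<bar> * (f x)\<^sup>2) \<and> (LINT x|lborel. \<bar>b x\<bar> * (f x)\<^sup>2)
      \<le> (LINT x|lborel. (f1 x)\<^sup>2) + interpolation_const p (Lp_norm p b) * (LINT x|lborel. (f x)\<^sup>2)"
  proof (cases "I = 0")
    case True
    then have "AE x in lborel. \<bar>b x\<bar> powr p = 0"
      using bi by (simp add: I_def integral_nonneg_eq_0_iff_AE)
    then have ae: "AE x in lborel. \<bar>b x\<bar> * (f x)\<^sup>2 = 0" by eventually_elim simp
    have "integrable lborel (\<lambda>x. \<bar>b x\<bar> * (f x)\<^sup>2)"
      by (rule Bochner_Integration.integrable_cong_AE_imp[of _ "\<lambda>x. 0"]) (use ae in \<open>auto elim: eventually_mono\<close>)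
    moreover have "(LINT x|lborel. \<bar>b x\<bar> * (f x)\<^sup>2) = 0"
      by (rule integral_eq_zero_AE) fact
    moreover have "interpolation_const p (Lp_norm p b) = 0"
      using True by (simp add: interpolation_const_def Lp_norm_def I_def)
    ultimately show ?thesis by simp
  next
    case False
    then have "0 < I" using \<open>0 \<le> I\<close> by simp
    define m where "m = 2 * p - 1"
    have m: "1 \<le> m" "0 < m" using p by (auto simp: m_def)
    \<comment> \<open>a minimiser of \<open>Y\<^sup>2 + (1 - 1 / p) * y\<close>\<close>
    define y where "y = (2 / p) powr (1 / m) * I powr (2 / m)"
    have "0 < y" using p \<open>0 < I\<close> by (simp add: y_def)
    have ym: "y powr m = (2 / p) * I\<^sup>2"
      using p m \<open>0 < I\<close> by (simp add: y_def powr_mult powr_powr powr_numeral)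
    define Y where "Y = I / (p * y powr (p - 1))"
    \<comment> \<open>from \<open>(y\<^bsup>p-1\<^esup>)\<^sup>2 * y = y\<^bsup>2p-1\<^esup>\<close>\<close>
    have "Y\<^sup>2 = y / (2 * p)"
    proof -
      have "(y powr (p - 1))\<^sup>2 * y = y powr m"
        using \<open>0 < y\<close> by (simp add: m_def power2_eq_square flip: powr_add powr_mult_base)
           (simp add: powr_mult_base mult.commute algebra_simps flip: powr_add)
      then have "(y powr (p - 1))\<^sup>2 = 2 / p * I\<^sup>2 / y"
        using ym \<open>0 < y\<close> by (subst nonzero_eq_divide_eq) auto
      then have "Y\<^sup>2 = I\<^sup>2 / (p\<^sup>2 * (2 / p * I\<^sup>2 / y))"
        by (simp add: Y_def power_divide power_mult_distrib)
      also have "\<dots> = y / (2 * p)"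
        using \<open>0 < I\<close> \<open>0 < y\<close> p by (simp add: field_simps power2_eq_square)
      finally show ?thesis .
    qed
    then have "Y\<^sup>2 + (1 - 1 / p) * y = (2 * p - 1) / (2 * p) * y"
      using p by (simp add: field_simps)
    also have "\<dots> = interpolation_const p (Lp_norm p b)"
      using p by (simp add: interpolation_const_def Lp_norm_def y_def m_def powr_powr flip: I_def)
    finally have eq: "Y\<^sup>2 + (1 - 1 / p) * y = interpolation_const p (Lp_norm p b)" .
    show ?thesis
      using Lp_potential_bound[OF p \<open>0 < y\<close> b f sq] \<open>0 < I\<close>
      unfolding I_def[symmetric] Y_def[symmetric] eq by blast
  qed
  then show "integrable lborel (\<lambda>x. \<bar>b x\<bar> * (f x)\<^sup>2)"
    and "(LINT x|lborel. \<bar>b x\<bar> * (f x)\<^sup>2)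
      \<le> (LINT x|lborel. (f1 x)\<^sup>2) + interpolation_const p (Lp_norm p b) * (LINT x|lborel. (f x)\<^sup>2)"
    by blast+
qed

section \<open>Multiplication by bounded functions\<close>

lemma Linfty_bound:
  assumes "a \<in> Linfty"
  obtains M where "0 \<le> M" "AE x in lborel. \<bar>a x\<bar> \<le> M"
proof -
  obtain M where "AE x in lborel. \<bar>a x\<bar> \<le> M" using assms by (auto simp: Linfty_def)
  then have "AE x in lborel. \<bar>a x\<bar> \<le> max 0 M" by eventually_elim auto
  then show ?thesis by (intro that[of "max 0 M"]) auto
qed

lemma Linfty_measurable: "a \<in> Linfty \<Longrightarrow> a \<in> borel_measurable borel"
  by (simp add: Linfty_def)

lemma Linfty_abs: "a \<in> Linfty \<Longrightarrow> (\<lambda>x. \<bar>a x\<bar>) \<in> Linfty"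
  by (auto simp: Linfty_def)

lemma sq_integrable_Linfty_mult:
  assumes a: "a \<in> Linfty" and f: "sq_integrable f"
  shows "sq_integrable (\<lambda>x. a x * f x)"
proof -
  obtain M where M: "0 \<le> M" "AE x in lborel. \<bar>a x\<bar> \<le> M" using Linfty_bound[OF a] .
  have [measurable]: "a \<in> borel_measurable borel" "f \<in> borel_measurable borel"
    using a f by (auto simp: Linfty_def sq_integrable_def)
  have "integrable lborel (\<lambda>x. M\<^sup>2 * (f x)\<^sup>2)" using f by (simp add: sq_integrable_def)
  then have "integrable lborel (\<lambda>x. (a x * f x)\<^sup>2)"
  proof (rule Bochner_Integration.integrable_bound)
    show "AE x in lborel. norm ((a x * f x)\<^sup>2) \<le> norm (M\<^sup>2 * (f x)\<^sup>2)"
      using M(2)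
    proof eventually_elim
      case (elim x)
      then have "(a x)\<^sup>2 \<le> M\<^sup>2" using M(1) by (simp add: abs_le_square_iff[symmetric])
      then show ?case by (simp add: power_mult_distrib mult_right_mono)
    qed
  qed simp
  then show ?thesis by (simp add: sq_integrable_def)
qed

lemma rep_mult_L2:
  assumes "a \<in> Linfty"
  shows "AE x in lborel. rep_L2 (mult_L2 a f) x = a x * rep_L2 f x"
  unfolding mult_L2_def
  by (rule rep_abs_L2) (rule sq_integrable_Linfty_mult[OF assms sq_integrable_rep])

lemma rep_L2_measurable [measurable]: "rep_L2 f \<in> borel_measurable borel"
  using sq_integrable_rep[of f] by (simp add: sq_integrable_def)

lemma inner_mult_L2:
  assumes a: "a \<in> Linfty"
  shows "inner (mult_L2 a f) g = (LINT x|lborel. a x * rep_L2 f x * rep_L2 g x)"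
proof -
  have [measurable]: "a \<in> borel_measurable borel" by (rule Linfty_measurable[OF a])
  show ?thesis
    unfolding inner_L2_eq
    by (rule integral_cong_AE) (use rep_mult_L2[OF a, of f] in \<open>auto elim: eventually_mono\<close>)
qed

lemma mult_L2_Lipschitz:
  assumes a: "a \<in> Linfty"
  obtains K where "0 \<le> K" "\<And>f g. norm (mult_L2 a f - mult_L2 a g) \<le> K * norm (f - g)"
proof -
  obtain K where K: "0 \<le> K" "AE x in lborel. \<bar>a x\<bar> \<le> K" using Linfty_bound[OF a] .
  have "norm (mult_L2 a f - mult_L2 a g) \<le> K * norm (f - g)" for f g
  proof -
    have "ennreal ((norm (mult_L2 a f - mult_L2 a g))\<^sup>2)
        = (\<integral>\<^sup>+x. ennreal ((rep_L2 (mult_L2 a f) x - rep_L2 (mult_L2 a g) x)\<^sup>2) \<partial>lborel)"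
      by (rule norm_diff_L2_nn[symmetric])
    also have "\<dots> \<le> (\<integral>\<^sup>+x. ennreal (K\<^sup>2) * ennreal ((rep_L2 f x - rep_L2 g x)\<^sup>2) \<partial>lborel)"
    proof (rule nn_integral_mono_AE)
      show "AE x in lborel. ennreal ((rep_L2 (mult_L2 a f) x - rep_L2 (mult_L2 a g) x)\<^sup>2)
          \<le> ennreal (K\<^sup>2) * ennreal ((rep_L2 f x - rep_L2 g x)\<^sup>2)"
        using K(2) rep_mult_L2[OF a, of f] rep_mult_L2[OF a, of g]
      proof eventually_elim
        case (elim x)
        have "(rep_L2 (mult_L2 a f) x - rep_L2 (mult_L2 a g) x)\<^sup>2 = (a x)\<^sup>2 * (rep_L2 f x - rep_L2 g x)\<^sup>2"
          using elim by (simp flip: right_diff_distrib power_mult_distrib)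
        also have "\<dots> \<le> K\<^sup>2 * (rep_L2 f x - rep_L2 g x)\<^sup>2"
          using elim(1) K(1) by (intro mult_right_mono) (simp_all add: abs_le_square_iff[symmetric])
        finally show ?case by (simp flip: ennreal_mult)
      qed
    qed
    also have "\<dots> = ennreal ((K * norm (f - g))\<^sup>2)"
      by (simp add: nn_integral_cmult norm_diff_L2_nn power_mult_distrib ennreal_mult)
    finally have "(norm (mult_L2 a f - mult_L2 a g))\<^sup>2 \<le> (K * norm (f - g))\<^sup>2"
      by (simp add: ennreal_le_iff)
    then show ?thesis by (rule power2_le_imp_le) (simp add: K)
  qed
  then show ?thesis using that K(1) by blast
qed

lemma continuous_mult_L2:
  assumes a: "a \<in> Linfty" shows "continuous_on A (mult_L2 a)"
proof -
  obtain K where K: "0 \<le> K" "\<And>f g. norm (mult_L2 a f - mult_L2 a g) \<le> K * norm (f - g)"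
    using mult_L2_Lipschitz[OF a] by blast
  show ?thesis
    by (rule lipschitz_on_continuous_on[of K]) (auto simp: lipschitz_on_def dist_norm K)
qed

definition mass :: "(real \<Rightarrow> real) \<Rightarrow> L2 \<Rightarrow> real" where
  "mass a f = (LINT x|lborel. \<bar>a x\<bar> * (rep_L2 f x)\<^sup>2)"

lemma mass_eq_inner:
  assumes "a \<in> Linfty"
  shows "mass a f = inner (mult_L2 (\<lambda>x. \<bar>a x\<bar>) f) f"
  by (simp add: mass_def inner_mult_L2[OF Linfty_abs[OF assms]] power2_eq_square mult.assoc)

lemma continuous_mass:
  assumes "a \<in> Linfty" shows "continuous_on A (mass a)"
  unfolding mass_eq_inner[OF assms, abs_def]
  by (intro continuous_intros continuous_mult_L2 Linfty_abs assms)

lemma mass_nonneg: "0 \<le> mass a f"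
  by (simp add: mass_def)

lemma integrable_Linfty_square:
  assumes "a \<in> Linfty" "sq_integrable f"
  shows "integrable lborel (\<lambda>x. a x * (f x)\<^sup>2)"
  using sq_integrable_mult[OF sq_integrable_Linfty_mult[OF assms] assms(2)]
  by (simp add: power2_eq_square mult.assoc)

text \<open>Young's inequality with weight \<open>|a|\<close>.\<close>

lemma delay_term_bound:
  assumes a: "a \<in> Linfty" and "0 < r"
  shows "\<bar>inner (mult_L2 a g) f\<bar> \<le> r / 2 * mass a f + 1 / (2 * r) * mass a g"
proof -
  have i: "integrable lborel (\<lambda>x. \<bar>a x\<bar> * (rep_L2 f x)\<^sup>2)" for f
    by (intro integrable_Linfty_square Linfty_abs a sq_integrable_rep)
  have "\<bar>inner (mult_L2 a g) f\<bar> \<le> (LINT x|lborel. \<bar>a x * rep_L2 g x * rep_L2 f x\<bar>)"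
    unfolding inner_mult_L2[OF a] by (rule integral_abs_bound)
  also have "\<dots> \<le> (LINT x|lborel. r / 2 * (\<bar>a x\<bar> * (rep_L2 f x)\<^sup>2) + 1 / (2 * r) * (\<bar>a x\<bar> * (rep_L2 g x)\<^sup>2))"
  proof (rule integral_mono)
    show "integrable lborel (\<lambda>x. \<bar>a x * rep_L2 g x * rep_L2 f x\<bar>)"
      by (intro integrable_abs sq_integrable_mult sq_integrable_Linfty_mult a sq_integrable_rep)
    show "integrable lborel (\<lambda>x. r / 2 * (\<bar>a x\<bar> * (rep_L2 f x)\<^sup>2) + 1 / (2 * r) * (\<bar>a x\<bar> * (rep_L2 g x)\<^sup>2))"
      by (intro Bochner_Integration.integrable_add integrable_mult_right i)
    fix x
    have "0 \<le> (r * \<bar>rep_L2 f x\<bar> - \<bar>rep_L2 g x\<bar>)\<^sup>2 / (2 * r)" using \<open>0 < r\<close> by simp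
    also have "\<dots> = r / 2 * (rep_L2 f x)\<^sup>2 + 1 / (2 * r) * (rep_L2 g x)\<^sup>2 - \<bar>rep_L2 g x\<bar> * \<bar>rep_L2 f x\<bar>"
      using \<open>0 < r\<close> by (simp add: power2_diff power_mult_distrib field_simps power2_eq_square)
    finally have "\<bar>rep_L2 g x\<bar> * \<bar>rep_L2 f x\<bar> \<le> r / 2 * (rep_L2 f x)\<^sup>2 + 1 / (2 * r) * (rep_L2 g x)\<^sup>2"
      by simp
    from mult_left_mono[OF this, of "\<bar>a x\<bar>"]
    show "\<bar>a x * rep_L2 g x * rep_L2 f x\<bar>
        \<le> r / 2 * (\<bar>a x\<bar> * (rep_L2 f x)\<^sup>2) + 1 / (2 * r) * (\<bar>a x\<bar> * (rep_L2 g x)\<^sup>2)"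
      by (simp add: abs_mult distrib_left mult_ac)
  qed
  also have "\<dots> = r / 2 * mass a f + 1 / (2 * r) * mass a g"
    using i by (simp add: mass_def)
  finally show ?thesis .
qed

section \<open>Dissipation and coercivity of the generator\<close>

text \<open>A weak derivative of order \<open>k + 1\<close> is the first weak derivative of the one of order \<open>k\<close>, since
derivatives of test functions are test functions.\<close>

lemma weak_deriv_step:
  assumes "weak_deriv k f g" "weak_deriv (Suc k) f h" "test_function \<phi>"
  shows "(LINT x|lborel. rep_L2 g x * deriv \<phi> x) = - (LINT x|lborel. rep_L2 h x * \<phi> x)"
proof -
  have "(- 1) ^ k * (LINT x|lborel. rep_L2 g x * deriv \<phi> x)
      = (LINT x|lborel. rep_L2 f x * (deriv ^^ k) (deriv \<phi>) x)"
    using assms(1) test_function_deriv[OF assms(3)] by (simp add: weak_deriv_def)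
  also have "(deriv ^^ k) (deriv \<phi>) = (deriv ^^ Suc k) \<phi>" by (simp only: funpow_Suc_right o_apply)
  also have "(LINT x|lborel. rep_L2 f x * (deriv ^^ Suc k) \<phi> x)
      = (- 1) ^ Suc k * (LINT x|lborel. rep_L2 h x * \<phi> x)"
    using assms(2,3) unfolding weak_deriv_def by blast
  finally show ?thesis by (cases "even k") auto
qed

lemma weak_deriv_0: "weak_deriv 0 f f"
  by (simp add: weak_deriv_def)

lemma is_primitive_cong_AE:
  assumes "is_primitive F f" "AE x in lborel. f x = g x" "loc_integrable g"
  shows "is_primitive F g"
  unfolding is_primitive_def
proof (intro conjI allI impI)
  fix a b :: real assume "a \<le> b"
  then have "F b - F a = (LINT x:{a..b}|lborel. f x)" using assms(1) by (simp add: is_primitive_def)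
  also have "\<dots> = (LINT x:{a..b}|lborel. g x)"
    unfolding set_lebesgue_integral_def
    by (rule integral_cong_AE) (use assms in \<open>auto simp: is_primitive_def loc_integrable_def elim: eventually_mono\<close>)
  finally show "F b - F a = (LINT x:{a..b}|lborel. g x)" .
qed fact

lemma sq_integrable_cong_AE:
  assumes "sq_integrable f" "AE x in lborel. f x = g x" "g \<in> borel_measurable borel"
  shows "sq_integrable g"
proof -
  have [measurable]: "f \<in> borel_measurable borel" "g \<in> borel_measurable borel"
    using assms by (auto simp: sq_integrable_def)
  have "integrable lborel (\<lambda>x. (f x)\<^sup>2)" using assms by (simp add: sq_integrable_def)
  then have "integrable lborel (\<lambda>x. (g x)\<^sup>2)"
    by (rule Bochner_Integration.integrable_cong_AE_imp) (use assms(2) in \<open>auto elim: eventually_mono\<close>)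
  then show ?thesis by (simp add: sq_integrable_def)
qed

text \<open>With primitives \<open>F\<close>, \<open>F\<^sub>1\<close>, \<open>F\<^sub>2\<close> representing \<open>f\<close> and its first two derivatives, integration by parts
gives \<open>\<integral> f''' f = - \<integral> F\<^sub>1 F\<^sub>2\<close>, and since \<open>F\<^sub>2\<close> is the derivative of \<open>F\<^sub>1\<close> a second one shows that
this is zero.\<close>

lemma A_op_dissipation:
  assumes lam0: "lam0 \<in> Linfty" and fg: "(f, g) \<in> A_op lam0"
  obtains F F' where "is_primitive F F'" "sq_integrable F" "sq_integrable F'"
    "AE x in lborel. rep_L2 f x = F x"
    "inner g f = - (LINT x|lborel. (F' x)\<^sup>2) - (LINT x|lborel. lam0 x * (F x)\<^sup>2)"
proof -
  obtain f2 f3 where g: "g = - f3 + f2 - mult_L2 lam0 f" and f: "f \<in> sobolev_H 3"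
    and w2: "weak_deriv 2 f f2" and w3: "weak_deriv 3 f f3"
    using fg by (auto simp: A_op_def)
  obtain f1 where w1: "weak_deriv 1 f f1"
    using f unfolding sobolev_H_def by (auto dest: spec[of _ "1::nat"])
  have l: "loc_integrable (rep_L2 v)" for v by (rule loc_integrable_sq_integrable[OF sq_integrable_rep])
  obtain F where F: "is_primitive F (rep_L2 f1)" "AE x in lborel. rep_L2 f x = F x"
    using weakly_differentiable_imp_primitive[OF l l] weak_deriv_step[OF weak_deriv_0, of f f1] w1
    by (metis One_nat_def)
  obtain F1 where F1: "is_primitive F1 (rep_L2 f2)" "AE x in lborel. rep_L2 f1 x = F1 x"
    using weakly_differentiable_imp_primitive[OF l l] weak_deriv_step[OF w1, of f2] w2
    by (metis Suc_1)
  obtain F2 where F2: "is_primitive F2 (rep_L2 f3)" "AE x in lborel. rep_L2 f2 x = F2 x"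
    using weakly_differentiable_imp_primitive[OF l l] weak_deriv_step[OF w2, of f3] w3
    by (metis eval_nat_numeral(3))
  have lp: "loc_integrable G" if "is_primitive G h" for G h
    by (rule loc_integrable_continuous[OF is_primitive_continuous[OF that]])
  note [measurable] = lp[OF F(1), THEN loc_integrable_measurable]
    lp[OF F1(1), THEN loc_integrable_measurable] lp[OF F2(1), THEN loc_integrable_measurable]
    Linfty_measurable[OF lam0]
  have sF: "sq_integrable F" by (rule sq_integrable_cong_AE[OF sq_integrable_rep F(2)]) simp
  have sF1: "sq_integrable F1" by (rule sq_integrable_cong_AE[OF sq_integrable_rep F1(2)]) simp
  have sF2: "sq_integrable F2" by (rule sq_integrable_cong_AE[OF sq_integrable_rep F2(2)]) simp
  have p0: "is_primitive F F1" by (rule is_primitive_cong_AE[OF F(1) F1(2) lp[OF F1(1)]])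
  have p1: "is_primitive F1 F2" by (rule is_primitive_cong_AE[OF F1(1) F2(2) lp[OF F2(1)]])
  have "inner f2 f = (LINT x|lborel. F2 x * F x)"
    unfolding inner_L2_eq by (rule integral_cong_AE) (use F(2) F2(2) in \<open>auto elim: eventually_elim2\<close>)
  also have "\<dots> = - (LINT x|lborel. F1 x * F1 x)"
    by (rule integral_parts_line[OF p1 p0 sF1 sF2 sF sF1])
  finally have i2: "inner f2 f = - (LINT x|lborel. F1 x * F1 x)" .
  have "inner f3 f = (LINT x|lborel. rep_L2 f3 x * F x)"
    unfolding inner_L2_eq by (rule integral_cong_AE) (use F(2) in \<open>auto elim: eventually_mono\<close>)
  also have "\<dots> = - (LINT x|lborel. F1 x * F2 x)"
    by (rule integral_parts_line[OF F2(1) p0 sF2 sq_integrable_rep sF sF1])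
  also have "(LINT x|lborel. F1 x * F2 x) = 0"
    using integral_parts_line[OF p1 p1 sF1 sF2 sF1 sF2] by (simp add: mult.commute)
  finally have i3: "inner f3 f = 0" by simp
  have i0: "inner (mult_L2 lam0 f) f = (LINT x|lborel. lam0 x * (F x)\<^sup>2)"
    unfolding inner_mult_L2[OF lam0]
    by (rule integral_cong_AE) (use F(2) in \<open>auto elim!: eventually_mono simp: power2_eq_square\<close>)
  have "inner g f = - (LINT x|lborel. (F1 x)\<^sup>2) - (LINT x|lborel. lam0 x * (F x)\<^sup>2)"
    unfolding g by (simp add: inner_diff_left inner_add_left i2 i3 i0 power2_eq_square)
  then show ?thesis by (rule that[OF p0 sF sF1 F(2)])
qed

lemma Lp_add:
  assumes "1 \<le> p" "a \<in> Lp p" "b \<in> Lp p"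
  shows "(\<lambda>x. a x + b x) \<in> Lp p"
proof -
  have [measurable]: "a \<in> borel_measurable borel" "b \<in> borel_measurable borel"
    using assms by (auto simp: Lp_def)
  have "integrable lborel (\<lambda>x. 2 powr p * (\<bar>a x\<bar> powr p + \<bar>b x\<bar> powr p))"
    using assms by (auto simp: Lp_def)
  then have "integrable lborel (\<lambda>x. \<bar>a x + b x\<bar> powr p)"
  proof (rule Bochner_Integration.integrable_bound)
    show "AE x in lborel. norm (\<bar>a x + b x\<bar> powr p) \<le> norm (2 powr p * (\<bar>a x\<bar> powr p + \<bar>b x\<bar> powr p))"
    proof (rule AE_I2)
      fix x
      have "\<bar>a x + b x\<bar> powr p \<le> (2 * max \<bar>a x\<bar> \<bar>b x\<bar>) powr p"
        using assms(1) by (intro powr_mono2) auto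
      also have "\<dots> = 2 powr p * max \<bar>a x\<bar> \<bar>b x\<bar> powr p" by (simp add: powr_mult)
      also have "\<dots> \<le> 2 powr p * (\<bar>a x\<bar> powr p + \<bar>b x\<bar> powr p)"
        by (intro mult_left_mono) (auto simp: max_def)
      finally show "norm (\<bar>a x + b x\<bar> powr p) \<le> norm (2 powr p * (\<bar>a x\<bar> powr p + \<bar>b x\<bar> powr p))"
        by simp
    qed
  qed simp
  then show ?thesis by (simp add: Lp_def)
qed

text \<open>Pointwise \<open>\<kappa> |\<lambda>| - \<lambda>\<^sub>0 + \<alpha>\<^sub>0 - \<alpha> \<le> |\<beta> + \<beta>\<^sub>0|\<close>; the potential on the right is absorbed by the dissipation
\<open>\<integral> F'\<^sup>2\<close> through \<open>Lp_interpolation\<close>.\<close>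

lemma A_op_coercive:
  assumes p: "1 \<le> p" and lam: "lam \<in> Linfty" and lam0: "lam0 \<in> Linfty"
    and b: "\<beta> \<in> Lp p" and b0: "\<beta>0 \<in> Lp p"
    and le0: "AE x in lborel. lam0 x \<ge> \<alpha>0 - \<beta>0 x"
    and le: "AE x in lborel. \<kappa> * \<bar>lam x\<bar> \<le> \<alpha> + \<beta> x"
    and fg: "(f, g) \<in> A_op lam0"
  shows "inner g f \<le> - ((\<alpha>0 - \<alpha> - interpolation_const p (Lp_norm p (\<lambda>x. \<beta> x + \<beta>0 x))) * (norm f)\<^sup>2
    + \<kappa> * mass lam f)"
proof -
  obtain F F' where F: "is_primitive F F'" "sq_integrable F" "sq_integrable F'"
    and ae: "AE x in lborel. rep_L2 f x = F x"
    and gf: "inner g f = - (LINT x|lborel. (F' x)\<^sup>2) - (LINT x|lborel. lam0 x * (F x)\<^sup>2)"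
    using A_op_dissipation[OF lam0 fg] .
  have [measurable]: "F \<in> borel_measurable borel"
      "lam \<in> borel_measurable borel"
    using F lam by (auto simp: sq_integrable_def Linfty_def)
  define N where "N = (LINT x|lborel. (F x)\<^sup>2)"
  have N: "(norm f)\<^sup>2 = N"
    unfolding norm_L2_sq N_def by (rule integral_cong_AE) (use ae in \<open>auto elim: eventually_mono\<close>)
  have mass: "mass lam f = (LINT x|lborel. \<bar>lam x\<bar> * (F x)\<^sup>2)"
    unfolding mass_def by (rule integral_cong_AE) (use ae in \<open>auto elim: eventually_mono\<close>)
  note interp = Lp_interpolation[OF p Lp_add[OF p b b0] F]
  have i: "integrable lborel (\<lambda>x. \<bar>lam x\<bar> * (F x)\<^sup>2)" "integrable lborel (\<lambda>x. lam0 x * (F x)\<^sup>2)"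
    "integrable lborel (\<lambda>x. (F x)\<^sup>2)"
    using F(2) by (auto intro!: integrable_Linfty_square lam lam0 Linfty_abs simp: sq_integrable_def)
  have "\<kappa> * mass lam f - (LINT x|lborel. lam0 x * (F x)\<^sup>2) + (\<alpha>0 - \<alpha>) * N
      = (LINT x|lborel. \<kappa> * (\<bar>lam x\<bar> * (F x)\<^sup>2) - lam0 x * (F x)\<^sup>2 + (\<alpha>0 - \<alpha>) * (F x)\<^sup>2)"
    using i by (simp add: mass N_def)
  also have "\<dots> \<le> (LINT x|lborel. \<bar>\<beta> x + \<beta>0 x\<bar> * (F x)\<^sup>2)"
  proof (rule integral_mono_AE)
    show "AE x in lborel. \<kappa> * (\<bar>lam x\<bar> * (F x)\<^sup>2) - lam0 x * (F x)\<^sup>2 + (\<alpha>0 - \<alpha>) * (F x)\<^sup>2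
        \<le> \<bar>\<beta> x + \<beta>0 x\<bar> * (F x)\<^sup>2"
      using le le0
    proof eventually_elim
      case (elim x)
      then have "\<kappa> * \<bar>lam x\<bar> - lam0 x + (\<alpha>0 - \<alpha>) \<le> \<bar>\<beta> x + \<beta>0 x\<bar>" by linarith
      from mult_right_mono[OF this, of "(F x)\<^sup>2"] show ?case by (simp add: algebra_simps)
    qed
  qed (use i interp(1) in auto)
  also note interp(2)
  finally show ?thesis unfolding gf N by (simp add: N_def algebra_simps)
qed

text \<open>The smallness hypothesis raised to the power \<open>2p / (2p - 1)\<close>, as
\<open>interpolation_const p B = c_const p * B\<^bsup>2p/(2p-1)\<^esup>\<close>.\<close>

lemma interpolation_const_less:
  assumes p: "1 \<le> p" and "0 < d" "0 \<le> B"
    and B: "B < (d / c_const p) powr (1 - 1 / (2 * p))"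
  shows "interpolation_const p B < d"
proof -
  define r where "r = 2 * p / (2 * p - 1)"
  have r: "0 < r" "(1 - 1 / (2 * p)) * r = 1" using p by (auto simp: r_def field_simps)
  have c: "0 < c_const p" unfolding c_const_def using p by (intro mult_pos_pos) (auto simp: field_simps)
  have "B powr r < ((d / c_const p) powr (1 - 1 / (2 * p))) powr r"
    using B r(1) assms(3) by (intro powr_less_mono2)
  also have "\<dots> = d / c_const p" using r(2) \<open>0 < d\<close> c by (simp add: powr_powr)
  finally have "c_const p * B powr r < d" using c by (simp add: field_simps)
  moreover have "interpolation_const p B = c_const p * B powr r"
    using p by (simp add: interpolation_const_def c_const_def r_def diff_divide_distrib)
  ultimately show ?thesis by simp
qed

lemma Lp_norm_nonneg: "0 \<le> Lp_norm p b"
  by (simp add: Lp_norm_def)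


section \<open>Decay of the energy\<close>

definition memory :: "real \<Rightarrow> (real \<Rightarrow> real) \<Rightarrow> real \<Rightarrow> real" where
  "memory \<tau> m t = (LINT s:{t - \<tau>..t}|lborel. exp (- (t - s)) * m s)"

text \<open>In terms of a primitive \<open>P\<close> of \<open>exp s * m s\<close> the memory term is \<open>exp (- t) * (P t - P (t - \<tau>))\<close>.
Only right derivatives are available at \<open>t = 0\<close>, where \<open>t - \<tau>\<close> is the left end of the domain
of \<open>m\<close>.\<close>

lemma memory_regularity:
  fixes m :: "real \<Rightarrow> real"
  assumes m: "continuous_on {- \<tau>..} m" and "0 < \<tau>"
  shows "continuous_on {0..T} (memory \<tau> m)"
    and "0 \<le> t \<Longrightarrow> ((\<lambda>h. (memory \<tau> m (t + h) - memory \<tau> m t) / h)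
      \<longlongrightarrow> - memory \<tau> m t + m t - exp (- \<tau>) * m (t - \<tau>)) (at_right 0)"
proof -
  define G where "G s = exp s * m s" for s
  define P where "P t = integral {- \<tau>..t} G" for t
  have G: "continuous_on {- \<tau>..} G"
    unfolding G_def by (intro continuous_intros m)
  have Gi: "G integrable_on {a..b}" if "- \<tau> \<le> a" for a b
    using that by (intro integrable_continuous_interval continuous_on_subset[OF G]) auto
  have Pdiff: "P b - P a = integral {a..b} G" if "- \<tau> \<le> a" "a \<le> b" for a b
    unfolding P_def
    using Henstock_Kurzweil_Integration.integral_combine[of "- \<tau>" a b G] Gi that by simp
  have mem: "memory \<tau> m t = exp (- t) * (P t - P (t - \<tau>))" if "0 \<le> t" for t
  proof -
    have "continuous_on {t - \<tau>..t} (\<lambda>s. exp (- (t - s)) * m s)"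
      using that by (intro continuous_intros continuous_on_subset[OF m]) auto
    then have "memory \<tau> m t = integral {t - \<tau>..t} (\<lambda>s. exp (- (t - s)) * m s)"
      unfolding memory_def by (intro set_borel_integral_eq_integral borel_integrable_atLeastAtMost')
    also have "\<dots> = integral {t - \<tau>..t} (\<lambda>s. exp (- t) * G s)"
      by (intro integral_cong) (simp add: G_def exp_diff exp_minus field_simps)
    also have "\<dots> = exp (- t) * integral {t - \<tau>..t} G" by simp
    also have "integral {t - \<tau>..t} G = P t - P (t - \<tau>)"
      using that \<open>0 < \<tau>\<close> by (intro Pdiff[symmetric]) auto
    finally show ?thesis .
  qed
  have Pc: "continuous_on {- \<tau>..b} P" for b
    unfolding P_def by (intro indefinite_integral_continuous_1 Gi) simp
  have "continuous_on {0..T} (\<lambda>t. exp (- t) * (P t - P (t - \<tau>)))"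
  proof (intro continuous_intros)
    show "continuous_on {0..T} P" using \<open>0 < \<tau>\<close> by (intro continuous_on_subset[OF Pc[of T]]) auto
    show "continuous_on {0..T} (\<lambda>t. P (t - \<tau>))"
      using \<open>0 < \<tau>\<close> by (intro continuous_on_compose2[OF Pc[of T]] continuous_intros) auto
  qed
  then show "continuous_on {0..T} (memory \<tau> m)"
    by (rule continuous_on_eq) (simp add: mem)
  assume t: "0 \<le> t"
  have avg: "((\<lambda>h. (P (t' + h) - P t') / h) \<longlongrightarrow> G t') (at_right 0)" if "- \<tau> \<le> t'" for t'
  proof -
    have "((\<lambda>h. integral {t'..t' + h} G /\<^sub>R h) \<longlongrightarrow> G t') (at_right 0)"
      using that by (intro right_average_continuous continuous_on_subset[OF G]) auto
    then show ?thesis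
    proof (rule Lim_transform_eventually)
      show "\<forall>\<^sub>F h in at_right 0. integral {t'..t' + h} G /\<^sub>R h = (P (t' + h) - P t') / h"
        using eventually_at_right_less[of "0::real"]
        by eventually_elim (use that in \<open>simp add: Pdiff divide_inverse mult.commute\<close>)
    qed
  qed
  have expq: "((\<lambda>h. (exp (- (t + h)) - exp (- t)) / h) \<longlongrightarrow> - exp (- t)) (at_right 0)"
  proof -
    have "((\<lambda>h. exp (- h)) has_field_derivative - exp (- t)) (at t)"
      by (auto intro!: derivative_eq_intros)
    then have "((\<lambda>h. (exp (- (t + h)) - exp (- t)) / h) \<longlongrightarrow> - exp (- t)) (at 0)"
      by (simp add: DERIV_def)
    then show ?thesis by (rule Lim_at_imp_Lim_at_within)
  qed
  have exp0: "((\<lambda>h. exp (- (t + h))) \<longlongrightarrow> exp (- (t + 0))) (at_right 0)"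
    by (intro tendsto_intros)
  have lim: "((\<lambda>h. exp (- (t + h)) * ((P (t + h) - P t) / h - (P (t - \<tau> + h) - P (t - \<tau>)) / h)
        + (exp (- (t + h)) - exp (- t)) / h * (P t - P (t - \<tau>)))
      \<longlongrightarrow> exp (- (t + 0)) * (G t - G (t - \<tau>)) + - exp (- t) * (P t - P (t - \<tau>))) (at_right 0)"
    using t \<open>0 < \<tau>\<close> by (intro tendsto_intros exp0 expq avg) auto
  have eq: "exp (- (t + 0)) * (G t - G (t - \<tau>)) + - exp (- t) * (P t - P (t - \<tau>))
      = - memory \<tau> m t + m t - exp (- \<tau>) * m (t - \<tau>)"
    by (simp add: mem[OF t] G_def exp_diff exp_minus field_simps)
  have ev: "\<forall>\<^sub>F h in at_right 0.
      exp (- (t + h)) * ((P (t + h) - P t) / h - (P (t - \<tau> + h) - P (t - \<tau>)) / h)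
        + (exp (- (t + h)) - exp (- t)) / h * (P t - P (t - \<tau>))
      = (memory \<tau> m (t + h) - memory \<tau> m t) / h"
    using eventually_at_right_less[of "0::real"]
  proof eventually_elim
    case (elim h)
    have "t + h - \<tau> = t - \<tau> + h" by simp
    then have "memory \<tau> m (t + h) - memory \<tau> m t
        = exp (- (t + h)) * ((P (t + h) - P t) - (P (t - \<tau> + h) - P (t - \<tau>)))
        + (exp (- (t + h)) - exp (- t)) * (P t - P (t - \<tau>))"
      using t elim by (simp only: mem) (simp add: mem algebra_simps)
    moreover have "x * (A / h - B / h) + y / h * D = (x * (A - B) + y * D) / h" for x A B y D
      by (simp add: add_divide_distrib diff_divide_distrib right_diff_distrib)
    ultimately show ?case by simp
  qed
  show "((\<lambda>h. (memory \<tau> m (t + h) - memory \<tau> m t) / h)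
      \<longlongrightarrow> - memory \<tau> m t + m t - exp (- \<tau>) * m (t - \<tau>)) (at_right 0)"
    using Lim_transform_eventually[OF lim ev] unfolding eq .
qed

lemma memory_nonneg:
  assumes "\<And>s. 0 \<le> m s" shows "0 \<le> memory \<tau> m t"
  unfolding memory_def set_lebesgue_integral_def using assms by (intro integral_nonneg_AE) auto

lemma energy_eq: "energy \<tau> lam u t = (norm (u t))\<^sup>2 / 2 + memory \<tau> (\<lambda>s. mass lam (u s)) t / 2"
  by (simp add: energy_def norm_L2_sq memory_def mass_def)

text \<open>The upper right Dini derivative of the energy is at most
\<open>- \<delta> \<parallel>u\<parallel>\<^sup>2 - memory / 2\<close>: the weight \<open>(e\<^sup>\<tau> + 1) / 2\<close> in the coercivity pays for the
\<open>e\<^sup>\<tau> / 2\<close> from the delay term and the \<open>1 / 2\<close> from the memory term at time \<open>t\<close>, and the loss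
\<open>e\<^sup>-\<^sup>\<tau> / 2\<close> of the memory term at time \<open>t - \<tau>\<close> pays for the delayed value.\<close>

lemma energy_decay:
  assumes "0 < \<tau>" and lam: "lam \<in> Linfty" and S: "C0_semigroup S"
    and coercive: "\<And>f g. (f, g) \<in> generator S \<Longrightarrow>
      inner g f \<le> - (\<delta> * (norm f)\<^sup>2 + (exp \<tau> + 1) / 2 * mass lam f)"
    and mild: "mild_solution \<tau> S lam u0 u" and \<gamma>: "\<gamma> \<le> 2 * \<delta>" "\<gamma> \<le> 1" and "0 \<le> T"
  shows "energy \<tau> lam u T \<le> energy \<tau> lam u 0 * exp (- \<gamma> * T)"
proof -
  have uc: "continuous_on {- \<tau>..} u" using mild by (simp add: mild_solution_def)
  define m where "m s = mass lam (u s)" for s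
  have mc: "continuous_on {- \<tau>..} m"
    unfolding m_def by (intro continuous_on_compose2[OF continuous_mass[OF lam] uc]) auto
  define F where "F s = - mult_L2 lam (u (s - \<tau>))" for s
  have Fc: "continuous_on {0..} F"
    unfolding F_def
    by (intro continuous_intros continuous_on_compose2[OF continuous_mult_L2[OF lam, of UNIV]]
        continuous_on_compose2[OF uc]) auto
  define Q where "Q f = \<delta> * (norm f)\<^sup>2 + (exp \<tau> + 1) / 2 * mass lam f" for f
  have Qc: "continuous_on UNIV Q"
    unfolding Q_def by (intro continuous_intros continuous_mass lam)
  have u: "u t = blinfun_apply (S t) (u0 0) + integral {0..t} (\<lambda>s. blinfun_apply (S (t - s)) (F s))"
    if "0 \<le> t" for t
    using mild that by (simp add: mild_solution_def F_def blinfun.minus_right)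
  define V where "V = memory \<tau> m"
  note V = memory_regularity[OF mc \<open>0 < \<tau>\<close>, folded V_def]
  have E: "energy \<tau> lam u = (\<lambda>t. (norm (u t))\<^sup>2 / 2 + V t / 2)"
    by (rule ext) (simp add: energy_eq V_def m_def[abs_def])
  define c where "c t = - Q (u t) + inner (F t) (u t) + (- V t + m t - exp (- \<tau>) * m (t - \<tau>)) / 2" for t
  show ?thesis
  proof (rule dini_gronwall[where c = c])
    show "continuous_on {0..T} (energy \<tau> lam u)"
      unfolding E using \<open>0 < \<tau>\<close> by (intro continuous_intros V(1) continuous_on_subset[OF uc]) auto
    show "0 \<le> T" by fact
    fix t :: real assume t: "0 \<le> t"
    show "c t \<le> - \<gamma> * energy \<tau> lam u t"
    proof -
      have "inner (F t) (u t) \<le> \<bar>inner (mult_L2 lam (u (t - \<tau>))) (u t)\<bar>"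
        unfolding F_def by simp
      also have "\<dots> \<le> exp \<tau> / 2 * m t + 1 / (2 * exp \<tau>) * m (t - \<tau>)"
        unfolding m_def by (rule delay_term_bound[OF lam]) simp
      also have "1 / (2 * exp \<tau>) = exp (- \<tau>) / 2" by (simp add: exp_minus field_simps)
      finally have "c t \<le> - (\<delta> * (norm (u t))\<^sup>2) - V t / 2"
        by (simp add: c_def Q_def m_def[of t] field_simps)
      also have "\<dots> \<le> - \<gamma> * ((norm (u t))\<^sup>2 / 2 + V t / 2)"
      proof -
        have "0 \<le> V t" unfolding V_def m_def by (intro memory_nonneg mass_nonneg)
        from mult_right_mono[OF \<gamma>(2) this] mult_right_mono[OF \<gamma>(1), of "(norm (u t))\<^sup>2"]
        show ?thesis by (simp add: algebra_simps)
      qed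
      finally show ?thesis by (simp add: E)
    qed
    fix \<eta> :: real assume \<eta>: "0 < \<eta>"
    have "\<forall>\<^sub>F h in at_right 0. (norm (u (t + h)))\<^sup>2 / 2 - (norm (u t))\<^sup>2 / 2
        \<le> h * (- Q (u t) + inner (F t) (u t) + \<eta> / 2)"
      by (rule mild_solution_dini[OF S _ Qc Fc u t]) (use coercive \<eta> in \<open>auto simp: Q_def\<close>)
    moreover have "\<forall>\<^sub>F h in at_right 0. (V (t + h) - V t) / h
        < (- V t + m t - exp (- \<tau>) * m (t - \<tau>)) + \<eta>"
      using V(2)[OF t] \<eta> by (intro order_tendstoD(2)) auto
    ultimately show "\<forall>\<^sub>F h in at_right 0.
        energy \<tau> lam u (t + h) - energy \<tau> lam u t \<le> h * (c t + \<eta>)"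
      using eventually_at_right_less[of "0::real"]
    proof eventually_elim
      case (elim h)
      then have "V (t + h) - V t \<le> h * ((- V t + m t - exp (- \<tau>) * m (t - \<tau>)) + \<eta>)"
        by (simp add: pos_divide_less_eq mult.commute)
      moreover have "h * (c t + \<eta>) = h * (- Q (u t) + inner (F t) (u t) + \<eta> / 2)
          + h * ((- V t + m t - exp (- \<tau>) * m (t - \<tau>)) + \<eta>) / 2"
        by (simp add: c_def field_simps)
      ultimately show ?case using elim(1) unfolding E by linarith
    qed
  qed
qed

lemma C_init_eq_energy:
  assumes "0 < \<tau>" "mild_solution \<tau> S lam u0 u"
  shows "C_init \<tau> lam u0 = energy \<tau> lam u 0"
proof -
  have u: "u s = u0 s" if "- \<tau> \<le> s" "s \<le> 0" for s
    using assms that by (simp add: mild_solution_def)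
  have "(LINT s:{- \<tau>..0}|lborel. exp s * (LINT x|lborel. \<bar>lam x\<bar> * (rep_L2 (u0 s) x)\<^sup>2))
      = (LINT s:{- \<tau>..0}|lborel. exp s * (LINT x|lborel. \<bar>lam x\<bar> * (rep_L2 (u s) x)\<^sup>2))"
    unfolding set_lebesgue_integral_def
    by (intro Bochner_Integration.integral_cong) (auto simp: u split: split_indicator)
  then show ?thesis
    using u[of 0] \<open>0 < \<tau>\<close> by (simp add: C_init_def energy_def norm_L2_sq)
qed

theorem theorem4p1:
  fixes \<tau> p \<alpha>0 \<alpha> :: real
    and lam lam0 \<beta>0 \<beta> :: "real \<Rightarrow> real"
    and S :: "real \<Rightarrow> L2 \<Rightarrow>\<^sub>L L2"
  assumes "\<tau> > 0" and "1 \<le> p"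
    and "lam \<in> Linfty" and "lam0 \<in> Linfty"
    and "\<alpha>0 > 0" and "\<beta>0 \<in> Lp p"
    and "AE x in lborel. lam0 x \<ge> \<alpha>0 - \<beta>0 x"
    and "Lp_norm p \<beta>0 < (\<alpha>0 / c_const p) powr (1 - 1 / (2 * p))"
    and "\<beta> \<in> Lp p"
    and "AE x in lborel. (exp \<tau> + 1) / 2 * \<bar>lam x\<bar> \<le> \<alpha> + \<beta> x"
    and "0 \<le> \<alpha>" and "\<alpha> < \<alpha>0"
    and "Lp_norm p (\<lambda>x. \<beta>0 x + \<beta> x) < ((\<alpha>0 - \<alpha>) / c_const p) powr (1 - 1 / (2 * p))"
    and "generates (A_op lam0) S"
  shows "exponentially_stable \<tau> S lam \<and>
    (\<forall>u0 u. continuous_on {- \<tau>..0} u0 \<longrightarrow> mild_solution \<tau> S lam u0 u \<longrightarrow>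
       C_init \<tau> lam u0 = energy \<tau> lam u 0 \<and>
       (\<forall>t\<ge>0. energy \<tau> lam u t \<le> C_init \<tau> lam u0 * exp (- gamma_rate p \<alpha>0 \<alpha> \<beta>0 \<beta> * t)))"
proof -
  define K where "K = interpolation_const p (Lp_norm p (\<lambda>x. \<beta> x + \<beta>0 x))"
  have S: "C0_semigroup S" and gen: "generator S = A_op lam0"
    using assms(14) by (simp_all add: generates_def)
  have rate: "gamma_rate p \<alpha>0 \<alpha> \<beta>0 \<beta> = min (2 * (\<alpha>0 - \<alpha> - K)) 1"
    by (simp add: gamma_rate_def K_def interpolation_const_def)
  have "K < \<alpha>0 - \<alpha>"
    unfolding K_def
    by (rule interpolation_const_less[OF \<open>1 \<le> p\<close> _ Lp_norm_nonneg])
      (use assms(12,13) in \<open>simp_all add: add.commute\<close>)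
  then have pos: "0 < gamma_rate p \<alpha>0 \<alpha> \<beta>0 \<beta>" by (simp add: rate)
  have main: "energy \<tau> lam u t \<le> C_init \<tau> lam u0 * exp (- gamma_rate p \<alpha>0 \<alpha> \<beta>0 \<beta> * t)"
    if mild: "mild_solution \<tau> S lam u0 u" and "0 \<le> t" for u0 u t
    unfolding C_init_eq_energy[OF \<open>\<tau> > 0\<close> mild]
  proof (rule energy_decay[OF \<open>\<tau> > 0\<close> \<open>lam \<in> Linfty\<close> S _ mild _ _ \<open>0 \<le> t\<close>])
    show "inner g f \<le> - ((\<alpha>0 - \<alpha> - K) * (norm f)\<^sup>2 + (exp \<tau> + 1) / 2 * mass lam f)"
      if "(f, g) \<in> generator S" for f g
      unfolding K_def using that gen assms by (intro A_op_coercive) auto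
  qed (simp_all add: rate)
  have "exponentially_stable \<tau> S lam"
    unfolding exponentially_stable_def using pos main by blast
  then show ?thesis using main C_init_eq_energy[OF \<open>\<tau> > 0\<close>] by blast
qed

end
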